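(* There exists an ergodic probability measure-preserving bijection $T$ (of a standard atomless probability space) which is $\mathrm{L}^{<1/2}$ orbit equivalent (in particular Shannon orbit equivalent) to the dyadic odometer but not evenly Kakutani equivalent to it.
   Context: Probability spaces are standard and atomless; $\mathrm{Aut}(X,\mu)$ is the group of bimeasurable $\mu$-preserving bijections of $(X,\mu)$, up to null sets. Orbit equivalence. Two aperiodic transformations $S\in\mathrm{Aut}(X,\mu)$ and $T\in\mathrm{Aut}(Y,\nu)$ are orbit equivalent if there is a bimeasurable bijection $\Psi\colon X\to Y$ with $\Psi_\star\mu=\nu$ such that $S$ and $\Psi^{-1}T\Psi$ have the same orbit at almost every point of $X$; $\Psi$ is called an orbit equivalence. Its cocycles are the measurable functions $c_S\colon X\to\mathbb{Z}$, $c_T\colon Y\to\mathbb{Z}$, uniquely defined almost everywhere by $Sx=\Psi^{-1}T^{c_S(x)}\Psi(x)$ and $Ty=\Psi S^{c_T(y)}\Psi^{-1}(y)$. The transformations are $\mathrm{L}^{<p}$ orbit equivalent if there is an orbit equivalence $\Psi$ such that for every $q$ with $0<q<p$ both $\int_X|c_S|^q\,d\mu$ and $\int_Y|c_T|^q\,d\nu$ are finite. They are Shannon orbit equivalent if there is an orbit equivalence whose cocycles are both Shannon, where a measurable function $f$ with values in $\mathbb{Z}$ on a probability space $(X,\mu)$ is Shannon if $-\sum_{n\in\mathbb{Z}}\mu(f^{-1}(n))\log\mu(f^{-1}(n))<+\infty$ (with $0\log 0=0$). Even Kakutani equivalence. For $T\in\mathrm{Aut}(X,\mu)$ and $A\subset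 X$ measurable of positive measure, the induced transformation $T_A$ is $T_Ax=T^{r_A(x)}x$ on $A$, where $r_A(x)=\inf\{k\geq 1\mid T^kx\in A\}$; it preserves the normalized measure $\mu_A=\mu(\cdot)/\mu(A)$ on $A$. Two ergodic transformations $T$ on $(X,\mu)$ and $S$ on $(Y,\nu)$ are evenly Kakutani equivalent if there are measurable sets $A\subset X$, $B\subset Y$ of positive measure with $\mu(A)=\nu(B)$ such that $T_A$ and $S_B$ are isomorphic (conjugate). Dyadic odometer. For integers $q_n\geq 2$, the odometer on $X=\prod_{n\geq 0}\{0,\ldots,q_n-1\}$, equipped with the product $\mu$ of the uniform measures, is the addition of $(1,0,0,\ldots)$ with carry over to the right. The dyadic odometer is (up to conjugacy) the one with $q_n=2$ for all $n$. *)

theory Defs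
  imports "HOL-Probability.Probability"
begin

section \<open>Standard atomless probability spaces and their automorphisms\<close>

text \<open>The measurable sets are the Borel sets of some Polish topology on the space.\<close>

definition standard_borel :: "'a measure \<Rightarrow> bool" where
  "standard_borel M \<longleftrightarrow>
     (\<exists>X :: 'a topology. completely_metrizable_space X \<and> second_countable X \<and>
        topspace X = space M \<and> sets M = sigma_sets (topspace X) {U. openin X U})"

definition atomless :: "'a measure \<Rightarrow> bool" where
  "atomless M \<longleftrightarrow>
     (\<forall>A\<in>sets M. emeasure M A > 0 \<longrightarrow>
        (\<exists>B\<in>sets M. B \<subseteq> A \<and> 0 < emeasure M B \<and> emeasure M B < emeasure M A))"

definition standard_atomless_prob_space :: "'a measure \<Rightarrow> bool" where
  "standard_atomless_prob_space M \<longleftrightarrow> prob_space M \<and> standard_borel M \<and> atomless M"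

text \<open>Every such space is isomorphic to one whose underlying set lives in a given uncountable Polish
  type such as \<open>nat \<Rightarrow> nat\<close>, so existence statements may fix the type.\<close>

definition mp_bij :: "'a measure \<Rightarrow> 'b measure \<Rightarrow> ('a \<Rightarrow> 'b) \<Rightarrow> bool" where
  "mp_bij M N \<Psi> \<longleftrightarrow>
     bij_betw \<Psi> (space M) (space N) \<and> \<Psi> \<in> M \<rightarrow>\<^sub>M N \<and>
     inv_into (space M) \<Psi> \<in> N \<rightarrow>\<^sub>M M \<and> distr M N \<Psi> = N"

text \<open>Elements of \<open>Aut(X,\<mu>)\<close> are given by representatives; every notion below is insensitive
  to modifications of the representatives on null sets.\<close>

definition aut :: "'a measure \<Rightarrow> ('a \<Rightarrow> 'a) \<Rightarrow> bool" where
  "aut M T \<longleftrightarrow> mp_bij M M T"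

definition ergodic :: "'a measure \<Rightarrow> ('a \<Rightarrow> 'a) \<Rightarrow> bool" where
  "ergodic M T \<longleftrightarrow>
     (\<forall>A\<in>sets M. T -` A \<inter> space M = A \<longrightarrow> measure M A = 0 \<or> measure M A = 1)"

definition aperiodic :: "'a measure \<Rightarrow> ('a \<Rightarrow> 'a) \<Rightarrow> bool" where
  "aperiodic M T \<longleftrightarrow> (AE x in M. \<forall>n\<ge>1. (T ^^ n) x \<noteq> x)"

section \<open>Orbit equivalence\<close>

definition int_iter :: "'a measure \<Rightarrow> ('a \<Rightarrow> 'a) \<Rightarrow> int \<Rightarrow> 'a \<Rightarrow> 'a" where
  "int_iter M T k =
     (if 0 \<le> k then T ^^ nat k else (inv_into (space M) T) ^^ nat (- k))"

definition orbit_of :: "'a measure \<Rightarrow> ('a \<Rightarrow> 'a) \<Rightarrow> 'a \<Rightarrow> 'a set" where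
  "orbit_of M T x = range (\<lambda>k::int. int_iter M T k x)"

definition orbit_equivalence ::
  "'a measure \<Rightarrow> ('a \<Rightarrow> 'a) \<Rightarrow> 'b measure \<Rightarrow> ('b \<Rightarrow> 'b) \<Rightarrow> ('a \<Rightarrow> 'b) \<Rightarrow> bool" where
  "orbit_equivalence M S N T \<Psi> \<longleftrightarrow>
     aut M S \<and> aperiodic M S \<and> aut N T \<and> aperiodic N T \<and> mp_bij M N \<Psi> \<and>
     (AE x in M. orbit_of M S x = orbit_of M (inv_into (space M) \<Psi> \<circ> T \<circ> \<Psi>) x)"

definition oe_cocycles ::
  "'a measure \<Rightarrow> ('a \<Rightarrow> 'a) \<Rightarrow> 'b measure \<Rightarrow> ('b \<Rightarrow> 'b) \<Rightarrow> ('a \<Rightarrow> 'b) \<Rightarrow>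
    ('a \<Rightarrow> int) \<Rightarrow> ('b \<Rightarrow> int) \<Rightarrow> bool" where
  "oe_cocycles M S N T \<Psi> c\<^sub>S c\<^sub>T \<longleftrightarrow>
     c\<^sub>S \<in> M \<rightarrow>\<^sub>M count_space UNIV \<and> c\<^sub>T \<in> N \<rightarrow>\<^sub>M count_space UNIV \<and>
     (AE x in M. S x = inv_into (space M) \<Psi> (int_iter N T (c\<^sub>S x) (\<Psi> x))) \<and>
     (AE y in N. T y = \<Psi> (int_iter M S (c\<^sub>T y) (inv_into (space M) \<Psi> y)))"

definition L_less_orbit_equivalent ::
  "real \<Rightarrow> 'a measure \<Rightarrow> ('a \<Rightarrow> 'a) \<Rightarrow> 'b measure \<Rightarrow> ('b \<Rightarrow> 'b) \<Rightarrow> bool" where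
  "L_less_orbit_equivalent p M S N T \<longleftrightarrow>
     (\<exists>\<Psi> c\<^sub>S c\<^sub>T. orbit_equivalence M S N T \<Psi> \<and> oe_cocycles M S N T \<Psi> c\<^sub>S c\<^sub>T \<and>
        (\<forall>q. 0 < q \<and> q < p \<longrightarrow>
           integrable M (\<lambda>x. \<bar>real_of_int (c\<^sub>S x)\<bar> powr q) \<and>
           integrable N (\<lambda>y. \<bar>real_of_int (c\<^sub>T y)\<bar> powr q)))"

text \<open>The terms of the sum are nonnegative, so summability is finiteness of the sum;
  \<open>0 log 0 = 0\<close> holds automatically.\<close>

definition Shannon :: "'a measure \<Rightarrow> ('a \<Rightarrow> int) \<Rightarrow> bool" where
  "Shannon M f \<longleftrightarrow>
     f \<in> M \<rightarrow>\<^sub>M count_space UNIV \<and>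
     (\<lambda>n. - (measure M (f -` {n} \<inter> space M) * ln (measure M (f -` {n} \<inter> space M))))
       summable_on UNIV"

definition Shannon_orbit_equivalent ::
  "'a measure \<Rightarrow> ('a \<Rightarrow> 'a) \<Rightarrow> 'b measure \<Rightarrow> ('b \<Rightarrow> 'b) \<Rightarrow> bool" where
  "Shannon_orbit_equivalent M S N T \<longleftrightarrow>
     (\<exists>\<Psi> c\<^sub>S c\<^sub>T. orbit_equivalence M S N T \<Psi> \<and> oe_cocycles M S N T \<Psi> c\<^sub>S c\<^sub>T \<and>
        Shannon M c\<^sub>S \<and> Shannon N c\<^sub>T)"

section \<open>Even Kakutani equivalence\<close>

text \<open>Conjugacy is understood up to null sets: the conjugating map is a measure-preserving
  bijection between conull subsets.\<close>

definition conjugate ::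
  "'a measure \<Rightarrow> ('a \<Rightarrow> 'a) \<Rightarrow> 'b measure \<Rightarrow> ('b \<Rightarrow> 'b) \<Rightarrow> bool" where
  "conjugate M S N T \<longleftrightarrow>
     (\<exists>X\<^sub>0\<in>sets M. \<exists>Y\<^sub>0\<in>sets N. \<exists>\<Psi>.
        (AE x in M. x \<in> X\<^sub>0) \<and> (AE y in N. y \<in> Y\<^sub>0) \<and>
        mp_bij (restrict_space M X\<^sub>0) (restrict_space N Y\<^sub>0) \<Psi> \<and>
        (AE x in M. \<Psi> (S x) = T (\<Psi> x)))"

text \<open>The junk value \<open>Inf {} = 0\<close> only occurs at points that never return to \<open>A\<close>,
  a null subset of \<open>A\<close> by Poincare recurrence.\<close>

definition return_time :: "('a \<Rightarrow> 'a) \<Rightarrow> 'a set \<Rightarrow> 'a \<Rightarrow> nat" where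
  "return_time T A x = Inf {k. 1 \<le> k \<and> (T ^^ k) x \<in> A}"

definition induced_map :: "('a \<Rightarrow> 'a) \<Rightarrow> 'a set \<Rightarrow> 'a \<Rightarrow> 'a" where
  "induced_map T A x = (T ^^ return_time T A x) x"

definition induced_measure :: "'a measure \<Rightarrow> 'a set \<Rightarrow> 'a measure" where
  "induced_measure M A = restrict_space (uniform_measure M A) A"

definition evenly_Kakutani_equivalent ::
  "'a measure \<Rightarrow> ('a \<Rightarrow> 'a) \<Rightarrow> 'b measure \<Rightarrow> ('b \<Rightarrow> 'b) \<Rightarrow> bool" where
  "evenly_Kakutani_equivalent M T N S \<longleftrightarrow>
     (\<exists>A\<in>sets M. \<exists>B\<in>sets N.
        0 < measure M A \<and> 0 < measure N B \<and> measure M A = measure N B \<and>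
        conjugate (induced_measure M A) (induced_map T A)
                  (induced_measure N B) (induced_map S B))"

section \<open>Odometers\<close>

definition odometer_space :: "(nat \<Rightarrow> nat) \<Rightarrow> (nat \<Rightarrow> nat) measure" where
  "odometer_space q = (\<Pi>\<^sub>M n\<in>UNIV. uniform_count_measure {..<q n})"

text \<open>\<open>odometer_carry q x n\<close> is the carry into position \<open>n\<close> when adding \<open>(1,0,0,\<dots>)\<close> to \<open>x\<close>;
  the added digit 1 is treated as the carry into position 0.\<close>

fun odometer_carry :: "(nat \<Rightarrow> nat) \<Rightarrow> (nat \<Rightarrow> nat) \<Rightarrow> nat \<Rightarrow> nat" where
  "odometer_carry q x 0 = 1"
| "odometer_carry q x (Suc n) = (x n + odometer_carry q x n) div q n"

definition odometer :: "(nat \<Rightarrow> nat) \<Rightarrow> (nat \<Rightarrow> nat) \<Rightarrow> (nat \<Rightarrow> nat)" where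
  "odometer q x = (\<lambda>n. (x n + odometer_carry q x n) mod q n)"

abbreviation dyadic_space :: "(nat \<Rightarrow> nat) measure" where
  "dyadic_space \<equiv> odometer_space (\<lambda>_. 2)"

abbreviation dyadic_odometer :: "(nat \<Rightarrow> nat) \<Rightarrow> (nat \<Rightarrow> nat)" where
  "dyadic_odometer \<equiv> odometer (\<lambda>_. 2)"

end

theory Submission
  imports Defs "HOL-Library.Sublist"
begin

text \<open>The transformation \<open>T\<close> lives on the dyadic space and has the same orbits as the odometer \<open>S\<close>, so the
  orbit equivalence is the identity. Cut the bit sequence of a point into digits, the \<open>n\<close>-th one
  of length \<open>dlen n\<close>, starting at position \<open>blen n\<close>. The low bits of a digit are the type of the
  block below it, and this type prescribes a rotation of the bits of the previous digit; \<open>T\<close> is the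
  addition of 1 to the bit sequence after all these rotations. Since \<open>T\<close> moves a point
  within its \<open>n\<close>-block outside a set of measure \<open>1 / 2 ^ blen n\<close>, the cocycles are bounded by \<open>2 ^ blen n\<close> there,
  and \<open>blen (n + 1)\<close> is about \<open>2 * blen n\<close>, which gives all exponents below \<open>1 / 2\<close>.

  The rotations make the order in which an \<open>(n + 1)\<close>-block of type \<open>i\<close> reads the \<open>k\<close> types of \<open>n\<close>-blocks
  that of Feldman's words: cyclically, each type being repeated \<open>N ^ i\<close> times, where \<open>N = k = 2 ^ (n + 8)\<close>.
  A common subsequence of the words of types \<open>i < j\<close> is short, because during one long run of the second word
  the first one shows the right type only a proportion \<open>1 / k\<close> of the time. So blocks of different types
  stay uniformly far apart in the edit distance. On the other hand, a
  conjugacy of induced maps turns the periodicity of \<open>S\<close> on cylinders into an almost periodicity of the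
  names of most points of a set of positive measure, so that all these names are close to each other.\<close>

section \<open>Common subsequences of Feldman's words\<close>

text \<open>Inducing removes and inserts stretches of a name at irregular times, so a comparison of
  letters at equal times is lost after the first return, while a long common subsequence survives;
  hence the edit distance. The words come from Feldman's zero-entropy map that is not loosely
  Bernoulli. The obstacle is to find them inside the orbits of the odometer: the blocks of
  \<open>T\<close> must be those of \<open>S\<close> as sets, and only the order in which a block is
  traversed may change. A rotation of the bits of a digit does just this. It changes the weight of
  the type bits, hence the speed at which the types alternate, and it keeps the digits with all bits
  0 or all bits 1, so that room for a carry is visible on the unrotated bits. The error of one level
  is of order 1 / N, and \<open>N\<close> doubles with the level to make the errors summable. Run
  lengths \<open>N ^ i\<close> for \<open>2 ^ (n + 9)\<close> types then make the block lengths
  doubly exponential, which is where the ratio 2 of successive values of \<open>blen\<close> comes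
  from. The final contradiction takes place at a single level, chosen large in terms of the given
  equivalence.\<close>

definition far :: "real \<Rightarrow> real \<Rightarrow> 'a list \<Rightarrow> 'a list \<Rightarrow> bool" where
  "far \<delta> E u v \<longleftrightarrow>
     (\<forall>s. subseq s u \<longrightarrow> subseq s v \<longrightarrow> 2 * real (length s) \<le> \<delta> * (real (length u) + real (length v)) + E)"

text \<open>\<open>far \<delta> E\<close> bounds the edit distance, normalized by the total length,
  from below by 1 - \<delta>, up to the error \<open>E\<close>. The induction needs this for all
  factors at once, since a matching of two concatenations matches a piece of one word with an
  arbitrary factor of the other.\<close>

definition far_sub :: "real \<Rightarrow> real \<Rightarrow> 'a list \<Rightarrow> 'a list \<Rightarrow> bool" where
  "far_sub \<delta> E U V \<longleftrightarrow> (\<forall>u v. sublist u U \<longrightarrow> sublist v V \<longrightarrow> far \<delta> E u v)"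

lemma farD:
  "far \<delta> E u v \<Longrightarrow> subseq s u \<Longrightarrow> subseq s v \<Longrightarrow>
     2 * real (length s) \<le> \<delta> * (real (length u) + real (length v)) + E"
  by (auto simp: far_def)

lemma far_subD: "far_sub \<delta> E U V \<Longrightarrow> sublist u U \<Longrightarrow> sublist v V \<Longrightarrow> far \<delta> E u v"
  by (auto simp: far_sub_def)

lemma far_sub_sym: "far_sub \<delta> E U V \<Longrightarrow> far_sub \<delta> E V U"
  unfolding far_sub_def far_def by (metis add.commute)

lemma far_mono: "far \<delta> E u v \<Longrightarrow> E \<le> E' \<Longrightarrow> far \<delta> E' u v"
  by (force simp: far_def)

lemma far_sub_mono:
  assumes "far_sub \<delta> E U V" "\<delta> \<le> \<delta>'" "E \<le> E'"
  shows "far_sub \<delta>' E' U V"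
proof -
  have "\<delta> * (real (length u) + real (length v)) + E \<le> \<delta>' * (real (length u) + real (length v)) + E'"
    for u v :: "'a list"
    using assms by (intro add_mono mult_right_mono) auto
  then show ?thesis
    using assms(1) by (fastforce simp: far_sub_def far_def intro: order_trans)
qed

text \<open>A matching splits \<open>v\<close> where it leaves \<open>u\<close>. The lengths add up
  on both sides, so only the additive errors accumulate.\<close>

lemma far_append:
  assumes "\<And>v'. sublist v' v \<Longrightarrow> far \<delta> E u v'" "\<And>v'. sublist v' v \<Longrightarrow> far \<delta> E' u' v'"
  shows "far \<delta> (E + E') (u @ u') v"
  unfolding far_def
proof (intro allI impI)
  fix s assume s: "subseq s (u @ u')" "subseq s v"
  from s(1) obtain s1 s2 where 1: "s = s1 @ s2" "subseq s1 u" "subseq s2 u'"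
    by (elim subseq_appendE)
  from s(2) obtain v1 v2 where 2: "v = v1 @ v2" "subseq s1 v1" "subseq s2 v2"
    unfolding 1(1) by (auto dest: list_emb_appendD)
  have "2 * real (length s1) \<le> \<delta> * (real (length u) + real (length v1)) + E"
    using assms(1) 1 2 by (intro farD) auto
  moreover have "2 * real (length s2) \<le> \<delta> * (real (length u') + real (length v2)) + E'"
    using assms(2) 1 2 by (intro farD) auto
  ultimately show "2 * real (length s) \<le> \<delta> * (real (length (u @ u')) + real (length v)) + (E + E')"
    by (simp add: 1(1) 2(1) algebra_simps)
qed

text \<open>An error proportional to the length of \<open>u\<close> is absorbed in the rate; this is
  how the number of pieces disappears from the estimates.\<close>

lemma far_weaken:
  assumes "far \<delta> E u v" "E \<le> \<epsilon> * real (length u) + E'" "\<epsilon> \<ge> 0"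
  shows "far (\<delta> + \<epsilon>) E' u v"
proof -
  have "0 \<le> \<epsilon> * real (length v)" using assms by simp
  with assms(2) have "E \<le> \<epsilon> * (real (length u) + real (length v)) + E'" by (simp add: distrib_left)
  then show ?thesis using assms(1) unfolding far_def by (fastforce simp: distrib_right)
qed

text \<open>Each piece costs one \<open>E\<close>, and a prefix meets at most
  \<open>length u / L + 1\<close> pieces. A general factor may also begin in the middle of a piece;
  \<open>far_sub_concat\<close> treats that one apart.\<close>

lemma far_prefix_concat:
  fixes U :: "'c \<Rightarrow> 'a list" and L :: nat
  assumes "\<And>c. c \<in> set cs \<Longrightarrow> far_sub \<delta> (E + X c) (U c) V"
    and "\<And>c. c \<in> set cs \<Longrightarrow> length (U c) = L" and L: "L > 0" and E: "E \<ge> 0"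
    and "\<And>c. c \<in> set cs \<Longrightarrow> X c \<ge> 0"
    and "prefix u (concat (map U cs))" "sublist v V" and \<delta>: "\<delta> \<ge> 0"
  shows "far \<delta> (E * (length u / L + 1) + (\<Sum>c\<leftarrow>cs. X c)) u v"
  using assms(1,2,5-7)
proof (induction cs arbitrary: u v)
  case Nil
  have "0 \<le> \<delta> * real (length v)" using \<delta> by simp
  with Nil show ?case using E by (auto simp: far_def dest: list_emb_Nil2)
next
  case (Cons c cs)
  have nn: "0 \<le> (\<Sum>c\<leftarrow>cs. X c)" using Cons.prems by (intro sum_list_nonneg) auto
  consider "prefix u (U c)" | u' where "u = U c @ u'" "prefix u' (concat (map U cs))"
    using Cons.prems(4) by (auto simp: prefix_append)
  then show ?case
  proof cases
    case 1
    have "far \<delta> (E + X c) u v"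
      using 1 Cons.prems by (intro far_subD[of _ _ "U c" V]) auto
    moreover have "0 \<le> E * (length u / L)" using E by simp
    ultimately show ?thesis using nn E by (elim far_mono) (simp add: algebra_simps)
  next
    case 2
    have "far \<delta> ((E + X c) + (E * (length u' / L + 1) + (\<Sum>c\<leftarrow>cs. X c))) (U c @ u') v"
    proof (rule far_append)
      fix v' assume v': "sublist v' v"
      have v'': "sublist v' V" using v' Cons.prems(5) by (rule sublist_order.order_trans)
      show "far \<delta> (E + X c) (U c) v'" using v'' Cons.prems by (intro far_subD[of _ _ "U c" V]) auto
      show "far \<delta> (E * (length u' / L + 1) + (\<Sum>c\<leftarrow>cs. X c)) u' v'"
        by (rule Cons.IH[OF _ _ _ 2(2) v'']) (use Cons.prems in auto)
    qed
    moreover have "length u / L = 1 + length u' / L"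
      using 2(1) Cons.prems(2)[of c] L by (simp add: field_simps)
    ultimately show ?thesis by (simp add: 2(1) algebra_simps)
  qed
qed

text \<open>A substring of a concatenation of pieces of length \<open>L\<close> meets at most two pieces partially, so the
  additive error \<open>E\<close> of a piece turns into a relative error \<open>E / L\<close>. The \<open>X c\<close> are the
  extra errors of exceptional pieces.\<close>

lemma far_sub_concat:
  fixes U :: "'c \<Rightarrow> 'a list" and L :: nat
  assumes far: "\<And>c. c \<in> set cs \<Longrightarrow> far_sub \<delta> (E + X c) (U c) V"
    and len: "\<And>c. c \<in> set cs \<Longrightarrow> length (U c) = L" and L: "L > 0" and E: "E \<ge> 0"
    and X: "\<And>c. c \<in> set cs \<Longrightarrow> X c \<ge> 0" and \<delta>: "\<delta> \<ge> 0"
  shows "far_sub (\<delta> + E / L) (2 * E + (\<Sum>c\<leftarrow>cs. X c)) (concat (map U cs)) V"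
proof -
  have sub: "far \<delta> (E * (length u / L + 2) + (\<Sum>c\<leftarrow>cs. X c)) u v"
    if "sublist u (concat (map U cs))" "sublist v V" for u v
    using that far len X
  proof (induction cs arbitrary: u v)
    case Nil
    have "0 \<le> \<delta> * real (length v)" using \<delta> by simp
    with Nil show ?case using E by (auto simp: far_def dest: list_emb_Nil2)
  next
    case (Cons c cs)
    have nn: "0 \<le> (\<Sum>c\<leftarrow>cs. X c)" using Cons.prems by (intro sum_list_nonneg) auto
    have Xc: "0 \<le> X c" using Cons.prems by simp
    consider "sublist u (U c)" | "sublist u (concat (map U cs))"
      | u1 u2 where "u = u1 @ u2" "suffix u1 (U c)" "prefix u2 (concat (map U cs))"
      using Cons.prems(1) by (auto simp: sublist_append)
    then show ?case
    proof cases
      case 1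
      have "far \<delta> (E + X c) u v"
        using 1 Cons.prems by (intro far_subD[of _ _ "U c" V]) auto
      moreover have "0 \<le> E * (length u / L)" using E by simp
      ultimately show ?thesis using nn E by (elim far_mono) (simp add: algebra_simps)
    next
      case 2
      have "far \<delta> (E * (length u / L + 2) + (\<Sum>c\<leftarrow>cs. X c)) u v"
        by (rule Cons.IH[OF 2 Cons.prems(2)]) (use Cons.prems in auto)
      then show ?thesis using Xc by (elim far_mono) simp
    next
      case 3
      have "far \<delta> ((E + X c) + (E * (length u2 / L + 1) + (\<Sum>c\<leftarrow>cs. X c))) (u1 @ u2) v"
      proof (rule far_append)
        fix v' assume v': "sublist v' v"
        have v'': "sublist v' V" using v' Cons.prems(2) by (rule sublist_order.order_trans)
        show "far \<delta> (E + X c) u1 v'" using v'' 3 Cons.prems by (intro far_subD[of _ _ "U c" V]) auto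
        show "far \<delta> (E * (length u2 / L + 1) + (\<Sum>c\<leftarrow>cs. X c)) u2 v'"
          by (rule far_prefix_concat[OF _ _ L E _ 3(3) v'' \<delta>]) (use Cons.prems in auto)
      qed
      moreover have "E * (length u2 / L) \<le> E * (length u / L)"
        using E 3 by (intro mult_left_mono divide_right_mono) auto
      ultimately show ?thesis unfolding 3(1) by (elim far_mono) (simp add: algebra_simps)
    qed
  qed
  show ?thesis
    unfolding far_sub_def
  proof (intro allI impI)
    fix u v assume "sublist u (concat (map U cs))" "sublist v V"
    from sub[OF this] show "far (\<delta> + E / L) (2 * E + (\<Sum>c\<leftarrow>cs. X c)) u v"
      by (rule far_weaken) (use E L in \<open>auto simp: field_simps\<close>)
  qed
qed

corollary far_sub_concat':
  fixes U :: "'c \<Rightarrow> 'a list" and L :: nat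
  assumes "\<And>c. c \<in> set cs \<Longrightarrow> far_sub \<delta> E (U c) V"
    and "\<And>c. c \<in> set cs \<Longrightarrow> length (U c) = L" and "L > 0" "E \<ge> 0" "\<delta> \<ge> 0"
  shows "far_sub (\<delta> + E / L) (2 * E) (concat (map U cs)) V"
  using far_sub_concat[of cs \<delta> E "\<lambda>_. 0" U V L] assms by simp

text \<open>Both sides are cut in turn. Each pass doubles the additive error and adds its ratio to
  \<open>h\<close> to the rate: \<epsilon> first, then 2 \<epsilon>.\<close>

lemma far_sub_replicate:
  fixes h :: nat and \<epsilon> :: real
  assumes "far_sub \<delta> (\<epsilon> * h) U V" "length U = h" "length V = h" "h > 0" "\<epsilon> \<ge> 0" "\<delta> \<ge> 0"
  shows "far_sub (\<delta> + 3 * \<epsilon>) (4 * \<epsilon> * h) (concat (replicate p U)) (concat (replicate r V))"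
proof -
  have "far_sub (\<delta> + \<epsilon> * h / h) (2 * (\<epsilon> * h)) (concat (map (\<lambda>_. U) [0..<p])) V"
    using assms by (intro far_sub_concat') auto
  then have 1: "far_sub (\<delta> + \<epsilon>) (2 * \<epsilon> * h) V (concat (replicate p U))"
    using assms by (simp add: map_replicate_const far_sub_sym mult.assoc)
  have "far_sub (\<delta> + \<epsilon> + 2 * \<epsilon> * h / h) (2 * (2 * \<epsilon> * h)) (concat (map (\<lambda>_. V) [0..<r])) (concat (replicate p U))"
    using assms 1 by (intro far_sub_concat') auto
  then show ?thesis
    using assms by (simp add: map_replicate_const far_sub_sym algebra_simps)
qed

section \<open>Feldman's words\<close>

definition runs :: "(nat \<Rightarrow> 'a list) \<Rightarrow> nat \<Rightarrow> nat \<Rightarrow> nat \<Rightarrow> 'a list" where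
  "runs B k Q m = concat (replicate m (concat (map (\<lambda>c. concat (replicate Q (B c))) [0..<k])))"

lemma concat_concat: "concat (concat xss) = concat (map concat xss)"
  by (induction xss) auto

lemma map_upt_mult:
  "map f [0..<m * l] = concat (map (\<lambda>t. map (\<lambda>r. f (t * l + r)) [0..<l]) [0..<m])"
proof (induction m)
  case (Suc m)
  have "[0..<Suc m * l] = [0..<m * l] @ [m * l..<m * l + l]"
    by (metis add.commute mult_Suc upt_add_eq_append zero_le)
  moreover have "map f [m * l..<m * l + l] = map (\<lambda>r. f (m * l + r)) [0..<l]"
    by (rule nth_equalityI) auto
  ultimately show ?case using Suc by simp
qed simp

text \<open>When \<open>k\<close> and \<open>Q\<close> are powers of 2, the index on the right is a
  window of bits of \<open>s\<close>. This form links the words with the rotations of bits.\<close>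

lemma runs_eq:
  assumes "k > 0" "Q > 0"
  shows "runs B k Q m = concat (map (\<lambda>s. B ((s div Q) mod k)) [0..<m * (k * Q)])"
proof -
  have "concat (map (\<lambda>s. B ((s div Q) mod k)) [0..<m * (k * Q)]) =
    concat (map concat (map (\<lambda>t. map (\<lambda>r. B (((t * (k * Q) + r) div Q) mod k)) [0..<k * Q]) [0..<m]))"
    by (simp add: map_upt_mult concat_concat)
  also have "map (\<lambda>t. map (\<lambda>r. B (((t * (k * Q) + r) div Q) mod k)) [0..<k * Q]) [0..<m]
    = map (\<lambda>t. map (\<lambda>r. B ((r div Q) mod k)) [0..<k * Q]) [0..<m]"
  proof (intro map_cong refl)
    fix t r
    have "(t * (k * Q) + r) div Q = t * k + r div Q"
      using assms by (metis div_mult_self3 less_numeral_extra(3) mult.assoc)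
    then show "B (((t * (k * Q) + r) div Q) mod k) = B ((r div Q) mod k)" by simp
  qed
  also have "map (\<lambda>r. B ((r div Q) mod k)) [0..<k * Q] = concat (map (\<lambda>c. replicate Q (B c)) [0..<k])"
  proof -
    have "map (\<lambda>r. B ((r div Q) mod k)) [0..<k * Q]
      = concat (map (\<lambda>t. map (\<lambda>r. B (((t * Q + r) div Q) mod k)) [0..<Q]) [0..<k])"
      by (rule map_upt_mult)
    also have "map (\<lambda>t. map (\<lambda>r. B (((t * Q + r) div Q) mod k)) [0..<Q]) [0..<k]
      = map (\<lambda>c. replicate Q (B c)) [0..<k]"
      by (intro map_cong refl) (auto intro!: nth_equalityI)
    finally show ?thesis .
  qed
  also have "concat (concat (map (\<lambda>c. replicate Q (B c)) [0..<k])) = concat (map (\<lambda>c. concat (replicate Q (B c))) [0..<k])"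
    by (induction k) (auto simp: )
  ultimately show ?thesis by (simp add: runs_def map_replicate_const o_def)
qed

text \<open>Feldman's step: a run of the slower word is longer by a factor \<open>N\<close> than
  the runs of the faster word, which spends a proportion \<open>1 / k\<close> of its time in the matching type.\<close>

lemma far_sub_runs:
  fixes h N k :: nat and \<epsilon> :: real
  assumes len: "\<And>c. c < k \<Longrightarrow> length (B c) = h"
    and far: "\<And>b c. b < k \<Longrightarrow> c < k \<Longrightarrow> b \<noteq> c \<Longrightarrow> far_sub \<delta> (\<epsilon> * h) (B b) (B c)"
    and pos: "h > 0" "Q > 0" "k > 0" "N > 0" "\<epsilon> \<ge> 0" "\<delta> \<ge> 0" and k: "k \<ge> 8"
    and Q': "N * Q \<le> Q'"
  shows "far_sub (\<delta> + 31 * \<epsilon> + 2 / k + 4 / N) (32 * \<epsilon> * h + 8 * (Q * h)) (runs B k Q' m') (runs B k Q m)"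
proof -
  define R where "R = (\<lambda>Q c. concat (replicate Q (B c)))"
  have lenR: "length (R p c) = p * h" if "c < k" for c p
    unfolding R_def using len[OF that] by (induction p) auto
  have Q'0: "Q' > 0" using pos Q' by (cases Q') auto
  define P where "P = concat (map (R Q) [0..<k])"
  have lenP: "length P = k * (Q * h)"
  proof -
    have "(\<Sum>c\<leftarrow>[0..<k]. length (R Q c)) = (\<Sum>c\<leftarrow>[0..<k]. Q * h)"
      by (intro arg_cong[where f=sum_list] map_cong) (auto simp: lenR)
    then show ?thesis by (simp add: P_def length_concat o_def sum_list_triv)
  qed
  have RR: "far_sub (\<delta> + 3 * \<epsilon>) (4 * \<epsilon> * h) (R p b) (R r c)" if "b < k" "c < k" "b \<noteq> c" for p r b c
    unfolding R_def using that assms by (intro far_sub_replicate) auto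
  \<comment> \<open>The fast word against a single long run, of type \<open>b\<close>, of the slow
    word.\<close>
  have A: "far_sub (\<delta> + 15 * \<epsilon> + 2 / k) (16 * \<epsilon> * h + 4 * (Q * h)) (runs B k Q m) (R p b)" if b: "b < k" for p b
  proof -
    have "far_sub (\<delta> + 3 * \<epsilon> + (4 * \<epsilon> * h) / (Q * h)) (2 * (4 * \<epsilon> * h) + (\<Sum>c\<leftarrow>[0..<k]. if c = b then 2 * (real Q * real h) else 0))
        (concat (map (R Q) [0..<k])) (R p b)"
    proof (rule far_sub_concat)
      fix c assume c: "c \<in> set [0..<k]"
      show "far_sub (\<delta> + 3 * \<epsilon>) (4 * \<epsilon> * h + (if c = b then 2 * (real Q * real h) else 0)) (R Q c) (R p b)"
      proof (cases "c = b")
        \<comment> \<open>The matching type gets the trivial bound: a common subsequence is no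
          longer than the piece. In each cycle this concerns one run, \<open>Q * h\<close>
          letters.\<close>
        case True
        have "length s \<le> Q * h" if "subseq s u" "sublist u (R Q c)" for s u
        proof -
          have "length s \<le> length u" using that by (simp add: list_emb_length)
          also have "length u \<le> length (R Q c)" using that by (simp add: sublist_length_le)
          finally show ?thesis using lenR c by simp
        qed
        moreover have "0 \<le> (\<delta> + 3 * \<epsilon>) * (real a + real b)" "0 \<le> 4 * \<epsilon> * h" for a b :: nat using pos by auto
        ultimately show ?thesis using True unfolding far_sub_def far_def
          by (smt (verit, best) of_nat_mono of_nat_mult)
      qed (use RR b c in auto)
    qed (use pos lenR in auto)
    moreover have "(\<Sum>c\<leftarrow>[0..<k]. if c = b then 2 * (real Q * real h) else 0) = 2 * (Q * h)"
      using b by (subst sum_list_distinct_conv_sum_set) auto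
    moreover have "4 * \<epsilon> * h / (Q * h) \<le> 4 * \<epsilon>"
      using pos mult_left_mono[of 1 "real Q" \<epsilon>] by (simp add: field_simps)
    ultimately have "far_sub (\<delta> + 7 * \<epsilon>) (8 * \<epsilon> * h + 2 * (Q * h)) P (R p b)"
      unfolding P_def by (elim far_sub_mono) auto
    \<comment> \<open>Now a whole cycle is the piece. Its length \<open>k * (Q * h)\<close> turns
      the loss \<open>2 * (Q * h)\<close> into the rate 2 / k.\<close>
    then have "far_sub (\<delta> + 7 * \<epsilon> + (8 * \<epsilon> * h + 2 * (Q * h)) / (k * (Q * h))) (2 * (8 * \<epsilon> * h + 2 * (Q * h)))
      (concat (map (\<lambda>_. P) [0..<m])) (R p b)"
      using pos lenP by (intro far_sub_concat') auto
    moreover have "(8 * \<epsilon> * h + 2 * (Q * h)) / (k * (Q * h)) \<le> 8 * \<epsilon> + 2 / k"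
    proof -
      have "real 1 \<le> real (k * Q)" using pos by (intro of_nat_mono) (simp add: Suc_leI)
      then have "1 \<le> real k * real Q" by simp
      then have "8 * \<epsilon> * h / (k * (Q * h)) \<le> 8 * \<epsilon> * h / h"
        using pos by (intro divide_left_mono) (auto)
      moreover have "2 * (Q * h) / (k * (Q * h)) = 2 / k" using pos by (simp add: field_simps)
      ultimately show ?thesis using pos by (simp add: add_divide_distrib)
    qed
    moreover have "runs B k Q m = concat (map (\<lambda>_. P) [0..<m])"
      unfolding runs_def P_def[unfolded R_def, symmetric] by (simp add: map_replicate_const)
    ultimately show ?thesis using far_sub_mono by (fastforce simp: algebra_simps)
  qed
  have eq: "runs B k Q' m' = concat (map (\<lambda>t. R Q' (t mod k)) [0..<m' * k])"
  proof -
    have upt_mod_cong: "map (\<lambda>x. R Q' (x mod k)) [0..<k] = map (R Q') [0..<k]" by (intro map_cong) auto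
    have "concat (map (\<lambda>t. R Q' (t mod k)) [0..<m' * k]) = concat (map concat (map (\<lambda>t. map (R Q') [0..<k]) [0..<m']))"
      by (simp add: map_upt_mult concat_concat o_def upt_mod_cong)
    also have "\<dots> = runs B k Q' m'" by (simp add: runs_def R_def map_replicate_const o_def)
    finally show ?thesis by simp
  qed
  \<comment> \<open>Now the pieces are the runs of the slow word. Their length is at least
    \<open>N * Q * h\<close>, which turns \<open>4 * (Q * h)\<close> into the rate 4 / N.\<close>
  have "far_sub (\<delta> + 15 * \<epsilon> + 2 / k + (16 * \<epsilon> * h + 4 * (Q * h)) / (Q' * h)) (2 * (16 * \<epsilon> * h + 4 * (Q * h)))
     (runs B k Q' m') (runs B k Q m)"
    unfolding eq using A[THEN far_sub_sym] pos Q'0 by (intro far_sub_concat') (auto simp: lenR)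
  moreover have "(16 * \<epsilon> * h + 4 * (Q * h)) / (Q' * h) \<le> 16 * \<epsilon> + 4 / N"
  proof -
    have "16 * \<epsilon> * h / (Q' * h) \<le> 16 * \<epsilon> * h / h"
      using pos Q'0 by (intro divide_left_mono) (auto)
    moreover have "4 * (Q * h) / (Q' * h) \<le> 4 / N"
    proof -
      have "real N * Q \<le> Q'" using Q' by (metis of_nat_le_iff of_nat_mult)
      then show ?thesis using pos Q'0 by (simp add: field_simps)
    qed
    ultimately show ?thesis using pos by (simp add: add_divide_distrib)
  qed
  ultimately show ?thesis by (elim far_sub_mono) (auto simp: algebra_simps)
qed

text \<open>With \<open>N = 2 ^ (n + 8)\<close> a block of level \<open>n + 1\<close> consists of \<open>2 ^ dlen n = N ^ 2 ^ (n + 9)\<close> blocks of level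
  \<open>n\<close>, which leaves room for the run lengths \<open>N ^ i\<close> of its \<open>2 ^ (n + 9)\<close> types \<open>i\<close>. The shift by 8
  keeps the sum of all errors in \<open>blk_far\<close> below \<open>1 / 4\<close>.\<close>

definition blen :: "nat \<Rightarrow> nat" where "blen n = (n + 6) * 2 ^ (n + 9)"
definition dlen :: "nat \<Rightarrow> nat" where "dlen n = (n + 8) * 2 ^ (n + 9)"

text \<open>The summand 6 in \<open>blen\<close> makes the closed form work: 2 * (n + 7) = (n + 6) +
  (n + 8).\<close>

lemma blen_Suc: "blen (Suc n) = blen n + dlen n"
  by (simp add: blen_def dlen_def algebra_simps power_add)

text \<open>The word that \<open>btype 0\<close> reads along a block of level \<open>n\<close> and
  type \<open>i\<close>. At level 0 distinct types share no letter. Above, the type of the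
  \<open>s\<close>-th subblock is the window of \<open>n + 8\<close> bits of \<open>s\<close> from
  \<open>(n + 8) * i\<close> on, so it stays the same for \<open>N ^ i\<close> steps.\<close>

primrec blk :: "nat \<Rightarrow> nat \<Rightarrow> nat list" where
  "blk 0 i = replicate (2 ^ blen 0) i"
| "blk (Suc n) i = concat (map (\<lambda>s. blk n ((s div 2 ^ ((n + 8) * i)) mod 2 ^ (n + 8))) [0..<2 ^ dlen n])"

lemma length_blk: "length (blk n i) = 2 ^ blen n"
proof (induction n arbitrary: i)
  case (Suc n)
  have "length (blk (Suc n) i) = (\<Sum>s\<leftarrow>[0..<2 ^ dlen n]. 2 ^ blen n)"
    unfolding blk.simps length_concat map_map o_def Suc ..
  then show ?case by (simp add: sum_list_triv blen_Suc power_add)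
qed simp

lemma nth_blk_Suc:
  assumes "s < 2 ^ dlen n" "p < 2 ^ blen n"
  shows "blk (Suc n) i ! (p + 2 ^ blen n * s) = blk n ((s div 2 ^ ((n + 8) * i)) mod 2 ^ (n + 8)) ! p"
proof -
  have *: "concat (map F [0..<m]) ! (p + h * s) = F s ! p"
    if "s < m" "p < h" "\<And>t. length (F t) = h" for F :: "nat \<Rightarrow> nat list" and m s p h
    using that
  proof (induction m)
    case (Suc m)
    have len: "length (concat (map F [0..<m])) = h * m"
      using Suc.prems(3) by (simp add: length_concat o_def sum_list_triv)
    show ?case
    proof (cases "s < m")
      case True
      then have "h * Suc s \<le> h * m" by (intro mult_le_mono) auto
      then show ?thesis using True Suc len by (simp add: nth_append)
    next
      case False
      then have "s = m" using Suc.prems by simp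
      then show ?thesis using Suc.prems len by (simp add: nth_append)
    qed
  qed simp
  show ?thesis unfolding blk.simps by (rule *) (use assms length_blk in auto)
qed

text \<open>One cycle takes \<open>N ^ (i + 1)\<close> of the \<open>N ^ 2 ^ (n + 9)\<close>
  subblocks, so for every admissible \<open>i\<close> a whole number of cycles fits.\<close>

lemma blk_Suc_runs:
  assumes "i < 2 ^ (n + 9)"
  shows "blk (Suc n) i = runs (blk n) (2 ^ (n + 8)) (2 ^ ((n + 8) * i)) (2 ^ ((n + 8) * (2 ^ (n + 9) - 1 - i)))"
proof -
  have "(n + 8) * (2 ^ (n + 9) - 1 - i) + ((n + 8) + (n + 8) * i) = (n + 8) * (2 ^ (n + 9) - 1 - i + 1 + i)"
    by (simp add: algebra_simps)
  also have "2 ^ (n + 9) - 1 - i + 1 + i = (2 ^ (n + 9) :: nat)" using assms by simp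
  finally have "dlen n = (n + 8) * (2 ^ (n + 9) - 1 - i) + ((n + 8) + (n + 8) * i)" unfolding dlen_def ..
  then have "2 ^ dlen n = (2::nat) ^ ((n + 8) * (2 ^ (n + 9) - 1 - i)) * (2 ^ (n + 8) * 2 ^ ((n + 8) * i))"
    by (simp only: power_add)
  then show ?thesis by (subst runs_eq) auto
qed

text \<open>With \<open>N = 2 ^ (n + 8)\<close>, one level adds at most 28 / N to the rate, and 56 /
  N is the sum of the geometric series of these increments from level \<open>n\<close> on. At level
  0 the rate is 1 / 32; so it is never negative and stays below 1 / 4.\<close>

lemma blk_far:
  assumes "i < 2 ^ (n + 8)" "j < 2 ^ (n + 8)" "i \<noteq> j"
  shows "far_sub (1 / 4 - 56 / 2 ^ (n + 8)) (160 / 4 ^ (n + 8) * 2 ^ blen n) (blk n i) (blk n j)"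
  using assms
proof (induction n arbitrary: i j)
  case 0
  have "s = []" if "subseq s u" "sublist u (blk 0 i)" "subseq s v" "sublist v (blk 0 j)" for s u v
  proof (rule ccontr)
    assume "s \<noteq> []"
    then obtain c where c: "c \<in> set s" by (cases s) auto
    have "c \<in> set (blk 0 i)" using list_emb_set[OF that(1) c] set_mono_sublist[OF that(2)] by auto
    moreover have "c \<in> set (blk 0 j)" using list_emb_set[OF that(3) c] set_mono_sublist[OF that(4)] by auto
    ultimately show False using 0 by auto
  qed
  then show ?case unfolding far_sub_def far_def by fastforce
next
  case (Suc n)
  define \<epsilon> \<delta> :: real where "\<epsilon> = 160 / 4 ^ (n + 8)" and "\<delta> = 1 / 4 - 56 / 2 ^ (n + 8)"
  have p2: "(256::real) \<le> 2 ^ (n + 8)" by (simp add: power_add)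
  have p4: "(4::real) ^ (n + 8) = 2 ^ (n + 8) * 2 ^ (n + 8)" by (simp flip: power_mult_distrib)
  have "\<epsilon> \<le> 160 / (256 * 256)"
    unfolding \<epsilon>_def p4 using p2 by (intro divide_left_mono mult_mono) auto
  also have "\<dots> \<le> 1" by simp
  finally have "\<epsilon> \<le> 1" .
  then have \<epsilon>: "\<epsilon> \<ge> 0" "\<epsilon> \<le> 1" by (simp add: \<epsilon>_def, assumption)
  have "56 / 2 ^ (n + 8) \<le> 56 / (256::real)" using p2 by (intro divide_left_mono) auto
  also have "\<dots> \<le> 1 / 4" by simp
  finally have \<delta>: "\<delta> \<ge> 0" unfolding \<delta>_def by linarith
  have IH: "far_sub \<delta> (\<epsilon> * real (2 ^ blen n)) (blk n b) (blk n c)"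
    if "b < 2 ^ (n + 8)" "c < 2 ^ (n + 8)" "b \<noteq> c" for b c
    using Suc.IH[OF that] by (simp add: \<epsilon>_def \<delta>_def)
  \<comment> \<open>Type \<open>j\<close> has the longer runs and plays the slow word of
    \<open>far_sub_runs\<close>.\<close>
  have main: "far_sub (1 / 4 - 56 / 2 ^ (Suc n + 8)) (160 / 4 ^ (Suc n + 8) * 2 ^ blen (Suc n)) (blk (Suc n) j) (blk (Suc n) i)"
    if ij: "i < j" "j < 2 ^ (n + 9)" for i j
  proof -
    define N Q K where "N = (2::nat) ^ (n + 8)" and "Q = (2::nat) ^ ((n + 8) * i)" and "K = (2::nat) ^ (n + 9)"
    have "far_sub (\<delta> + 31 * \<epsilon> + 2 / real N + 4 / real N) (32 * \<epsilon> * real (2 ^ blen n) + 8 * (Q * (2 ^ blen n)))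
        (blk (Suc n) j) (blk (Suc n) i)"
      unfolding blk_Suc_runs[OF ij(2)] blk_Suc_runs[OF order.strict_trans[OF ij]] N_def[symmetric] Q_def[symmetric]
    proof (rule far_sub_runs)
      have "N * Q = 2 ^ ((n + 8) * Suc i)" by (simp add: N_def Q_def power_add)
      also have "\<dots> \<le> 2 ^ ((n + 8) * j)" using ij by (intro power_increasing mult_le_mono) auto
      finally show "N * Q \<le> 2 ^ ((n + 8) * j)" .
      have "(2::nat) ^ 3 \<le> N" unfolding N_def by (intro power_increasing) auto
      then show "8 \<le> N" by simp
    qed (use IH \<epsilon> \<delta> in \<open>auto simp: length_blk N_def Q_def\<close>)
    then show ?thesis
    proof (rule far_sub_mono)
      have "31 * \<epsilon> \<le> 20 / real N"
      proof -
        \<comment> \<open>Here 4960 / 256 < 20, and together with the 2 and the 4 of the other terms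
          this stays below 28.\<close>
        have "31 * \<epsilon> = 4960 / (real N * real N)" by (simp add: \<epsilon>_def p4 N_def)
        also have "\<dots> \<le> 4960 / (256 * real N)" using p2 by (intro divide_left_mono mult_mono) (auto simp: N_def)
        also have "\<dots> \<le> 20 / real N" by (simp add: N_def field_simps)
        finally show ?thesis .
      qed
      moreover have "56 / 2 ^ (Suc n + 8) = 28 / real N" by (simp add: N_def power_add)
      moreover have "\<delta> = 1 / 4 - 56 / real N" by (simp add: \<delta>_def N_def)
      moreover have "20 / real N + 2 / real N + 4 / real N \<le> 28 / real N" by (simp add: N_def field_simps)
      moreover have "28 / real N + 28 / real N = 56 / real N" by (simp add: field_simps)
      ultimately show "\<delta> + 31 * \<epsilon> + 2 / real N + 4 / real N \<le> 1 / 4 - 56 / 2 ^ (Suc n + 8)" by linarith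
      have Q1: "1 \<le> real Q" by (simp add: Q_def)
      \<comment> \<open>The smaller type is at most \<open>2 ^ (n + 9) - 2\<close>, so its runs are
        shorter than the block by a factor of at least \<open>N * N\<close>. The additive error of
        40 runs is thus the fraction 40 / (N * N) = 160 / 4 ^ (n + 9) of the block.\<close>
      have QN: "Q * N * N \<le> 2 ^ dlen n"
      proof -
        have "Q * N * N = 2 ^ ((n + 8) * (i + 2))" by (simp add: Q_def N_def power_add[symmetric] algebra_simps)
        also have "\<dots> \<le> 2 ^ dlen n" unfolding dlen_def using ij by (intro power_increasing mult_le_mono) auto
        finally show ?thesis .
      qed
      have "32 * \<epsilon> * real (2 ^ blen n) + 8 * (Q * (2 ^ blen n)) \<le> 40 * real Q * 2 ^ blen n"
        using Q1 \<epsilon> by (auto intro!: mult_mono simp: algebra_simps)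
      also have "\<dots> \<le> 40 / (real N * real N) * 2 ^ dlen n * 2 ^ blen n"
      proof -
        have "real Q * real N * real N \<le> 2 ^ dlen n" using of_nat_mono[OF QN, where 'a=real] by simp
        then have "real Q \<le> 2 ^ dlen n / (real N * real N)" by (simp add: N_def field_simps)
        then have "real Q * (40 * 2 ^ blen n) \<le> 2 ^ dlen n / (real N * real N) * (40 * 2 ^ blen n)"
          by (rule mult_right_mono) simp
        then show ?thesis by (simp add: mult_ac)
      qed
      also have "\<dots> = 160 / 4 ^ (Suc n + 8) * 2 ^ blen (Suc n)"
        using p4 by (simp add: N_def blen_Suc power_add)
      finally show "32 * \<epsilon> * real (2 ^ blen n) + 8 * (Q * (2 ^ blen n)) \<le> 160 / 4 ^ (Suc n + 8) * 2 ^ blen (Suc n)" .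
    qed
  qed
  have ij: "i < 2 ^ (n + 9)" "j < 2 ^ (n + 9)" using Suc.prems by (simp_all add: numeral_eq_Suc)
  show ?case
    using main[of i j] main[of j i] ij Suc.prems(3) far_sub_sym by (cases "i < j") force+
qed

section \<open>The dyadic space\<close>

definition bits_val :: "nat \<Rightarrow> nat \<Rightarrow> (nat \<Rightarrow> nat) \<Rightarrow> nat" where
  "bits_val m L x = (\<Sum>t<L. x (m + t) * 2 ^ t)"

abbreviation val :: "nat \<Rightarrow> (nat \<Rightarrow> nat) \<Rightarrow> nat" where "val \<equiv> bits_val 0"

abbreviation "\<Omega> \<equiv> space dyadic_space"
abbreviation "\<mu> \<equiv> measure dyadic_space"
abbreviation "cyl n v \<equiv> {x \<in> \<Omega>. val n x = v}"
abbreviation "cylinders \<equiv> {cyl n v |n v. True}"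

lemma space_dyadic: "\<Omega> = {x. \<forall>n. x n < 2}"
  by (auto simp: odometer_space_def space_PiM space_uniform_count_measure PiE_def Pi_def)

lemma in_dyadic: "x \<in> \<Omega> \<longleftrightarrow> (\<forall>n. x n < 2)"
  by (simp add: space_dyadic)

interpretation coins: product_prob_space "\<lambda>_::nat. uniform_count_measure {..<2::nat}" UNIV
  by (intro product_prob_spaceI prob_space_uniform_count_measure) (auto simp: numeral_2_eq_2 lessThan_Suc)

interpretation dyadic: prob_space dyadic_space
  using coins.P.prob_space_axioms by (simp add: odometer_space_def)

lemma bits_val_add: "bits_val m (L + L') x = bits_val m L x + 2 ^ L * bits_val (m + L) L' x"
  by (induction L') (simp_all add: bits_val_def algebra_simps power_add)

lemma bits_val_less: "x \<in> \<Omega> \<Longrightarrow> bits_val m L x < 2 ^ L"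
proof (induction L)
  case (Suc L)
  have "x (m + L) < 2" using Suc.prems by (simp add: in_dyadic)
  then have "x (m + L) \<le> 1" by simp
  then have "x (m + L) * 2 ^ L \<le> 2 ^ L" by simp
  moreover have "bits_val m (Suc L) x = bits_val m L x + x (m + L) * 2 ^ L" by (simp add: bits_val_def)
  moreover have "bits_val m L x < 2 ^ L" using Suc by simp
  ultimately show ?case unfolding power_Suc by linarith
qed (simp add: bits_val_def)

lemma bits_val_div_mod:
  assumes "x \<in> \<Omega>" "u + e \<le> L"
  shows "(bits_val m L x div 2 ^ u) mod 2 ^ e = bits_val (m + u) e x"
proof -
  obtain r where L: "L = u + (e + r)" using assms(2) by (metis add.assoc le_iff_add)
  have "bits_val m L x = bits_val m u x + 2 ^ u * (bits_val (m + u) e x + 2 ^ e * bits_val (m + u + e) r x)"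
    unfolding L bits_val_add by (simp add: add.assoc)
  then show ?thesis using bits_val_less[OF assms(1)] by simp
qed

lemma bits_val_cong: "(\<And>t. t < L \<Longrightarrow> x (m + t) = y (m + t)) \<Longrightarrow> bits_val m L x = bits_val m L y"
  by (simp add: bits_val_def)

lemma bits_val_nth:
  assumes "x \<in> \<Omega>" "t < L"
  shows "x (m + t) = (bits_val m L x div 2 ^ t) mod 2"
  using bits_val_div_mod[OF assms(1), of t 1 L m] assms(2) by (simp add: bits_val_def)

lemma bits_val_eq_iff:
  assumes "x \<in> \<Omega>" "y \<in> \<Omega>"
  shows "bits_val m L x = bits_val m L y \<longleftrightarrow> (\<forall>t<L. x (m + t) = y (m + t))"
  using bits_val_nth[OF assms(1)] bits_val_nth[OF assms(2)] bits_val_cong by metis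

lemma dyadic_eqI:
  assumes "x \<in> \<Omega>" "y \<in> \<Omega>" "\<And>n. val n x = val n y"
  shows "x = y"
proof
  fix t show "x t = y t" using bits_val_eq_iff[OF assms(1,2), of 0 "Suc t"] assms(3) by auto
qed

lemma val_mod: "x \<in> \<Omega> \<Longrightarrow> m \<le> n \<Longrightarrow> val n x mod 2 ^ m = val m x"
  using bits_val_div_mod[of x 0 m n 0] by simp

lemma bits_val_bits: "bits_val 0 L (\<lambda>t. (v div 2 ^ t) mod 2) = v mod 2 ^ L"
proof (induction L)
  case (Suc L)
  have "v mod 2 ^ Suc L = 2 ^ L * (v div 2 ^ L mod 2) + v mod 2 ^ L"
    unfolding power_Suc2 by (rule mod_mult2_eq)
  then show ?case using Suc by (simp add: bits_val_def)
qed (simp add: bits_val_def)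

lemma measurable_coord [measurable]: "(\<lambda>x. x n) \<in> dyadic_space \<rightarrow>\<^sub>M count_space UNIV"
proof -
  have "(\<lambda>x. x n) \<in> dyadic_space \<rightarrow>\<^sub>M uniform_count_measure {..<2::nat}"
    unfolding odometer_space_def by (rule measurable_component_singleton) simp
  moreover have "(\<lambda>x. x) \<in> uniform_count_measure {..<2::nat} \<rightarrow>\<^sub>M count_space UNIV"
    by (simp add: measurable_def sets_uniform_count_measure space_uniform_count_measure)
  ultimately show ?thesis by (rule measurable_compose)
qed

lemma measurable_bits_val [measurable]: "bits_val m L \<in> dyadic_space \<rightarrow>\<^sub>M count_space UNIV"
proof (induction L)
  case (Suc L)
  have "(\<lambda>x. bits_val m L x + x (m + L) * 2 ^ L) \<in> dyadic_space \<rightarrow>\<^sub>M count_space UNIV"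
    by (rule measurable_compose_countable[OF _ Suc, where f = "\<lambda>i x. i + x (m + L) * 2 ^ L"])
      (rule measurable_compose[OF measurable_coord], simp)
  then show ?case by (simp add: bits_val_def[abs_def])
qed (simp add: bits_val_def[abs_def])

lemma measure_bits_val:
  assumes "v < 2 ^ L"
  shows "\<mu> {x \<in> \<Omega>. bits_val m L x = v} = 1 / 2 ^ L"
proof -
  \<comment> \<open>A point with the prescribed window; its other coordinates do not matter.\<close>
  define z where "z = (\<lambda>t. (v div 2 ^ (t - m)) mod 2)"
  have z: "z \<in> \<Omega>" by (simp add: z_def in_dyadic)
  have zv: "bits_val m L z = v" using bits_val_bits[of L v] assms by (simp add: bits_val_def z_def)
  have "{x \<in> \<Omega>. bits_val m L x = v} = {x \<in> \<Omega>. \<forall>i\<in>{m..<m+L}. x i \<in> {z i}}"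
  proof -
    have "(\<forall>t<L. x (m + t) = z (m + t)) \<longleftrightarrow> (\<forall>i\<in>{m..<m+L}. x i = z i)" for x
    proof safe
      fix i assume *: "\<forall>t<L. x (m + t) = z (m + t)" "i \<in> {m..<m+L}"
      then show "x i = z i" using *(1)[rule_format, of "i - m"] by auto
    qed auto
    then show ?thesis using bits_val_eq_iff[OF _ z, of _ m L, unfolded zv] by auto
  qed
  also have "emeasure dyadic_space \<dots> = (\<Prod>i\<in>{m..<m+L}. emeasure (uniform_count_measure {..<2::nat}) {z i})"
    unfolding odometer_space_def
    by (rule coins.emeasure_PiM_Collect) (use z in \<open>auto simp: sets_uniform_count_measure in_dyadic\<close>)
  also have "\<dots> = (\<Prod>i\<in>{m..<m+L}. ennreal (1 / 2))"
    by (intro prod.cong refl, subst emeasure_uniform_count_measure) (use z in \<open>auto simp: in_dyadic\<close>)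
  also have "\<dots> = ennreal ((1 / 2) ^ L)" unfolding prod_constant by (subst ennreal_power) auto
  finally show ?thesis by (simp add: measure_def power_one_over)
qed

section \<open>Cylinders as a generating class\<close>

lemma sets_dyadic: "sets dyadic_space = sigma_sets \<Omega> cylinders"
proof
  let ?G = "cylinders"
  let ?S = "sigma_sets \<Omega> ?G"
  interpret S: sigma_algebra "\<Omega>" ?S by (rule sigma_algebra_sigma_sets) auto
  have "sets dyadic_space = sigma_sets \<Omega> {{f \<in> \<Omega>. f i \<in> A} | i A. A \<subseteq> {..<2::nat}}"
    by (auto simp: odometer_space_def sets_PiM_single space_PiM sets_uniform_count_measure space_uniform_count_measure)
  also have "\<dots> \<subseteq> ?S"
  proof (rule sigma_sets_mono, safe)
    fix i and A :: "nat set"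
    have "{f \<in> \<Omega>. f i \<in> A} = (\<Union>v\<in>{v. (v div 2 ^ i) mod 2 \<in> A}. cyl (Suc i) v)"
      using bits_val_nth[of _ i "Suc i" 0] by auto
    also have "\<dots> \<in> ?S" by (rule S.countable_UN'') auto
    finally show "{f \<in> \<Omega>. f i \<in> A} \<in> ?S" .
  qed
  finally show "sets dyadic_space \<subseteq> ?S" .
  show "?S \<subseteq> sets dyadic_space" by (rule sets.sigma_sets_subset) auto
qed

lemma dyadic_measurableI:
  assumes "\<And>x. x \<in> space M \<Longrightarrow> F x \<in> \<Omega>"
    and "\<And>n. (\<lambda>x. val n (F x)) \<in> M \<rightarrow>\<^sub>M count_space UNIV"
  shows "F \<in> M \<rightarrow>\<^sub>M dyadic_space"
proof (rule measurable_sigma_sets[OF sets_dyadic])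
  fix A assume "A \<in> cylinders"
  then obtain n v where A: "A = cyl n v" by auto
  have "F -` A \<inter> space M = (\<lambda>x. val n (F x)) -` {v} \<inter> space M" using assms(1) by (auto simp: A)
  then show "F -` A \<inter> space M \<in> sets M" using measurable_sets[OF assms(2)] by simp
qed (use assms(1) in auto)

lemma Int_stable_cylinders: "Int_stable cylinders"
proof (rule Int_stableI)
  have *: "\<exists>n'' v''. cyl n v \<inter> cyl n' v'
      = cyl n'' v''" if le: "n \<le> n'" for n v n' v'
  proof (cases "v' mod 2 ^ n = v")
    case True
    have "(val n x = v \<and> val n' x = v') \<longleftrightarrow> val n' x = v'" if "x \<in> \<Omega>" for x
      using val_mod[OF that le] True by metis
    then have "cyl n v \<inter> cyl n' v'
      = cyl n' v'" by blast
    then show ?thesis by (intro exI)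
  next
    case False
    then have "cyl n v \<inter> cyl n' v' = {}"
      using val_mod[OF _ le] by blast
    \<comment> \<open>\<open>val 0\<close> vanishes everywhere, so this is the empty set in the form
      of a cylinder.\<close>
    also have "\<dots> = cyl 0 1" by (auto simp: bits_val_def)
    finally show ?thesis by (intro exI[of _ 0] exI[of _ 1])
  qed
  fix A B assume "A \<in> cylinders" "B \<in> cylinders"
  then obtain n v n' v' where A: "A = cyl n v" and B: "B = cyl n' v'"
    by blast
  obtain n'' v'' where "A \<inter> B = cyl n'' v''"
  proof (atomize_elim)
    show "\<exists>n'' v''. A \<inter> B = cyl n'' v''"
    proof (cases "n \<le> n'")
      case True
      then show ?thesis unfolding A B by (rule *)
    next
      case False
      then show ?thesis unfolding A B Int_commute[of "cyl n v"] by (intro *) simp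
    qed
  qed
  then show "A \<inter> B \<in> cylinders"
    by (intro CollectI exI conjI TrueI)
qed

lemma dyadic_measure_eqI:
  assumes "finite_measure M" "sets M = sets dyadic_space" "sets N = sets dyadic_space"
    and eq: "\<And>n v. v < 2 ^ n \<Longrightarrow> emeasure M (cyl n v) = emeasure N (cyl n v)"
  shows "M = N"
proof (rule measure_eqI_generator_eq[OF Int_stable_cylinders])
  interpret M: finite_measure M by fact
  let ?G = "cylinders"
  show "?G \<subseteq> Pow \<Omega>" by auto
  show "sets M = sigma_sets \<Omega> ?G" "sets N = sigma_sets \<Omega> ?G"
    using assms sets_dyadic by auto
  show "range (\<lambda>_. \<Omega>) \<subseteq> ?G"
    by (auto simp: bits_val_def intro!: exI[of _ "0::nat"])
  show "(\<Union>i::nat. \<Omega>) = \<Omega>" by simp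
  show "emeasure M \<Omega> \<noteq> \<infinity>" for i :: nat by simp
  fix X assume "X \<in> ?G"
  then obtain n v where X: "X = cyl n v" by auto
  show "emeasure M X = emeasure N X"
  proof (cases "v < 2 ^ n")
    case False
    then have "X = {}" using bits_val_less by (auto simp: X)
    then show ?thesis by simp
  qed (simp add: X eq)
qed

text \<open>Lifts a condition on \<open>n\<close> bits to a higher level, so that two cylinder sets
  can be combined at a common one.\<close>

lemma val_mem_mono:
  assumes "n \<le> m"
  shows "{x \<in> \<Omega>. val n x \<in> V} = {x \<in> \<Omega>. val m x \<in> {v. v mod 2 ^ n \<in> V}}"
  using val_mod[OF _ assms] by auto

text \<open>Induction over the generated sigma-algebra: complementation keeps the symmetric
  difference, and a countable disjoint union is within \<epsilon> / 2 of a finite one, whose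
  approximations are lifted to a common level.\<close>

lemma cylinder_approx:
  assumes "A \<in> sets dyadic_space" "\<epsilon> > 0"
  shows "\<exists>n V. \<mu> (sym_diff A {x \<in> \<Omega>. val n x \<in> V}) < \<epsilon>"
proof -
  let ?G = "cylinders"
  have G: "?G \<subseteq> Pow \<Omega>" by auto
  show ?thesis
    using Int_stable_cylinders G assms(1)[unfolded sets_dyadic] assms(2)
  proof (induction arbitrary: \<epsilon> rule: sigma_sets_induct_disjoint)
    case (basic A)
    then obtain n v where "A = {x \<in> \<Omega>. val n x \<in> {v}}" by auto
    then show ?case using basic by (intro exI[of _ n] exI[of _ "{v}"]) simp
  next
    case empty
    then show ?case by (intro exI[of _ 0] exI[of _ "{}"]) simp
  next
    case (compl A)
    then obtain n V where nV: "\<mu> (sym_diff A {x \<in> \<Omega>. val n x \<in> V}) < \<epsilon>" by blast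
    have "A \<subseteq> \<Omega>" using sets.sets_into_space[of A dyadic_space] compl.hyps unfolding sets_dyadic by simp
    then have "sym_diff (\<Omega> - A) {x \<in> \<Omega>. val n x \<in> - V} = sym_diff A {x \<in> \<Omega>. val n x \<in> V}"
      by auto
    then show ?case using nV by (intro exI[of _ n] exI[of _ "- V"]) simp
  next
    case (union A)
    have A: "A i \<in> sets dyadic_space" for i using union.hyps(2) unfolding sets_dyadic by blast
    have cyl: "{x \<in> \<Omega>. val n x \<in> V} \<in> sets dyadic_space" for n V by measurable
    have UA: "(\<Union>i. A i) \<in> sets dyadic_space" using A by (intro sets.countable_UN) auto
    have UN: "(\<Union>i<N. A i) \<in> sets dyadic_space" for N using A by (intro sets.finite_UN) auto
    have "(\<lambda>n. \<mu> (\<Union>i<n. A i)) \<longlonglongrightarrow> \<mu> (\<Union>n. \<Union>i<n. A i)"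
    proof (rule dyadic.finite_Lim_measure_incseq)
      show "incseq (\<lambda>n. \<Union>i<n. A i)" by (intro monoI UN_mono) auto
    qed (use UN in blast)
    moreover have "(\<Union>n. \<Union>i<n. A i) = (\<Union>i. A i)" by auto
    ultimately have lim: "(\<lambda>n. \<mu> (\<Union>i<n. A i)) \<longlonglongrightarrow> \<mu> (\<Union>i. A i)"
      by simp
    have "(\<lambda>n. \<mu> (\<Union>i. A i) - \<mu> (\<Union>i<n. A i)) \<longlonglongrightarrow> 0"
      using tendsto_diff[OF tendsto_const[of "\<mu> (\<Union>i. A i)"] lim] by simp
    then have "\<forall>\<^sub>F n in sequentially. \<mu> (\<Union>i. A i) - \<mu> (\<Union>i<n. A i) < \<epsilon> / 2"
      using union.prems by (intro order_tendstoD(2)) auto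
    then obtain N where N: "\<mu> (\<Union>i. A i) - \<mu> (\<Union>i<N. A i) < \<epsilon> / 2"
      by (auto simp: eventually_sequentially)
    have fin: "\<exists>n V. \<mu> (sym_diff (\<Union>i<N. A i) {x \<in> \<Omega>. val n x \<in> V}) < \<delta>"
      if "\<delta> > 0" for \<delta> N using that
    proof (induction N arbitrary: \<delta>)
      case 0
      then show ?case by (intro exI[of _ 0] exI[of _ "{}"]) simp
    next
      case (Suc N)
      have half: "\<delta> / 2 > 0" using Suc.prems by simp
      from Suc.IH[OF half] obtain n V where 1: "\<mu> (sym_diff (\<Union>i<N. A i) {x \<in> \<Omega>. val n x \<in> V}) < \<delta> / 2"
        by blast
      from union.IH[OF half] obtain n' V' where 2: "\<mu> (sym_diff (A N) {x \<in> \<Omega>. val n' x \<in> V'}) < \<delta> / 2"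
        by blast
      define m where "m = max n n'"
      define W W' where "W = {v. v mod 2 ^ n \<in> V}" and "W' = {v. v mod 2 ^ n' \<in> V'}"
      have W: "{x \<in> \<Omega>. val n x \<in> V} = {x \<in> \<Omega>. val m x \<in> W}"
        unfolding W_def by (rule val_mem_mono) (simp add: m_def)
      have W': "{x \<in> \<Omega>. val n' x \<in> V'} = {x \<in> \<Omega>. val m x \<in> W'}"
        unfolding W'_def by (rule val_mem_mono) (simp add: m_def)
      have "\<mu> (sym_diff (\<Union>i<Suc N. A i) {x \<in> \<Omega>. val m x \<in> W \<union> W'})
         \<le> \<mu> (sym_diff (\<Union>i<N. A i) {x \<in> \<Omega>. val m x \<in> W} \<union>
             sym_diff (A N) {x \<in> \<Omega>. val m x \<in> W'})"
        by (rule dyadic.finite_measure_mono) (force simp: less_Suc_eq, intro sets.Un sets.Diff UN A cyl)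
      also have "\<dots> \<le> \<mu> (sym_diff (\<Union>i<N. A i) {x \<in> \<Omega>. val m x \<in> W}) +
         \<mu> (sym_diff (A N) {x \<in> \<Omega>. val m x \<in> W'})"
        by (rule measure_Un_le) (intro sets.Un sets.Diff UA UN A cyl)+
      also have "\<dots> < \<delta>" using 1 2 by (simp add: W W')
      finally show ?case by blast
    qed
    from fin[of "\<epsilon> / 2" N] obtain n V where nV: "\<mu> (sym_diff (\<Union>i<N. A i) {x \<in> \<Omega>. val n x \<in> V}) < \<epsilon> / 2"
      using union.prems by auto
    have "\<mu> (sym_diff (\<Union>i. A i) {x \<in> \<Omega>. val n x \<in> V})
      \<le> \<mu> (sym_diff (\<Union>i<N. A i) {x \<in> \<Omega>. val n x \<in> V} \<union> ((\<Union>i. A i) - (\<Union>i<N. A i)))"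
      by (rule dyadic.finite_measure_mono) (blast, intro sets.Un sets.Diff UA UN A cyl)
    also have "\<dots> \<le> \<mu> (sym_diff (\<Union>i<N. A i) {x \<in> \<Omega>. val n x \<in> V}) + \<mu> ((\<Union>i. A i) - (\<Union>i<N. A i))"
      by (rule measure_Un_le) (intro sets.Un sets.Diff UA UN A cyl)+
    also have "\<mu> ((\<Union>i. A i) - (\<Union>i<N. A i)) = \<mu> (\<Union>i. A i) - \<mu> (\<Union>i<N. A i)"
      by (rule dyadic.finite_measure_Diff) (use UA UN in auto)
    finally show ?case using nV N by (intro exI[of _ n] exI[of _ V]) linarith
  qed
qed

section \<open>The dyadic odometer\<close>

lemma aut_bij: "aut M F \<Longrightarrow> bij_betw F (space M) (space M)"
  by (simp add: aut_def mp_bij_def)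

lemma aut_in: "aut M F \<Longrightarrow> x \<in> space M \<Longrightarrow> F x \<in> space M"
  using aut_bij bij_betwE by blast

lemma aut_inv_in: "aut M F \<Longrightarrow> x \<in> space M \<Longrightarrow> inv_into (space M) F x \<in> space M"
  using aut_bij bij_betw_inv_into bij_betwE by metis

lemma aut_inv_left: "aut M F \<Longrightarrow> x \<in> space M \<Longrightarrow> inv_into (space M) F (F x) = x"
  using aut_bij bij_betw_inv_into_left by metis

lemma aut_inv_right: "aut M F \<Longrightarrow> x \<in> space M \<Longrightarrow> F (inv_into (space M) F x) = x"
  using aut_bij bij_betw_inv_into_right by metis

lemma aut_funpow_in: "aut M F \<Longrightarrow> x \<in> space M \<Longrightarrow> (F ^^ n) x \<in> space M"
  by (induction n) (auto intro: aut_in)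

lemma int_iter_in: "aut M F \<Longrightarrow> x \<in> space M \<Longrightarrow> int_iter M F k x \<in> space M"
proof -
  assume F: "aut M F" "x \<in> space M"
  have "(inv_into (space M) F ^^ n) x \<in> space M" for n
    by (induction n) (auto intro: aut_inv_in F)
  then show ?thesis using F by (simp add: int_iter_def aut_funpow_in)
qed

lemma int_iter_0 [simp]: "int_iter M F 0 x = x"
  by (simp add: int_iter_def)

lemma int_iter_1 [simp]: "int_iter M F 1 x = F x"
  by (simp add: int_iter_def)

lemma int_iter_Suc:
  assumes "aut M F" "x \<in> space M"
  shows "int_iter M F (k + 1) x = F (int_iter M F k x)"
proof (cases "k \<ge> 0")
  case True
  then have "nat (k + 1) = Suc (nat k)" by simp
  with True show ?thesis by (simp add: int_iter_def)
next
  case False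
  define n where "n = nat (- k) - 1"
  have n: "k = - int (Suc n)" "k + 1 = - int n" using False by (auto simp: n_def)
  have "int_iter M F (- int m) x = (inv_into (space M) F ^^ m) x" for m
    by (cases m) (simp_all add: int_iter_def nat_add_distrib)
  from this[of "Suc n"] this[of n] have "int_iter M F k x = inv_into (space M) F (int_iter M F (k + 1) x)"
    unfolding n by simp
  then show ?thesis using int_iter_in[OF assms] aut_inv_right[OF assms(1)] by simp
qed

lemma int_iter_add:
  assumes "aut M F" "x \<in> space M"
  shows "int_iter M F (j + k) x = int_iter M F j (int_iter M F k x)"
proof (induction j rule: int_induct[where k = 0])
  case (step1 i)
  then show ?case using int_iter_Suc[OF assms, of "i + k"] int_iter_Suc[OF assms(1) int_iter_in[OF assms], of i k]
    by (simp add: algebra_simps)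
next
  case (step2 i)
  have "F (int_iter M F (i - 1 + k) x) = F (int_iter M F (i - 1) (int_iter M F k x))"
    using int_iter_Suc[OF assms, of "i - 1 + k"] int_iter_Suc[OF assms(1) int_iter_in[OF assms], of "i - 1" k] step2
    by (simp add: algebra_simps)
  then have "inv_into (space M) F (F (int_iter M F (i - 1 + k) x)) =
      inv_into (space M) F (F (int_iter M F (i - 1) (int_iter M F k x)))" by simp
  then show ?case
    by (simp only: aut_inv_left[OF assms(1)] int_iter_in[OF assms] int_iter_in[OF assms(1) int_iter_in[OF assms]])
qed simp

text \<open>Forward steps are given by the assumption. For a backward step it is applied to the
  preimage \<open>w\<close>: if \<open>F'\<close> acts at \<open>w\<close> as the
  \<open>l\<close>-th power of \<open>F\<close>, then \<open>w\<close> is the image of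
  \<open>F' w\<close> under the power \<open>- l\<close>.\<close>

lemma orbit_of_subset:
  assumes F: "aut M F" and F': "aut M F'" and x: "x \<in> space M"
    and "\<And>x. x \<in> space M \<Longrightarrow> \<exists>k. F' x = int_iter M F k x"
  shows "orbit_of M F' x \<subseteq> orbit_of M F x"
proof -
  have "\<exists>j. int_iter M F' k x = int_iter M F j x" for k
  proof (induction k rule: int_induct[where k = 0])
    case base
    then show ?case by (intro exI[of _ 0]) simp
  next
    case (step1 i)
    then obtain j where j: "int_iter M F' i x = int_iter M F j x" by blast
    from assms(4)[OF int_iter_in[OF F' x, of i]] obtain l where
      "F' (int_iter M F' i x) = int_iter M F l (int_iter M F' i x)" by blast
    then have "int_iter M F' (i + 1) x = int_iter M F (l + j) x"
      by (simp add: int_iter_Suc[OF F' x] j int_iter_add[OF F x])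
    then show ?case by blast
  next
    case (step2 i)
    then obtain j where j: "int_iter M F' i x = int_iter M F j x" by blast
    let ?w = "int_iter M F' (i - 1) x"
    have w: "?w \<in> space M" by (rule int_iter_in[OF F' x])
    obtain l where l: "F' ?w = int_iter M F l ?w" using assms(4)[OF w] by blast
    have "int_iter M F j x = int_iter M F l ?w"
      using int_iter_Suc[OF F' x, of "i - 1"] j l by simp
    then have "int_iter M F (- l + j) x = int_iter M F (- l + l) ?w"
      by (simp only: int_iter_add[OF F w] int_iter_add[OF F x])
    then have "?w = int_iter M F (- l + j) x" by simp
    then show ?case by blast
  qed
  then show ?thesis unfolding orbit_of_def by auto
qed

lemma int_iter_cong:
  assumes "\<And>x. x \<in> space M \<Longrightarrow> F x = F' x" "aut M F" "x \<in> space M"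
  shows "int_iter M F k x = int_iter M F' k x"
proof -
  have "inv_into (space M) F = inv_into (space M) F'"
    unfolding inv_into_def by (intro ext arg_cong[where f = Eps]) (use assms(1) in auto)
  moreover have "(F ^^ n) x = (F' ^^ n) x" for n
  proof (induction n)
    case (Suc n)
    then show ?case using assms(1)[OF aut_funpow_in[OF assms(2,3), of n]] by simp
  qed simp
  ultimately show ?thesis by (simp add: int_iter_def)
qed

lemma funpow_block:
  assumes step: "\<And>x. x \<in> G \<Longrightarrow> p x + 1 < H \<Longrightarrow> F x \<in> G \<and> R (F x) = R x \<and> p (F x) = p x + (1::nat)"
    and "x \<in> G" "p x + d < H"
  shows "(F ^^ d) x \<in> G \<and> R ((F ^^ d) x) = R x \<and> p ((F ^^ d) x) = p x + d"
  using assms(2,3)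
proof (induction d)
  case (Suc d)
  then show ?case using step[of "(F ^^ d) x"] by auto
qed simp

text \<open>If \<open>F\<close> raises the position \<open>p\<close> by 1 inside each class of
  \<open>R\<close>, then powers of \<open>F\<close> are read off from differences of positions. This
  serves the odometer with \<open>val\<close> and the odomutant with \<open>pos\<close>, and so
  computes both cocycles.\<close>

lemma int_iter_block:
  assumes F: "aut M F" and G: "G \<subseteq> space M"
    and step: "\<And>x. x \<in> G \<Longrightarrow> p x + 1 < H \<Longrightarrow> F x \<in> G \<and> R (F x) = R x \<and> p (F x) = p x + (1::nat)"
    and uniq: "\<And>x y. x \<in> G \<Longrightarrow> y \<in> G \<Longrightarrow> R x = R y \<Longrightarrow> p x = p y \<Longrightarrow> x = y"
    and H: "\<And>x. x \<in> G \<Longrightarrow> p x < H"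
    and xy: "x \<in> G" "y \<in> G" "R x = R y"
  shows "int_iter M F (int (p y) - int (p x)) x = y"
proof -
  have *: "(F ^^ (p y - p x)) x = y" if "p x \<le> p y" "x \<in> G" "y \<in> G" "R x = R y" for x y
  proof -
    have "(F ^^ (p y - p x)) x \<in> G \<and> R ((F ^^ (p y - p x)) x) = R x \<and> p ((F ^^ (p y - p x)) x) = p x + (p y - p x)"
      by (rule funpow_block[where H = H]) (use step that H[OF that(3)] in auto)
    then show ?thesis using that by (intro uniq) auto
  qed
  show ?thesis
  proof (cases "p x \<le> p y")
    case True
    then show ?thesis using *[OF True xy] by (simp add: int_iter_def nat_diff_distrib)
  next
    case False
    define d where "d = p x - p y"
    have "x = (F ^^ d) y" using *[of y x] False xy by (simp add: d_def)
    also have "\<dots> = int_iter M F (int d) y" by (simp add: int_iter_def)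
    finally have "int_iter M F (- int d) x = int_iter M F (- int d + int d) y"
      using int_iter_add[OF F, of y "- int d" "int d"] xy G by auto
    then show ?thesis using False by (simp add: d_def of_nat_diff)
  qed
qed

text \<open>The blocks of level \<open>n\<close> are the classes of points with equal tails from
  \<open>blen n\<close> on.\<close>

abbreviation (input) tail :: "nat \<Rightarrow> (nat \<Rightarrow> nat) \<Rightarrow> nat \<Rightarrow> nat" where
  "tail n x \<equiv> (\<lambda>t. x (n + t))"

lemma tail_val_eqI:
  assumes "x \<in> \<Omega>" "y \<in> \<Omega>" "tail n x = tail n y" "val n x = val n y"
  shows "x = y"
proof
  fix t
  show "x t = y t"
  proof (cases "t < n")
    case True
    then show ?thesis using bits_val_eq_iff[OF assms(1,2), of 0 n] assms(4) by auto
  next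
    case False
    then show ?thesis using fun_cong[OF assms(3), of "t - n"] by auto
  qed
qed

section \<open>Addition with carry\<close>

lemma val_odometer_carry: "val n (dyadic_odometer x) + 2 ^ n * odometer_carry (\<lambda>_. 2) x n = val n x + 1"
proof (induction n)
  case (Suc n)
  let ?c = "odometer_carry (\<lambda>_. 2) x n"
  have "(x n + ?c) mod 2 + 2 * ((x n + ?c) div 2) = x n + ?c" by simp
  then have "2 ^ n * ((x n + ?c) mod 2) + 2 ^ n * (2 * ((x n + ?c) div 2)) = 2 ^ n * x n + 2 ^ n * ?c"
    by (metis distrib_left)
  then show ?case using Suc by (simp add: bits_val_def odometer_def algebra_simps)
qed (simp add: bits_val_def)

lemma odometer_in: "dyadic_odometer x \<in> \<Omega>"
  by (simp add: in_dyadic odometer_def)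

lemma val_odometer: "val n (dyadic_odometer x) = (val n x + 1) mod 2 ^ n"
proof -
  have "(val n x + 1) mod 2 ^ n = (val n (dyadic_odometer x) + 2 ^ n * odometer_carry (\<lambda>_. 2) x n) mod 2 ^ n"
    by (simp only: val_odometer_carry)
  then show ?thesis using bits_val_less[OF odometer_in, of 0 n x] by simp
qed

lemma tail_odometer:
  assumes "val n x + 1 < 2 ^ n" "x \<in> \<Omega>"
  shows "tail n (dyadic_odometer x) = tail n x"
proof
  have 0: "odometer_carry (\<lambda>_. 2) x n = 0"
  proof (rule ccontr)
    assume "odometer_carry (\<lambda>_. 2) x n \<noteq> 0"
    then have "2 ^ n \<le> 2 ^ n * odometer_carry (\<lambda>_. 2) x n" by simp
    then show False using val_odometer_carry[of n x] assms by linarith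
  qed
  fix t
  have x: "x i < 2" for i using assms(2) by (simp add: in_dyadic)
  then have "odometer_carry (\<lambda>_. 2) x (n + t) = 0" by (induction t) (auto simp: 0)
  then show "dyadic_odometer x (n + t) = x (n + t)" using x by (simp add: odometer_def)
qed

text \<open>In the 2-adic integers \<open>C x\<close> is -1 - x, so conjugation by \<open>C\<close>
  turns x + 1 into x - 1. The inverse of the odometer thus comes from the odometer itself.\<close>

lemma odometer_inverse:
  defines "C \<equiv> \<lambda>x (n :: nat). 1 - x n :: nat"
  assumes x: "x \<in> \<Omega>"
  shows "C (dyadic_odometer (C (dyadic_odometer x))) = x" "dyadic_odometer (C (dyadic_odometer (C x))) = x"
proof -
  have C: "C x \<in> \<Omega>" if "x \<in> \<Omega>" for x using that by (auto simp: C_def in_dyadic)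
  have val_C: "val n (C x) + val n x + 1 = 2 ^ n" if x: "x \<in> \<Omega>" for x n
  proof (induction n)
    case (Suc n)
    have "x n = 0 \<or> x n = 1" using x by (auto simp: in_dyadic less_2_cases_iff)
    then show ?case using Suc by (auto simp: bits_val_def C_def)
  qed (simp add: bits_val_def)
  have S: "(u + 1) mod N = (if u + 1 = N then 0 else u + 1)" if "u < N" for u N :: nat
    using that by auto
  have *: "v = u" if "v + ((w + 1) mod N) + 1 = N" "w + (u + 1) mod N + 1 = N" "u < N" "w < N" for u v w N :: nat
    using that S[of w N] S[of u N] by (auto split: if_splits)
  have **: "(w + 1) mod N = u" if "w + (v + 1) mod N + 1 = N" "v + u + 1 = N" "u < N" "w < N" for u v w N :: nat
    using that S[of w N] S[of v N] by (auto split: if_splits)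
  show "C (dyadic_odometer (C (dyadic_odometer x))) = x"
  proof (rule dyadic_eqI)
    fix n
    show "val n (C (dyadic_odometer (C (dyadic_odometer x)))) = val n x"
      using val_C[OF odometer_in, of n "C (dyadic_odometer x)"] val_C[OF odometer_in, of n x]
        bits_val_less[OF x, of 0 n] bits_val_less[OF C[OF odometer_in], of 0 n x]
      unfolding val_odometer by (rule *)
  qed (use x C odometer_in in auto)
  show "dyadic_odometer (C (dyadic_odometer (C x))) = x"
  proof (rule dyadic_eqI)
    fix n
    show "val n (dyadic_odometer (C (dyadic_odometer (C x)))) = val n x"
      using val_C[OF odometer_in, of n "C x"] val_C[OF x, of n]
        bits_val_less[OF x, of 0 n] bits_val_less[OF C[OF odometer_in], of 0 n "C x"]
      unfolding val_odometer by (rule **)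
  qed (use x C odometer_in in auto)
qed

lemma measurable_odometer [measurable]: "dyadic_odometer \<in> dyadic_space \<rightarrow>\<^sub>M dyadic_space"
proof (rule dyadic_measurableI[OF odometer_in])
  fix n
  show "(\<lambda>x. val n (dyadic_odometer x)) \<in> dyadic_space \<rightarrow>\<^sub>M count_space UNIV"
    unfolding val_odometer by (rule measurable_compose[OF measurable_bits_val]) simp
qed

lemma aut_odometer: "aut dyadic_space dyadic_odometer"
  unfolding aut_def mp_bij_def
proof (intro conjI)
  define C where "C = (\<lambda>x (n :: nat). 1 - x n :: nat)"
  define I where "I = (\<lambda>x. C (dyadic_odometer (C x)))"
  have C: "C x \<in> \<Omega>" if "x \<in> \<Omega>" for x using that by (auto simp: C_def in_dyadic)
  have inv: "I (dyadic_odometer x) = x" "dyadic_odometer (I x) = x" if "x \<in> \<Omega>" for x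
    unfolding I_def C_def using odometer_inverse[OF that] by simp_all
  have I_in: "I x \<in> \<Omega>" for x using C odometer_in by (auto simp: I_def)
  show bij: "bij_betw dyadic_odometer \<Omega> \<Omega>"
    by (rule bij_betwI[where g = I]) (use inv odometer_in I_in in auto)
  show "dyadic_odometer \<in> dyadic_space \<rightarrow>\<^sub>M dyadic_space" by simp
  have mC: "C \<in> dyadic_space \<rightarrow>\<^sub>M dyadic_space"
  proof (rule dyadic_measurableI[OF C])
    fix n
    have "val n (C x) = bits_val 0 n (C (\<lambda>t. (val n x div 2 ^ t) mod 2))" if "x \<in> \<Omega>" for x
      using bits_val_nth[OF that, of _ n 0] by (intro bits_val_cong) (simp add: C_def)
    then have "(\<lambda>x. val n (C x)) \<in> dyadic_space \<rightarrow>\<^sub>M count_space UNIV \<longleftrightarrow>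
       (\<lambda>x. (\<lambda>v. bits_val 0 n (C (\<lambda>t. (v div 2 ^ t) mod 2))) (val n x)) \<in> dyadic_space \<rightarrow>\<^sub>M count_space UNIV"
      by (intro measurable_cong) simp
    also have "\<dots>" by (rule measurable_compose[OF measurable_bits_val]) simp
    finally show "(\<lambda>x. val n (C x)) \<in> dyadic_space \<rightarrow>\<^sub>M count_space UNIV" .
  qed
  have mI: "I \<in> dyadic_space \<rightarrow>\<^sub>M dyadic_space"
    unfolding I_def by (intro measurable_compose[OF _ mC] measurable_compose[OF mC] measurable_odometer)
  have "inv_into \<Omega> dyadic_odometer x = I x" if "x \<in> \<Omega>" for x
    using that inv I_in bij by (metis bij_betw_inv_into_left)
  then show "inv_into \<Omega> dyadic_odometer \<in> dyadic_space \<rightarrow>\<^sub>M dyadic_space"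
    using mI by (simp cong: measurable_cong)
  show "distr dyadic_space dyadic_space dyadic_odometer = dyadic_space"
  proof (rule dyadic_measure_eqI)
    show "finite_measure (distr dyadic_space dyadic_space dyadic_odometer)"
      by (intro prob_space.finite_measure dyadic.prob_space_distr) simp
    fix n v :: nat assume v: "v < 2 ^ n"
    \<comment> \<open>The predecessor of \<open>v\<close> modulo \<open>2 ^ n\<close>.\<close>
    define u where "u = (if v = 0 then 2 ^ n - 1 else v - 1)"
    have u: "u < 2 ^ n" using v by (auto simp: u_def)
    have "(w + 1) mod 2 ^ n = v \<longleftrightarrow> w = u" if "w < 2 ^ n" for w
      using that v by (cases "w + 1 = 2 ^ n") (auto simp: u_def)
    then have "dyadic_odometer -` cyl n v \<inter> \<Omega> = cyl n u"
      using bits_val_less[of _ 0 n] odometer_in by (auto simp: val_odometer)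
    then show "emeasure (distr dyadic_space dyadic_space dyadic_odometer) (cyl n v) = emeasure dyadic_space (cyl n v)"
      using measure_bits_val[OF v, of 0] measure_bits_val[OF u, of 0] by (simp add: emeasure_distr dyadic.emeasure_eq_measure)
  qed auto
qed

lemma val_odometer_funpow: "val n ((dyadic_odometer ^^ k) x) mod 2 ^ n = (val n x + k) mod 2 ^ n"
proof (induction k)
  case (Suc k)
  have "val n ((dyadic_odometer ^^ Suc k) x) mod 2 ^ n = (val n ((dyadic_odometer ^^ k) x) mod 2 ^ n + 1) mod 2 ^ n"
    by (simp add: val_odometer mod_simps)
  also have "\<dots> = ((val n x + k) mod 2 ^ n + 1) mod 2 ^ n" by (simp only: Suc)
  finally show ?case by (simp add: mod_simps)
qed simp

text \<open>On the first \<open>k\<close> bits a period \<open>k\<close> would make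
  \<open>2 ^ k\<close> divide \<open>k\<close>.\<close>

lemma odometer_free:
  assumes "x \<in> \<Omega>" "k \<ge> 1"
  shows "(dyadic_odometer ^^ k) x \<noteq> x"
proof
  assume eq: "(dyadic_odometer ^^ k) x = x"
  have "(val k x + k) mod 2 ^ k = (val k x + 0) mod 2 ^ k"
    using val_odometer_funpow[of k k x] by (simp add: eq)
  then have "2 ^ k dvd k" using mod_eq_dvd_iff_nat[of "val k x" "val k x + k" "2 ^ k"] by simp
  then show False using assms(2) less_exp[of k] dvd_imp_le[of "2 ^ k" k] by linarith
qed

lemma int_iter_odometer:
  assumes "x \<in> \<Omega>" "y \<in> \<Omega>" "tail n x = tail n y"
  shows "int_iter dyadic_space dyadic_odometer (int (val n y) - int (val n x)) x = y"
proof (rule int_iter_block[OF aut_odometer order_refl, where H = "2 ^ n" and R = "tail n"])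
  fix x assume "x \<in> \<Omega>" "val n x + 1 < 2 ^ n"
  then show "dyadic_odometer x \<in> \<Omega> \<and> tail n (dyadic_odometer x) = tail n x \<and> val n (dyadic_odometer x) = val n x + 1"
    using tail_odometer odometer_in by (simp add: val_odometer)
qed (use assms tail_val_eqI bits_val_less in blast)+

section \<open>The odomutant\<close>

text \<open>In the rotated sequence, the map from \<open>t\<close> to \<open>x (rho e i t)\<close>,
  the lowest \<open>e\<close> bits of \<open>x\<close> occupy the window from \<open>e * i\<close>
  on. Counting in rotated bits therefore changes them only every \<open>2 ^ (e * i)\<close>
  steps.\<close>

definition rho :: "nat \<Rightarrow> nat \<Rightarrow> nat \<Rightarrow> nat" where
  "rho e i t = (if t < e * i then t + e else if t < e * i + e then t - e * i else t)"

definition rho_inv :: "nat \<Rightarrow> nat \<Rightarrow> nat \<Rightarrow> nat" where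
  "rho_inv e i t = (if t < e then t + e * i else if t < e * i + e then t - e else t)"

definition btype :: "nat \<Rightarrow> (nat \<Rightarrow> nat) \<Rightarrow> nat" where
  "btype n x = bits_val (blen n) (n + 8) x"

text \<open>The rotation of digit \<open>n\<close> is governed by bits from
  \<open>blen (Suc n)\<close> on, so the digits can be decoded from the top down.\<close>

definition dig :: "nat \<Rightarrow> (nat \<Rightarrow> nat) \<Rightarrow> nat" where
  "dig n x = val (dlen n) (\<lambda>t. x (blen n + rho (n + 8) (btype (Suc n) x) t))"

primrec pos :: "nat \<Rightarrow> (nat \<Rightarrow> nat) \<Rightarrow> nat" where
  "pos 0 x = val (blen 0) x"
| "pos (Suc n) x = pos n x + 2 ^ blen n * dig n x"

lemma btype_less: "x \<in> \<Omega> \<Longrightarrow> btype n x < 2 ^ (n + 8)"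
  unfolding btype_def by (rule bits_val_less)

lemma dig_less: "x \<in> \<Omega> \<Longrightarrow> dig n x < 2 ^ dlen n"
  unfolding dig_def by (rule bits_val_less) (simp add: in_dyadic)

lemma pos_less: "x \<in> \<Omega> \<Longrightarrow> pos n x < 2 ^ blen n"
proof (induction n)
  case (Suc n)
  have "2 ^ blen n * (dig n x + 1) \<le> 2 ^ blen n * 2 ^ dlen n"
    using dig_less[OF Suc.prems, of n] by (intro mult_le_mono) auto
  then show ?case using Suc by (simp add: blen_Suc power_add)
qed (simp add: bits_val_less)

lemma rho_inverse:
  "rho e i (rho_inv e i t) = t" "rho_inv e i (rho e i t) = t"
  by (auto simp: rho_def rho_inv_def)

text \<open>The part that is rotated ends at \<open>(n + 8) * (i + 1)\<close>, which lies within the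
  digit for all \<open>2 ^ (n + 9)\<close> types.\<close>

lemma rho_less:
  assumes "i < 2 ^ (n + 9)" "t < dlen n"
  shows "rho (n + 8) i t < dlen n" "rho_inv (n + 8) i t < dlen n"
proof -
  have "(n + 8) * i + (n + 8) = (n + 8) * Suc i" by simp
  also have "\<dots> \<le> dlen n" unfolding dlen_def using assms by (intro mult_le_mono) auto
  finally have "(n + 8) * i + (n + 8) \<le> dlen n" .
  then show "rho (n + 8) i t < dlen n" "rho_inv (n + 8) i t < dlen n"
    using assms(2) by (auto simp: rho_def rho_inv_def)
qed

lemma btype_Suc_less: "x \<in> \<Omega> \<Longrightarrow> btype (Suc n) x < 2 ^ (n + 9)"
  using btype_less[of x "Suc n"] by (simp add: numeral_eq_Suc)

lemma strict_mono_blen: "strict_mono blen"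
  by (simp add: strict_mono_Suc_iff blen_Suc dlen_def)

lemma blen_less: "n < m \<Longrightarrow> blen n < blen m"
  by (rule strict_mono_less[OF strict_mono_blen, THEN iffD2])

lemma blen_le: "n \<le> m \<Longrightarrow> blen n \<le> blen m"
  using blen_less[of n m] by (cases "n = m") auto

lemma blen_ge: "n \<le> blen n"
  by (rule strict_mono_imp_increasing[OF strict_mono_blen])

lemma level_cases:
  assumes "blen k \<le> t"
  obtains n s where "n \<ge> k" "t = blen n + s" "s < dlen n"
proof -
  define n where "n = (GREATEST n. blen n \<le> t)"
  have bd: "\<forall>n. blen n \<le> t \<longrightarrow> n \<le> t" using blen_ge order_trans by blast
  have 1: "blen n \<le> t" unfolding n_def by (rule GreatestI_nat[where P = "\<lambda>n. blen n \<le> t", OF assms]) (use bd in auto)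
  have 2: "k \<le> n" unfolding n_def by (rule Greatest_le_nat[where P = "\<lambda>n. blen n \<le> t", OF assms]) (use bd in auto)
  have "\<not> blen (Suc n) \<le> t"
  proof
    assume "blen (Suc n) \<le> t"
    then have "Suc n \<le> n" unfolding n_def by (rule Greatest_le_nat[where P = "\<lambda>n. blen n \<le> t"]) (use bd in auto)
    then show False by simp
  qed
  then show ?thesis using that[of n "t - blen n"] 1 2 by (auto simp: blen_Suc)
qed

section \<open>Blocks and the positions in them\<close>

lemma tail_mono: "tail n x = tail n y \<Longrightarrow> n \<le> m \<Longrightarrow> tail m x = tail m y"
  by (metis add.assoc le_Suc_ex)

lemma tailD: "tail n x = tail n y \<Longrightarrow> t \<ge> n \<Longrightarrow> x t = y t"
  by (metis le_Suc_ex)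

lemma tailI: "(\<And>t. t \<ge> n \<Longrightarrow> x t = y t) \<Longrightarrow> tail n x = tail n y"
  by auto

lemma btype_tail: "tail (blen n) x = tail (blen n) y \<Longrightarrow> btype n x = btype n y"
  unfolding btype_def by (rule bits_val_cong) (auto dest: fun_cong)

lemma dig_tail: "tail (blen n) x = tail (blen n) y \<Longrightarrow> dig n x = dig n y"
proof -
  assume t: "tail (blen n) x = tail (blen n) y"
  have "btype (Suc n) x = btype (Suc n) y" by (intro btype_tail tail_mono[OF t] blen_le) simp
  then show ?thesis unfolding dig_def using tailD[OF t] by simp
qed

text \<open>Decoding from the top: the tail fixes the type of the larger block, this undoes the
  rotation of the digit below, and then the tail is known one level further down.\<close>

lemma pos_tail_eqI:
  assumes "x \<in> \<Omega>" "y \<in> \<Omega>" "tail (blen n) x = tail (blen n) y" "pos n x = pos n y"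
  shows "x = y"
  using assms
proof (induction n)
  case 0
  then show ?case using tail_val_eqI[of x y "blen 0"] by simp
next
  case (Suc n)
  have pn: "pos n x = pos n y" and dn: "dig n x = dig n y"
  proof -
    have "pos (Suc n) x mod 2 ^ blen n = pos (Suc n) y mod 2 ^ blen n" by (simp only: Suc.prems)
    then show "pos n x = pos n y" using pos_less Suc.prems by simp
    then show "dig n x = dig n y" using Suc.prems by simp
  qed
  have ty: "btype (Suc n) x = btype (Suc n) y" by (rule btype_tail) (rule Suc.prems)
  have eq: "x (blen n + s) = y (blen n + s)" if s: "s < dlen n" for s
  proof -
    let ?r = "rho (n + 8) (btype (Suc n) x)" and ?q = "rho_inv (n + 8) (btype (Suc n) x)"
    have "\<forall>t<dlen n. x (blen n + ?r (0 + t)) = y (blen n + ?r (0 + t))"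
      using dn unfolding dig_def ty[symmetric]
      by (subst (asm) bits_val_eq_iff) (use Suc.prems in \<open>auto simp: in_dyadic\<close>)
    moreover have "?q s < dlen n" by (rule rho_less[OF btype_Suc_less[OF Suc.prems(1)] s])
    ultimately have "x (blen n + ?r (?q s)) = y (blen n + ?r (?q s))" by simp
    then show ?thesis by (simp add: rho_inverse)
  qed
  have "tail (blen n) x = tail (blen n) y"
  proof
    fix t
    show "x (blen n + t) = y (blen n + t)"
    proof (cases "t < dlen n")
      case False
      then show ?thesis using tailD[OF Suc.prems(3), of "blen n + t"] by (simp add: blen_Suc)
    qed (rule eq)
  qed
  then show ?case using Suc pn by blast
qed

text \<open>Together with \<open>pos_tail_eqI\<close> this says that \<open>pos n\<close> numbers
  the points of a block bijectively.\<close>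

lemma pos_ex:
  assumes "x \<in> \<Omega>" "p < 2 ^ blen n"
  shows "\<exists>y\<in>\<Omega>. tail (blen n) y = tail (blen n) x \<and> pos n y = p"
  using assms
proof (induction n arbitrary: x p)
  case 0
  define y where "y = (\<lambda>t. if t < blen 0 then (p div 2 ^ t) mod 2 else x t)"
  have "val (blen 0) y = val (blen 0) (\<lambda>t. (p div 2 ^ t) mod 2)" by (rule bits_val_cong) (simp add: y_def)
  then have "pos 0 y = p" using 0 by (simp add: bits_val_bits)
  moreover have "y \<in> \<Omega>" using 0 by (simp add: y_def in_dyadic)
  moreover have "tail (blen 0) y = tail (blen 0) x" by (simp add: y_def)
  ultimately show ?case by blast
next
  case (Suc n)
  let ?i = "btype (Suc n) x"
  define d where "d = p div 2 ^ blen n"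
  \<comment> \<open>Installs the digit \<open>d\<close> before the lower bits are chosen. The type
    that governs its rotation lies higher and is left alone.\<close>
  define x' where "x' = (\<lambda>t. if blen n \<le> t \<and> t < blen (Suc n) then (d div 2 ^ rho_inv (n + 8) ?i (t - blen n)) mod 2 else x t)"
  have x': "x' \<in> \<Omega>" using Suc.prems by (simp add: x'_def in_dyadic)
  have t': "tail (blen (Suc n)) x' = tail (blen (Suc n)) x" by (rule tailI) (simp add: x'_def)
  have d: "d < 2 ^ dlen n" using Suc.prems(2)
    by (simp add: d_def blen_Suc power_add less_mult_imp_div_less mult.commute)
  have "dig n x' = val (dlen n) (\<lambda>t. (d div 2 ^ t) mod 2)"
    unfolding dig_def btype_tail[OF t']
    by (rule bits_val_cong) (use rho_less[OF btype_Suc_less[OF Suc.prems(1)]] in \<open>auto simp: x'_def blen_Suc rho_inverse\<close>)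
  then have dx': "dig n x' = d" using d by (simp add: bits_val_bits)
  obtain y where y: "y \<in> \<Omega>" "tail (blen n) y = tail (blen n) x'" "pos n y = p mod 2 ^ blen n"
    using Suc.IH[OF x', of "p mod 2 ^ blen n"] by auto
  have "pos (Suc n) y = p" using y dig_tail[OF y(2)] dx' by (simp add: d_def)
  moreover have "tail (blen (Suc n)) y = tail (blen (Suc n)) x"
    using tail_mono[OF y(2) blen_le, of "Suc n"] t' by simp
  ultimately show ?case using y(1) by blast
qed

text \<open>Points of one block have equal higher digits, so their positions differ by the same
  amount at all higher levels. Hence the successor in a block does not depend on the level.\<close>

lemma pos_tail_mono:
  assumes "tail (blen n) y = tail (blen n) x" "pos n y = pos n x + d" "n \<le> m"
  shows "tail (blen m) y = tail (blen m) x \<and> pos m y = pos m x + d"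
  using assms(3)
proof (induction m rule: dec_induct)
  case base
  then show ?case using assms by simp
next
  case (step m)
  then show ?case using dig_tail[where n = m and x = y and y = x]
      tail_mono[where n = "blen m" and x = y and y = x and m = "blen (Suc m)"] blen_le[of m "Suc m"]
    by auto
qed

text \<open>The rotations below level \<open>n\<close> involve the type of the block of level
  \<open>n\<close>, which uses bits beyond \<open>blen n\<close>; up to \<open>blen (Suc n)\<close>
  there is room for it.\<close>

lemma pos_cong:
  assumes "x \<in> \<Omega>" "y \<in> \<Omega>" "val M x = val M y" "blen (Suc n) \<le> M"
  shows "pos n x = pos n y"
proof -
  have eq: "x t = y t" if "t < M" for t using bits_val_eq_iff[OF assms(1,2), of 0 M] assms(3) that by simp
  have le: "k \<le> n \<Longrightarrow> pos k x = pos k y" for k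
  proof (induction k)
    case 0
    have "blen 0 \<le> M" using assms(4) blen_le[of 0 "Suc n"] by simp
    then show ?case by (auto intro!: bits_val_cong eq)
  next
    case (Suc k)
    have b: "blen (Suc k) + dlen (Suc k) \<le> M" using assms(4) Suc.prems blen_le[of "Suc (Suc k)" "Suc n"] by (simp add: blen_Suc)
    have "Suc k + 8 \<le> (Suc k + 8) * 2 ^ (Suc k + 9)" by simp
    then have "Suc k + 8 \<le> dlen (Suc k)" unfolding dlen_def .
    then have ty: "btype (Suc k) x = btype (Suc k) y" unfolding btype_def using b by (intro bits_val_cong eq) simp
    have r: "blen k + rho (k + 8) (btype (Suc k) y) t < M" if "t < dlen k" for t
      using rho_less(1)[OF btype_Suc_less[OF assms(2), of k] that] b by (simp add: blen_Suc)
    have "dig k x = dig k y"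
      unfolding dig_def ty by (intro bits_val_cong eq) (simp add: r)
    then show ?case using Suc by simp
  qed
  show ?thesis by (rule le) simp
qed

lemma measurable_pos [measurable]: "pos n \<in> dyadic_space \<rightarrow>\<^sub>M count_space UNIV"
proof -
  have "pos n x = pos n (\<lambda>t. (val (blen (Suc n)) x div 2 ^ t) mod 2)" if x: "x \<in> \<Omega>" for x
    by (rule pos_cong[OF x _ _ order_refl]) (use bits_val_less[OF x] in \<open>auto simp: in_dyadic bits_val_bits\<close>)
  then have "pos n \<in> dyadic_space \<rightarrow>\<^sub>M count_space UNIV \<longleftrightarrow>
    (\<lambda>x. (\<lambda>v. pos n (\<lambda>t. (v div 2 ^ t) mod 2)) (val (blen (Suc n)) x)) \<in> dyadic_space \<rightarrow>\<^sub>M count_space UNIV"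
    by (intro measurable_cong) simp
  also have "\<dots>" by (rule measurable_compose[OF measurable_bits_val]) simp
  finally show ?thesis .
qed

text \<open>The other sequences are eventually constant, and on some of them a carry runs through
  all levels. They form a null set, invariant under the odometer, on which \<open>T\<close> is set
  equal to \<open>S\<close>.\<close>

definition nonconst :: "(nat \<Rightarrow> nat) set" where
  "nonconst = {x \<in> \<Omega>. \<forall>n. (\<exists>t\<ge>n. x t = 0) \<and> (\<exists>t\<ge>n. x t = 1)}"

lemma nonconst_in: "x \<in> nonconst \<Longrightarrow> x \<in> \<Omega>"
  by (simp add: nonconst_def)

lemma sets_nonconst [measurable]: "nonconst \<in> sets dyadic_space"
  unfolding nonconst_def by measurable

lemma nonconst_tail:
  assumes "tail n y = tail n x" "y \<in> \<Omega>" "x \<in> nonconst"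
  shows "y \<in> nonconst"
  unfolding nonconst_def
proof (intro CollectI conjI allI)
  fix m
  obtain t t' where "t \<ge> max n m" "x t = 0" "t' \<ge> max n m" "x t' = 1"
    using assms(3) unfolding nonconst_def by blast
  then show "\<exists>t\<ge>m. y t = 0" "\<exists>t\<ge>m. y t = 1" using tailD[OF assms(1)] by (metis max.bounded_iff)+
qed fact

lemma bits_val_ones: "bits_val m L (\<lambda>_. 1) + 1 = 2 ^ L"
  by (induction L) (auto simp: bits_val_def)

lemma AE_nonconst: "AE x in dyadic_space. x \<in> nonconst"
proof -
  have null: "{x \<in> \<Omega>. \<forall>t\<ge>n. x t = c} \<in> null_sets dyadic_space" if c: "c < 2" for n c :: nat
  proof -
    let ?A = "{x \<in> \<Omega>. \<forall>t\<ge>n. x t = c}"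
    have A: "?A \<in> sets dyadic_space" by measurable
    have "\<mu> ?A \<le> (1 / 2) ^ L" for L
    proof -
      have v: "bits_val n L (\<lambda>_. c) < 2 ^ L" by (rule bits_val_less) (use c in \<open>simp add: in_dyadic\<close>)
      have "\<mu> ?A \<le> \<mu> {x \<in> \<Omega>. bits_val n L x = bits_val n L (\<lambda>_. c)}"
        by (rule dyadic.finite_measure_mono) (auto intro!: bits_val_cong)
      then show ?thesis using measure_bits_val[OF v, of n] by (simp add: power_one_over)
    qed
    moreover have "(\<lambda>L. (1 / 2 :: real) ^ L) \<longlonglongrightarrow> 0" by (intro LIMSEQ_power_zero) simp
    ultimately have "\<mu> ?A \<le> 0"
      by (intro LIMSEQ_le_const[where X = "\<lambda>L. (1 / 2 :: real) ^ L"]) auto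
    then show ?thesis using A by (intro null_setsI) (simp_all add: dyadic.emeasure_eq_measure measure_le_0_iff)
  qed
  have "(\<Union>n. {x \<in> \<Omega>. \<forall>t\<ge>n. x t = 0} \<union> {x \<in> \<Omega>. \<forall>t\<ge>n. x t = 1}) \<in> null_sets dyadic_space"
    by (intro null_sets_UN null_sets.Un null) auto
  moreover have "{x \<in> \<Omega>. x \<notin> nonconst} \<subseteq>
     (\<Union>n. {x \<in> \<Omega>. \<forall>t\<ge>n. x t = 0} \<union> {x \<in> \<Omega>. \<forall>t\<ge>n. x t = 1})"
  proof (rule subsetI)
    fix x assume "x \<in> {x \<in> \<Omega>. x \<notin> nonconst}"
    then have x: "x \<in> \<Omega>" "x \<notin> nonconst" by simp_all
    then obtain n where n: "(\<forall>t\<ge>n. x t \<noteq> 0) \<or> (\<forall>t\<ge>n. x t \<noteq> 1)" unfolding nonconst_def by auto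
    have "x t = 0 \<or> x t = 1" for t using x(1) by (auto simp: in_dyadic less_2_cases_iff)
    with n have "(\<forall>t\<ge>n. x t = 1) \<or> (\<forall>t\<ge>n. x t = 0)" by metis
    then have "x \<in> {x \<in> \<Omega>. \<forall>t\<ge>n. x t = 0} \<union> {x \<in> \<Omega>. \<forall>t\<ge>n. x t = 1}"
      using x(1) by auto
    then show "x \<in> (\<Union>n. {x \<in> \<Omega>. \<forall>t\<ge>n. x t = 0} \<union> {x \<in> \<Omega>. \<forall>t\<ge>n. x t = 1})"
      by (rule UN_I[OF UNIV_I])
  qed
  ultimately show ?thesis by (rule AE_I')
qed

text \<open>A permutation of the bits cannot hide a 0 or a 1, so an extreme value of the rotated
  digit betrays constant bits.\<close>

lemma dig_extreme:
  assumes x: "x \<in> \<Omega>" and s: "s < dlen n"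
  shows "dig n x + 1 = 2 ^ dlen n \<Longrightarrow> x (blen n + s) = 1" "dig n x = 0 \<Longrightarrow> x (blen n + s) = 0"
proof -
  let ?r = "rho (n + 8) (btype (Suc n) x)" and ?q = "rho_inv (n + 8) (btype (Suc n) x)"
  have z: "(\<lambda>t. x (blen n + ?r t)) \<in> \<Omega>" using x by (simp add: in_dyadic)
  have q: "?q s < dlen n" by (rule rho_less[OF btype_Suc_less[OF x] s])
  have c: "(\<lambda>_. c) \<in> \<Omega>" if "c < 2" for c using that by (simp add: in_dyadic)
  have main: "x (blen n + s) = c" if "dig n x = val (dlen n) (\<lambda>_. c)" "c < 2" for c
    using that bits_val_eq_iff[OF z c[OF that(2)], of 0 "dlen n"] q by (simp add: dig_def) (metis rho_inverse(1))
  show "x (blen n + s) = 1" if "dig n x + 1 = 2 ^ dlen n"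
    by (rule main) (use that bits_val_ones[of 0 "dlen n"] in simp_all)
  show "x (blen n + s) = 0" if "dig n x = 0"
    by (rule main) (use that in \<open>simp_all add: bits_val_def\<close>)
qed

lemma pos_room:
  assumes x: "x \<in> nonconst"
  shows "\<exists>n. pos n x + k < 2 ^ blen n"
proof -
  obtain t where t: "t \<ge> blen k" "x t = 0" using x unfolding nonconst_def by blast
  then obtain n s where n: "n \<ge> k" "t = blen n + s" "s < dlen n" using level_cases by blast
  have "dig n x + 1 \<noteq> 2 ^ dlen n" using dig_extreme(1)[OF nonconst_in[OF x] n(3)] t n by auto
  \<comment> \<open>A digit that is not maximal leaves at least one whole block of level
    \<open>n\<close> ahead, which is longer than \<open>k\<close>.\<close>
  then have "dig n x + 2 \<le> 2 ^ dlen n" using dig_less[OF nonconst_in[OF x], of n] by linarith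
  then have "2 ^ blen n * (dig n x + 2) \<le> 2 ^ blen n * 2 ^ dlen n" by (intro mult_le_mono) auto
  moreover have "k < 2 ^ blen n"
    using n(1) blen_ge[of n] less_exp[of "blen n"] by linarith
  ultimately have "pos (Suc n) x + k < 2 ^ blen (Suc n)"
    using pos_less[OF nonconst_in[OF x], of n] by (simp add: blen_Suc power_add)
  then show ?thesis by blast
qed

lemma pos_positive:
  assumes x: "x \<in> nonconst"
  shows "\<exists>n. pos n x > 0"
proof -
  obtain t where t: "t \<ge> blen 0" "x t = 1" using x unfolding nonconst_def by blast
  then obtain n s where n: "t = blen n + s" "s < dlen n" using level_cases by blast
  then have "dig n x \<noteq> 0" using dig_extreme(2)[OF nonconst_in[OF x] n(2)] t n by auto
  then have "pos (Suc n) x > 0" by simp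
  then show ?thesis by blast
qed

section \<open>The successor map in the blocks\<close>

definition odomutant :: "(nat \<Rightarrow> nat) \<Rightarrow> nat \<Rightarrow> nat" where
  "odomutant x = (if x \<in> nonconst
     then THE y. y \<in> \<Omega> \<and> (\<exists>n. tail (blen n) y = tail (blen n) x \<and> pos n y = pos n x + 1)
     else dyadic_odometer x)"

text \<open>Candidates found at different levels are compared at the larger level, where the
  position determines the point.\<close>

lemma odomutant_eqI:
  assumes x: "x \<in> nonconst" and y: "y \<in> \<Omega>" "tail (blen n) y = tail (blen n) x" "pos n y = pos n x + 1"
  shows "odomutant x = y"
proof -
  have "(THE y. y \<in> \<Omega> \<and> (\<exists>n. tail (blen n) y = tail (blen n) x \<and> pos n y = pos n x + 1)) = y"
  proof (rule the_equality)
    fix y' assume y': "y' \<in> \<Omega> \<and> (\<exists>n. tail (blen n) y' = tail (blen n) x \<and> pos n y' = pos n x + 1)"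
    then obtain n' where n': "tail (blen n') y' = tail (blen n') x" "pos n' y' = pos n' x + 1" by blast
    define m where "m = max n n'"
    show "y' = y"
      by (rule pos_tail_eqI[where n = m])
        (use y y' pos_tail_mono[OF y(2,3), where m = m] pos_tail_mono[OF n', where m = m] in \<open>auto simp: m_def\<close>)
  qed (use y in blast)
  then show ?thesis using x by (simp add: odomutant_def)
qed

lemma odomutant_block:
  assumes x: "x \<in> nonconst" and p: "pos n x + 1 < 2 ^ blen n"
  shows "odomutant x \<in> nonconst \<and> tail (blen n) (odomutant x) = tail (blen n) x \<and> pos n (odomutant x) = pos n x + 1"
proof -
  obtain y where y: "y \<in> \<Omega>" "tail (blen n) y = tail (blen n) x" "pos n y = pos n x + 1"
    using pos_ex[OF nonconst_in[OF x] p] by blast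
  have "odomutant x = y" by (rule odomutant_eqI[OF x y])
  then show ?thesis using y nonconst_tail[OF y(2,1) x] by simp
qed

lemma odomutant_nonconst: "x \<in> nonconst \<Longrightarrow> odomutant x \<in> nonconst"
  using pos_room[of x 1] odomutant_block by blast

lemma odomutant_off: "x \<notin> nonconst \<Longrightarrow> odomutant x = dyadic_odometer x"
  by (simp add: odomutant_def)

text \<open>The odometer changes finitely many bits, except at the sequence of ones, whose image is
  the sequence of zeros.\<close>

lemma odometer_nonconst_iff:
  assumes x: "x \<in> \<Omega>"
  shows "dyadic_odometer x \<in> nonconst \<longleftrightarrow> x \<in> nonconst"
proof (cases "\<exists>n. val n x + 1 < 2 ^ n")
  case True
  then obtain n where n: "tail n (dyadic_odometer x) = tail n x" using tail_odometer[OF _ x] by blast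
  show ?thesis using nonconst_tail[OF n odometer_in] nonconst_tail[OF n[symmetric] x] by blast
next
  case False
  have v: "val n x + 1 = 2 ^ n" for n using False bits_val_less[OF x, of 0 n] by (metis Suc_eq_plus1 Suc_leI le_neq_implies_less)
  have 1: "val n x = val n (\<lambda>_. 1)" for n using v[of n] bits_val_ones[of 0 n] by simp
  have x1: "x = (\<lambda>_. 1)" by (rule dyadic_eqI[OF x _ 1]) (simp add: in_dyadic)
  have 0: "val n (dyadic_odometer x) = val n (\<lambda>_. 0)" for n using v[of n] by (simp add: val_odometer) (simp add: bits_val_def)
  have x0: "dyadic_odometer x = (\<lambda>_. 0)" by (rule dyadic_eqI[OF odometer_in _ 0]) (simp add: in_dyadic)
  show ?thesis unfolding x0 unfolding x1 by (simp add: nonconst_def)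
qed

lemma odomutant_in: "x \<in> \<Omega> \<Longrightarrow> odomutant x \<in> \<Omega>"
  using odomutant_nonconst nonconst_in odomutant_off odometer_in by metis

lemma odomutant_nonconst_iff: "x \<in> \<Omega> \<Longrightarrow> odomutant x \<in> nonconst \<longleftrightarrow> x \<in> nonconst"
  using odomutant_nonconst odomutant_off odometer_nonconst_iff by metis

lemma odomutant_preimage:
  assumes y: "y \<in> nonconst" and p: "pos n y = Suc p"
  obtains x where "x \<in> nonconst" "odomutant x = y" "pos n x = p"
proof -
  have "p < 2 ^ blen n" using pos_less[OF nonconst_in[OF y], of n] p by simp
  then obtain x where x: "x \<in> \<Omega>" "tail (blen n) x = tail (blen n) y" "pos n x = p"
    using pos_ex[OF nonconst_in[OF y]] by blast
  have xG: "x \<in> nonconst" by (rule nonconst_tail[OF x(2,1) y])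
  have "odomutant x = y" using x p by (intro odomutant_eqI[OF xG nonconst_in[OF y], where n = n]) auto
  then show ?thesis using that xG x by blast
qed

lemma odomutant_inj:
  assumes xy: "x \<in> \<Omega>" "y \<in> \<Omega>" and eq: "odomutant x = odomutant y"
  shows "x = y"
proof (cases "x \<in> nonconst")
  case True
  then have y: "y \<in> nonconst" using xy eq odomutant_nonconst_iff by metis
  obtain n where n: "pos n x + 1 < 2 ^ blen n" using pos_room[OF True] by blast
  obtain n' where n': "pos n' y + 1 < 2 ^ blen n'" using pos_room[OF y] by blast
  define m where "m = max n n'"
  note bx = odomutant_block[OF True n] and by' = odomutant_block[OF y n']
  have 1: "tail (blen m) (odomutant x) = tail (blen m) x \<and> pos m (odomutant x) = pos m x + 1"
    by (rule pos_tail_mono[where n = n]) (use bx in \<open>auto simp: m_def\<close>)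
  have 2: "tail (blen m) (odomutant y) = tail (blen m) y \<and> pos m (odomutant y) = pos m y + 1"
    by (rule pos_tail_mono[where n = n']) (use by' in \<open>auto simp: m_def\<close>)
  show ?thesis using 1 2 eq by (intro pos_tail_eqI[OF xy, where n = m]) auto
next
  case False
  then have "y \<notin> nonconst" using xy eq odomutant_nonconst_iff by metis
  then have "dyadic_odometer x = dyadic_odometer y" using eq False by (simp add: odomutant_off)
  then show ?thesis using xy aut_bij[OF aut_odometer] by (meson bij_betw_def inj_onD)
qed

lemma bij_odomutant: "bij_betw odomutant \<Omega> \<Omega>"
proof (rule bij_betw_imageI)
  show "inj_on odomutant \<Omega>" using odomutant_inj by (intro inj_onI) auto
  show "odomutant ` \<Omega> = \<Omega>"
  proof (intro equalityI subsetI)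
    fix y assume y: "y \<in> \<Omega>"
    show "y \<in> odomutant ` \<Omega>"
    proof (cases "y \<in> nonconst")
      case True
      then obtain n where "pos n y > 0" using pos_positive by blast
      then obtain p where "pos n y = Suc p" by (cases "pos n y") auto
      then obtain x where "x \<in> nonconst" "odomutant x = y" by (rule odomutant_preimage[OF True])
      then show ?thesis using nonconst_in by auto
    next
      case False
      obtain x where x: "x \<in> \<Omega>" "dyadic_odometer x = y"
        using aut_bij[OF aut_odometer] y by (metis bij_betw_imp_surj_on imageE)
      then have "x \<notin> nonconst" using False odometer_nonconst_iff by blast
      then show ?thesis using x by (metis odomutant_off imageI)
    qed
  qed (use odomutant_in in auto)
qed

text \<open>A step inside a block of level \<open>n\<close> is decided by the first \<open>M\<close>
  bits. Measurability of the odomutant rests on this.\<close>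

lemma odomutant_local:
  assumes x: "x \<in> nonconst" "x' \<in> nonconst" and p: "pos n x + 1 < 2 ^ blen n"
    and M: "val M x = val M x'" "blen (Suc n) \<le> M"
  shows "val M (odomutant x) = val M (odomutant x')"
proof -
  note sp = nonconst_in[OF x(1)] nonconst_in[OF x(2)]
  have eq: "x t = x' t" if "t < M" for t using bits_val_eq_iff[OF sp, of 0 M] M(1) that by simp
  have T: "odomutant x \<in> nonconst" "tail (blen n) (odomutant x) = tail (blen n) x" "pos n (odomutant x) = pos n x + 1"
    using odomutant_block[OF x(1) p] by auto
  \<comment> \<open>The successor of \<open>x'\<close>: the bits of the image of \<open>x\<close>
    below \<open>M\<close>, those of \<open>x'\<close> above.\<close>
  define y where "y = (\<lambda>t. if t < M then odomutant x t else x' t)"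
  have y: "y \<in> \<Omega>" using nonconst_in[OF T(1)] sp(2) by (simp add: y_def in_dyadic)
  have vy: "val M y = val M (odomutant x)" by (rule bits_val_cong) (simp add: y_def)
  have "tail (blen n) y = tail (blen n) x'"
    by (rule tailI) (use tailD[OF T(2)] eq in \<open>auto simp: y_def\<close>)
  moreover have "pos n y = pos n x' + 1"
    using pos_cong[OF y nonconst_in[OF T(1)] vy M(2)] T(3) pos_cong[OF sp M] by simp
  ultimately have "odomutant x' = y" using x(2) y by (intro odomutant_eqI)
  then show ?thesis using vy by simp
qed

lemma measurable_odomutant [measurable]: "odomutant \<in> dyadic_space \<rightarrow>\<^sub>M dyadic_space"
proof (rule dyadic_measurableI[OF odomutant_in])
  fix m
  have A: "{x \<in> \<Omega>. val m (odomutant x) = v} \<in> sets dyadic_space" for v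
  proof -
    \<comment> \<open>Splits the set by a level at which the step stays inside the block.\<close>
    define B where "B = (\<lambda>n. {x \<in> nonconst. pos n x + 1 < 2 ^ blen n \<and> val m (odomutant x) = v})"
    have B: "B n \<in> sets dyadic_space" for n
    proof -
      define M where "M = max m (blen (Suc n))"
      define V where "V = val M ` B n"
      have "B n = {x \<in> \<Omega>. x \<in> nonconst \<and> val M x \<in> V}"
      proof (intro equalityI subsetI)
        fix x' assume "x' \<in> {x \<in> \<Omega>. x \<in> nonconst \<and> val M x \<in> V}"
        then obtain x where x': "x' \<in> nonconst" and x: "x \<in> B n" "val M x = val M x'" by (auto simp: V_def)
        have le: "blen (Suc n) \<le> M" "m \<le> M" by (auto simp: M_def)
        have x2: "x \<in> nonconst" "pos n x + 1 < 2 ^ blen n" "val m (odomutant x) = v" using x(1) by (auto simp: B_def)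
        have "val M (odomutant x) = val M (odomutant x')" by (rule odomutant_local[OF x2(1) x' x2(2) x(2) le(1)])
        then have "val m (odomutant x') = v"
          using x2(3) val_mod[OF _ le(2)] odomutant_in nonconst_in x2(1) x' by metis
        moreover have "pos n x' = pos n x"
          using pos_cong[OF nonconst_in[OF x'] nonconst_in[OF x2(1)] _ le(1)] x(2) by simp
        ultimately show "x' \<in> B n" using x' x2(2) by (simp add: B_def)
      qed (auto simp: B_def V_def nonconst_in)
      also have "\<dots> \<in> sets dyadic_space" by measurable
      finally show ?thesis .
    qed
    have "{x \<in> \<Omega>. val m (odomutant x) = v} =
      (\<Union>n. B n) \<union> {x \<in> \<Omega>. x \<notin> nonconst \<and> val m (dyadic_odometer x) = v}"
    proof (intro equalityI subsetI)
      fix x assume x: "x \<in> {x \<in> \<Omega>. val m (odomutant x) = v}"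
      show "x \<in> (\<Union>n. B n) \<union> {x \<in> \<Omega>. x \<notin> nonconst \<and> val m (dyadic_odometer x) = v}"
        using x pos_room[of x 1] by (cases "x \<in> nonconst") (auto simp: B_def odomutant_off)
    qed (auto simp: B_def nonconst_in odomutant_off)
    also have "\<dots> \<in> sets dyadic_space"
    proof (intro sets.Un sets.countable_UN)
      show "{x \<in> \<Omega>. x \<notin> nonconst \<and> val m (dyadic_odometer x) = v} \<in> sets dyadic_space" by measurable
    qed (use B in auto)
    finally show ?thesis .
  qed
  show "(\<lambda>x. val m (odomutant x)) \<in> dyadic_space \<rightarrow>\<^sub>M count_space UNIV"
  proof -
    have "(\<lambda>x. val m (odomutant x)) -` {v} \<inter> \<Omega> = {x \<in> \<Omega>. val m (odomutant x) = v}" for v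
      by auto
    then show ?thesis using A by (subst measurable_count_space_eq2_countable) auto
  qed
qed

section \<open>Orbit equivalence with the odometer\<close>

lemma aut_image:
  assumes F: "aut M F" and A: "A \<in> sets M"
  shows "F ` A \<in> sets M" "emeasure M (F ` A) = emeasure M A"
    "inv_into (space M) F ` A \<in> sets M" "emeasure M (inv_into (space M) F ` A) = emeasure M A"
proof -
  have sub: "A \<subseteq> space M" using A sets.sets_into_space by blast
  have inv: "inv_into (space M) F \<in> M \<rightarrow>\<^sub>M M" and meas: "F \<in> M \<rightarrow>\<^sub>M M" and distr: "distr M M F = M"
    using F by (auto simp: aut_def mp_bij_def)
  have pre: "emeasure M (F -` B \<inter> space M) = emeasure M B" if "B \<in> sets M" for B
    using emeasure_distr[OF meas that] distr by simp
  have "F ` A = inv_into (space M) F -` A \<inter> space M"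
    using sub aut_in[OF F] aut_inv_left[OF F] aut_inv_right[OF F] by force
  then show 1: "F ` A \<in> sets M" using measurable_sets[OF inv A] by simp
  have "F -` (F ` A) \<inter> space M = A"
    using sub bij_betw_imp_inj_on[OF aut_bij[OF F]] by (auto dest: inj_onD)
  then show "emeasure M (F ` A) = emeasure M A" using pre[OF 1] by simp
  have 2: "inv_into (space M) F ` A = F -` A \<inter> space M"
    using sub aut_inv_in[OF F] aut_inv_left[OF F] aut_inv_right[OF F] by force
  then show "inv_into (space M) F ` A \<in> sets M" using measurable_sets[OF meas A] by simp
  show "emeasure M (inv_into (space M) F ` A) = emeasure M A" using pre[OF A] 2 by simp
qed

lemma int_iter_image:
  assumes F: "aut M F" and A: "A \<in> sets M"
  shows "int_iter M F k ` A \<in> sets M \<and> emeasure M (int_iter M F k ` A) = emeasure M A"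
proof -
  have *: "(H ^^ n) ` A \<in> sets M \<and> emeasure M ((H ^^ n) ` A) = emeasure M A"
    if "\<And>A. A \<in> sets M \<Longrightarrow> H ` A \<in> sets M \<and> emeasure M (H ` A) = emeasure M A" for n H
  proof (induction n)
    case (Suc n)
    have "(H ^^ Suc n) ` A = H ` ((H ^^ n) ` A)" by (simp add: image_image)
    then show ?case using that[of "(H ^^ n) ` A"] Suc by simp
  qed (simp add: A)
  show ?thesis
    unfolding int_iter_def using *[of F] *[of "inv_into (space M) F"] aut_image[OF F] by simp
qed

lemma measurable_funpow: "F \<in> M \<rightarrow>\<^sub>M M \<Longrightarrow> F ^^ n \<in> M \<rightarrow>\<^sub>M M"
  by (induction n) (auto intro: measurable_comp simp: id_def[symmetric])

lemma measurable_int_iter: "aut M F \<Longrightarrow> int_iter M F k \<in> M \<rightarrow>\<^sub>M M"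
  by (auto simp: int_iter_def aut_def mp_bij_def intro: measurable_funpow)

text \<open>On each piece of a countable partition \<open>F'\<close> is a power of \<open>F\<close>.
  So the images of the pieces keep their measure, and injectivity keeps them disjoint.\<close>

lemma aut_piecewise:
  assumes F: "aut M F" and bij: "bij_betw F' (space M) (space M)" and meas: "F' \<in> M \<rightarrow>\<^sub>M M"
    and c: "c \<in> M \<rightarrow>\<^sub>M count_space (UNIV :: int set)"
    and eq: "\<And>x. x \<in> space M \<Longrightarrow> F' x = int_iter M F (c x) x"
  shows "aut M F'"
proof -
  have img: "F' ` A \<in> sets M \<and> emeasure M (F' ` A) = emeasure M A" if A: "A \<in> sets M" for A
  proof -
    define B where "B = (\<lambda>k. A \<inter> (c -` {k} \<inter> space M))"
    have B: "B k \<in> sets M" for k unfolding B_def using A measurable_sets[OF c, of "{k}"] by auto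
    have sub: "A \<subseteq> space M" using A sets.sets_into_space by blast
    have AB: "A = (\<Union>k. B k)" using sub by (auto simp: B_def)
    have img: "F' ` B k = int_iter M F k ` B k" for k
      by (intro image_cong refl) (auto simp: B_def eq)
    have FA: "F' ` A = (\<Union>k. int_iter M F k ` B k)" unfolding img[symmetric] by (subst AB) blast
    have disj: "disjoint_family B" by (auto simp: B_def disjoint_family_on_def)
    have disj': "disjoint_family (\<lambda>k. int_iter M F k ` B k)"
      unfolding img[symmetric] disjoint_family_on_def
    proof (intro ballI impI)
      fix m n :: int assume "m \<noteq> n"
      then have "B m \<inter> B n = {}" by (auto simp: B_def)
      moreover have "inj_on F' (space M)" using bij by (rule bij_betw_imp_inj_on)
      ultimately show "F' ` B m \<inter> F' ` B n = {}"
        using inj_on_image_Int[of F' "space M" "B m" "B n"] by (auto simp: B_def)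
    qed
    have "emeasure M (F' ` A) = (\<integral>\<^sup>+ k. emeasure M (int_iter M F k ` B k) \<partial>count_space UNIV)"
      unfolding FA by (rule emeasure_UN_countable) (use int_iter_image[OF F B] disj' in auto)
    also have "\<dots> = (\<integral>\<^sup>+ k. emeasure M (B k) \<partial>count_space UNIV)" using int_iter_image[OF F B] by simp
    also have "\<dots> = emeasure M A"
      unfolding AB by (rule emeasure_UN_countable[symmetric]) (use B disj in auto)
    finally show ?thesis unfolding FA using int_iter_image[OF F B] by auto
  qed
  have inv_img: "inv_into (space M) F' -` A \<inter> space M = F' ` A" if "A \<in> sets M" for A
  proof (intro equalityI subsetI)
    fix y assume y: "y \<in> inv_into (space M) F' -` A \<inter> space M"
    then have "y = F' (inv_into (space M) F' y)" using bij_betw_inv_into_right[OF bij] by simp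
    then show "y \<in> F' ` A" using y by blast
  next
    fix y assume "y \<in> F' ` A"
    then obtain a where a: "a \<in> A" "y = F' a" by blast
    have "a \<in> space M" using a sets.sets_into_space[OF that] by blast
    then show "y \<in> inv_into (space M) F' -` A \<inter> space M"
      using a bij_betw_inv_into_left[OF bij] bij_betwE[OF bij] by simp
  qed
  have "inv_into (space M) F' \<in> M \<rightarrow>\<^sub>M M"
  proof (rule measurableI)
    show "inv_into (space M) F' x \<in> space M" if "x \<in> space M" for x
      using bij_betwE[OF bij_betw_inv_into[OF bij]] that by blast
  qed (use inv_img img in auto)
  moreover have "distr M M F' = M"
  proof (rule measure_eqI)
    fix A assume "A \<in> sets (distr M M F')"
    then have A: "A \<in> sets M" by simp
    have "F' -` A \<inter> space M \<in> sets M" by (rule measurable_sets[OF meas A])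
    moreover have "F' ` (F' -` A \<inter> space M) = A"
    proof -
      have "F' ` (F' -` A \<inter> space M) = A \<inter> F' ` space M" by auto
      also have "\<dots> = A" unfolding bij_betw_imp_surj_on[OF bij] using sets.sets_into_space[OF A] by (rule Int_absorb2)
      finally show ?thesis .
    qed
    ultimately show "emeasure (distr M M F') A = emeasure M A"
      using img[of "F' -` A \<inter> space M"] by (simp add: emeasure_distr[OF meas A])
  qed simp
  ultimately show ?thesis using bij meas by (simp add: aut_def mp_bij_def)
qed

lemma int_iter_free:
  assumes F: "aut M F" and free: "\<And>x n. x \<in> space M \<Longrightarrow> n \<ge> 1 \<Longrightarrow> (F ^^ n) x \<noteq> x"
    and x: "x \<in> space M" and eq: "int_iter M F j x = int_iter M F k x"
  shows "j = k"
proof -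
  have *: False if "j < k" "int_iter M F j x = int_iter M F k x" for j k
  proof -
    have "int_iter M F (k - j) (int_iter M F j x) = int_iter M F j x"
      using int_iter_add[OF F x, of "k - j" j] that by simp
    moreover have "int_iter M F (k - j) = F ^^ nat (k - j)" using that by (simp add: int_iter_def)
    moreover have "nat (k - j) \<ge> 1" using that by simp
    ultimately show False using free[OF int_iter_in[OF F x, of j], of "nat (k - j)"] by simp
  qed
  show ?thesis using *[of j k] *[of k j] eq by (cases j k rule: linorder_cases) auto
qed

text \<open>The exponent is unique as soon as \<open>F\<close> is free at every point, see
  \<open>cocycle_eqI\<close>.\<close>

definition cocycle :: "'a measure \<Rightarrow> ('a \<Rightarrow> 'a) \<Rightarrow> ('a \<Rightarrow> 'a) \<Rightarrow> 'a \<Rightarrow> int" where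
  "cocycle M F F' x = (THE k. F' x = int_iter M F k x)"

lemma cocycle_eqI:
  assumes "aut M F" "\<And>x n. x \<in> space M \<Longrightarrow> n \<ge> 1 \<Longrightarrow> (F ^^ n) x \<noteq> x" "x \<in> space M"
    and "F' x = int_iter M F k x"
  shows "cocycle M F F' x = k"
  unfolding cocycle_def using int_iter_free[OF assms(1-3)] assms(4) by (intro the_equality) auto

lemma measurable_cocycle:
  assumes F: "aut dyadic_space F" and free: "\<And>x n. x \<in> \<Omega> \<Longrightarrow> n \<ge> 1 \<Longrightarrow> (F ^^ n) x \<noteq> x"
    and ex: "\<And>x. x \<in> \<Omega> \<Longrightarrow> \<exists>k. F' x = int_iter dyadic_space F k x"
    and F': "F' \<in> dyadic_space \<rightarrow>\<^sub>M dyadic_space"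
  shows "cocycle dyadic_space F F' \<in> dyadic_space \<rightarrow>\<^sub>M count_space UNIV"
proof -
  have *: "cocycle dyadic_space F F' -` {k} \<inter> \<Omega> \<in> sets dyadic_space" for k
  proof -
    have "cocycle dyadic_space F F' -` {k} \<inter> \<Omega>
      = {x \<in> \<Omega>. F' x = int_iter dyadic_space F k x}"
      using ex cocycle_eqI[OF F free, of _ F'] by auto
    \<comment> \<open>A point is determined by its numbers \<open>val n\<close>, so the level set is
      cut out by countably many measurable conditions.\<close>
    also have "\<dots> = {x \<in> \<Omega>. \<forall>n. val n (F' x) = val n (int_iter dyadic_space F k x)}"
      using dyadic_eqI[OF measurable_space[OF F'] int_iter_in[OF F]] by auto
    also have "\<dots> \<in> sets dyadic_space"
    proof -
      note [measurable] = F' measurable_int_iter[OF F, of k]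
      show ?thesis by measurable
    qed
    finally show ?thesis .
  qed
  show ?thesis using * by (subst measurable_count_space_eq2_countable) auto
qed

lemma int_iter_odomutant_ex:
  assumes x: "x \<in> \<Omega>"
  shows "\<exists>k. odomutant x = int_iter dyadic_space dyadic_odometer k x"
proof (cases "x \<in> nonconst")
  case True
  then obtain n where n: "pos n x + 1 < 2 ^ blen n" using pos_room by blast
  have "int_iter dyadic_space dyadic_odometer (int (val (blen n) (odomutant x)) - int (val (blen n) x)) x = odomutant x"
    using odomutant_block[OF True n] by (intro int_iter_odometer x odomutant_in) auto
  then show ?thesis by metis
next
  case False
  then show ?thesis by (intro exI[of _ 1]) (simp add: odomutant_off)
qed

lemma aut_odomutant: "aut dyadic_space odomutant"
proof (rule aut_piecewise[OF aut_odometer bij_odomutant measurable_odomutant])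
  show "cocycle dyadic_space dyadic_odometer odomutant \<in> dyadic_space \<rightarrow>\<^sub>M count_space UNIV"
    by (intro measurable_cocycle aut_odometer odometer_free int_iter_odomutant_ex measurable_odomutant)
  fix x assume x: "x \<in> \<Omega>"
  then obtain k where "odomutant x = int_iter dyadic_space dyadic_odometer k x" using int_iter_odomutant_ex by blast
  then show "odomutant x = int_iter dyadic_space dyadic_odometer (cocycle dyadic_space dyadic_odometer odomutant x) x"
    using cocycle_eqI[OF aut_odometer odometer_free x, of odomutant k] by simp
qed

lemma odomutant_funpow_block:
  assumes "x \<in> nonconst" "pos n x + d < 2 ^ blen n"
  shows "(odomutant ^^ d) x \<in> nonconst \<and> tail (blen n) ((odomutant ^^ d) x) = tail (blen n) x \<and> pos n ((odomutant ^^ d) x) = pos n x + d"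
  by (rule funpow_block[where R = "tail (blen n)" and H = "2 ^ blen n"]) (use assms odomutant_block in auto)

lemma odomutant_free:
  assumes x: "x \<in> \<Omega>" and k: "k \<ge> 1"
  shows "(odomutant ^^ k) x \<noteq> x"
proof (cases "x \<in> nonconst")
  case True
  obtain n where "pos n x + k < 2 ^ blen n" using pos_room[OF True] by blast
  then show ?thesis using odomutant_funpow_block[OF True, of n k] k by force
next
  case False
  have "(odomutant ^^ j) x = (dyadic_odometer ^^ j) x \<and> (dyadic_odometer ^^ j) x \<notin> nonconst" for j
  proof (induction j)
    case (Suc j)
    then show ?case
      using odometer_nonconst_iff[OF aut_funpow_in[OF aut_odometer x, of j]] by (simp add: odomutant_off)
  qed (simp add: False)
  then show ?thesis using odometer_free[OF x k] by simp
qed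

lemma int_iter_odomutant:
  assumes "x \<in> nonconst" "y \<in> nonconst" "tail (blen n) x = tail (blen n) y"
  shows "int_iter dyadic_space odomutant (int (pos n y) - int (pos n x)) x = y"
proof (rule int_iter_block[OF aut_odomutant, where H = "2 ^ blen n" and R = "tail (blen n)" and G = nonconst])
  show "nonconst \<subseteq> \<Omega>" using nonconst_in by blast
qed (use assms odomutant_block pos_less pos_tail_eqI nonconst_in in blast)+

lemma val_room:
  assumes x: "x \<in> nonconst"
  shows "\<exists>n. val (blen n) x + 1 < 2 ^ blen n"
proof -
  obtain t where t: "x t = 0" using x unfolding nonconst_def by blast
  have "val (blen (Suc t)) x \<noteq> val (blen (Suc t)) (\<lambda>_. 1)"
    using bits_val_eq_iff[OF nonconst_in[OF x], of "\<lambda>_. 1" 0 "blen (Suc t)"] t blen_ge[of "Suc t"]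
    by (auto simp: in_dyadic intro!: exI[of _ t])
  then have "val (blen (Suc t)) x + 1 \<noteq> 2 ^ blen (Suc t)" using bits_val_ones[of 0 "blen (Suc t)"] by linarith
  then show ?thesis using bits_val_less[OF nonconst_in[OF x], of 0 "blen (Suc t)"] by (intro exI[of _ "Suc t"]) linarith
qed

lemma int_iter_odometer_ex:
  assumes x: "x \<in> \<Omega>"
  shows "\<exists>k. dyadic_odometer x = int_iter dyadic_space odomutant k x"
proof (cases "x \<in> nonconst")
  case True
  then obtain n where n: "val (blen n) x + 1 < 2 ^ blen n" using val_room by blast
  have "int_iter dyadic_space odomutant (int (pos n (dyadic_odometer x)) - int (pos n x)) x = dyadic_odometer x"
    using tail_odometer[OF n x] True odometer_nonconst_iff[OF x] by (intro int_iter_odomutant) auto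
  then show ?thesis by metis
next
  case False
  then show ?thesis by (intro exI[of _ 1]) (simp add: odomutant_off)
qed

lemma orbit_equivalence_odomutant:
  "orbit_equivalence dyadic_space odomutant dyadic_space dyadic_odometer id"
  unfolding orbit_equivalence_def
proof (intro conjI aut_odomutant aut_odometer)
  show "aperiodic dyadic_space odomutant" "aperiodic dyadic_space dyadic_odometer"
    unfolding aperiodic_def using odomutant_free odometer_free by (auto intro!: AE_I2)
  have inv: "inv_into \<Omega> id x = x" if "x \<in> \<Omega>" for x
    using that inv_into_f_f[of id "\<Omega>" x] by simp
  show "mp_bij dyadic_space dyadic_space id"
    unfolding mp_bij_def
  proof (intro conjI)
    show "inv_into \<Omega> id \<in> dyadic_space \<rightarrow>\<^sub>M dyadic_space"
      using inv by (subst measurable_cong[where g = "\<lambda>x. x"]) auto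
    show "distr dyadic_space dyadic_space id = dyadic_space" by (simp add: id_def distr_id)
  qed (auto simp: bij_betw_def)
  show "AE x in dyadic_space. orbit_of dyadic_space odomutant x =
      orbit_of dyadic_space (inv_into \<Omega> id \<circ> dyadic_odometer \<circ> id) x"
  proof (rule AE_I2)
    fix x assume x: "x \<in> \<Omega>"
    have "int_iter dyadic_space (inv_into \<Omega> id \<circ> dyadic_odometer \<circ> id) k x = int_iter dyadic_space dyadic_odometer k x" for k
      by (rule int_iter_cong[symmetric]) (use aut_odometer x inv odometer_in in auto)
    then have "orbit_of dyadic_space (inv_into \<Omega> id \<circ> dyadic_odometer \<circ> id) x = orbit_of dyadic_space dyadic_odometer x"
      by (simp add: orbit_of_def)
    also have "\<dots> = orbit_of dyadic_space odomutant x"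
      using orbit_of_subset[OF aut_odometer aut_odomutant x int_iter_odomutant_ex]
        orbit_of_subset[OF aut_odomutant aut_odometer x int_iter_odometer_ex] by blast
    finally show "orbit_of dyadic_space odomutant x =
      orbit_of dyadic_space (inv_into \<Omega> id \<circ> dyadic_odometer \<circ> id) x" by simp
  qed
qed

section \<open>Size of the two cocycles\<close>

abbreviation "coc_odomutant \<equiv> cocycle dyadic_space dyadic_odometer odomutant"
abbreviation "coc_odometer \<equiv> cocycle dyadic_space odomutant dyadic_odometer"

lemma measurable_coc_odomutant [measurable]: "coc_odomutant \<in> dyadic_space \<rightarrow>\<^sub>M count_space UNIV"
  by (intro measurable_cocycle aut_odometer odometer_free int_iter_odomutant_ex measurable_odomutant)

lemma measurable_coc_odometer [measurable]: "coc_odometer \<in> dyadic_space \<rightarrow>\<^sub>M count_space UNIV"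
  by (intro measurable_cocycle aut_odomutant odomutant_free int_iter_odometer_ex measurable_odometer)

lemma oe_cocycles_odomutant:
  "oe_cocycles dyadic_space odomutant dyadic_space dyadic_odometer id coc_odomutant coc_odometer"
  unfolding oe_cocycles_def
proof (intro conjI measurable_coc_odomutant measurable_coc_odometer AE_I2)
  have inv: "inv_into \<Omega> id x = x" if "x \<in> \<Omega>" for x
    using that inv_into_f_f[of id "\<Omega>" x] by simp
  fix x assume x: "x \<in> \<Omega>"
  obtain k where k: "odomutant x = int_iter dyadic_space dyadic_odometer k x" using int_iter_odomutant_ex[OF x] by blast
  then have "coc_odomutant x = k" by (intro cocycle_eqI aut_odometer odometer_free x)
  then show "odomutant x = inv_into \<Omega> id (int_iter dyadic_space dyadic_odometer (coc_odomutant x) (id x))"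
    using k inv int_iter_in[OF aut_odometer x] by simp
  obtain l where l: "dyadic_odometer x = int_iter dyadic_space odomutant l x" using int_iter_odometer_ex[OF x] by blast
  then have "coc_odometer x = l" by (intro cocycle_eqI aut_odomutant odomutant_free x)
  then show "dyadic_odometer x = id (int_iter dyadic_space odomutant (coc_odometer x) (inv_into \<Omega> id x))"
    using l inv[OF x] by simp
qed

text \<open>The point and its image lie in one block of level \<open>n\<close>, through which the
  odometer counts with \<open>val (blen n)\<close>; the exponent is a difference of two such values.
  For the other cocycle the counter is \<open>pos n\<close>.\<close>

lemma coc_odomutant_less:
  assumes x: "x \<in> nonconst" and n: "pos n x + 1 < 2 ^ blen n"
  shows "\<bar>coc_odomutant x\<bar> < 2 ^ blen n"
proof -
  have x': "x \<in> \<Omega>" by (rule nonconst_in[OF x])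
  have "odomutant x = int_iter dyadic_space dyadic_odometer (int (val (blen n) (odomutant x)) - int (val (blen n) x)) x"
    using odomutant_block[OF x n] by (intro int_iter_odometer[symmetric] x' odomutant_in) auto
  then have "coc_odomutant x = int (val (blen n) (odomutant x)) - int (val (blen n) x)"
    by (intro cocycle_eqI aut_odometer odometer_free x')
  moreover have "int (val (blen n) y) < 2 ^ blen n" if "y \<in> \<Omega>" for y
    using of_nat_less_iff[where 'a = int, THEN iffD2, OF bits_val_less[OF that, of 0 "blen n"]] by simp
  note this[OF x'] this[OF odomutant_in[OF x']]
  ultimately show ?thesis by linarith
qed

lemma coc_odometer_less:
  assumes x: "x \<in> nonconst" and n: "val (blen n) x + 1 < 2 ^ blen n"
  shows "\<bar>coc_odometer x\<bar> < 2 ^ blen n"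
proof -
  have x': "x \<in> \<Omega>" by (rule nonconst_in[OF x])
  have "dyadic_odometer x = int_iter dyadic_space odomutant (int (pos n (dyadic_odometer x)) - int (pos n x)) x"
    using tail_odometer[OF n x'] x odometer_nonconst_iff[OF x'] by (intro int_iter_odomutant[symmetric]) auto
  then have "coc_odometer x = int (pos n (dyadic_odometer x)) - int (pos n x)"
    by (intro cocycle_eqI aut_odomutant odomutant_free x')
  moreover have "int (pos n y) < 2 ^ blen n" if "y \<in> \<Omega>" for y
    using of_nat_less_iff[where 'a = int, THEN iffD2, OF pos_less[OF that, of n]] by simp
  note this[OF x'] this[OF odometer_in, of x]
  ultimately show ?thesis by linarith
qed

lemma measure_preimage:
  assumes "aut dyadic_space F" "A \<in> sets dyadic_space"
  shows "\<mu> (F -` A \<inter> \<Omega>) = \<mu> A"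
proof -
  have F: "F \<in> dyadic_space \<rightarrow>\<^sub>M dyadic_space" "distr dyadic_space dyadic_space F = dyadic_space"
    using assms(1) by (auto simp: aut_def mp_bij_def)
  show ?thesis using measure_distr[OF F(1) assms(2)] F(2) by simp
qed

text \<open>The sets with a fixed value of \<open>pos n\<close> are the levels of a tower: the
  odomutant carries each to the next, so they share the mass 1 equally.\<close>

lemma measure_pos:
  assumes "p < 2 ^ blen n"
  shows "\<mu> {x \<in> nonconst. pos n x = p} = 1 / 2 ^ blen n"
proof -
  define A where "A = (\<lambda>p. {x \<in> nonconst. pos n x = p})"
  have A: "A p \<in> sets dyadic_space" for p
  proof -
    have "A p = {x \<in> \<Omega>. x \<in> nonconst \<and> pos n x = p}" by (auto simp: A_def nonconst_in)
    then show ?thesis by simp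
  qed
  have step: "\<mu> (A p) = \<mu> (A (p + 1))" if "p + 1 < 2 ^ blen n" for p
  proof -
    have "odomutant -` A (p + 1) \<inter> \<Omega> = A p"
    proof (intro equalityI subsetI)
      fix x assume "x \<in> odomutant -` A (p + 1) \<inter> \<Omega>"
      then have x: "odomutant x \<in> nonconst" "pos n (odomutant x) = Suc p" "x \<in> \<Omega>" by (auto simp: A_def)
      obtain x' where x': "x' \<in> nonconst" "odomutant x' = odomutant x" "pos n x' = p"
        by (rule odomutant_preimage[OF x(1,2)])
      then have "x' = x" using odomutant_inj nonconst_in x(3) by blast
      then show "x \<in> A p" using x' by (simp add: A_def)
    qed (use odomutant_block[of _ n] that nonconst_in in \<open>auto simp: A_def\<close>)
    then show ?thesis using measure_preimage[OF aut_odomutant A, of "p + 1"] by simp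
  qed
  have same: "\<mu> (A p) = \<mu> (A 0)" if "p < 2 ^ blen n" for p
    using that by (induction p) (use step in auto)
  have "(\<Union>p<2 ^ blen n. A p) = nonconst" using pos_less nonconst_in by (auto simp: A_def)
  then have "1 = \<mu> (\<Union>p<2 ^ blen n. A p)"
    using AE_nonconst by (simp add: dyadic.AE_in_set_eq_1)
  also have "\<dots> = (\<Sum>p<2 ^ blen n. \<mu> (A p))"
    by (rule dyadic.finite_measure_finite_Union) (use A in \<open>auto simp: disjoint_family_on_def A_def\<close>)
  also have "\<dots> = (\<Sum>p<(2::nat) ^ blen n. \<mu> (A 0))" by (intro sum.cong refl same) simp
  finally have "1 = 2 ^ blen n * \<mu> (A p)" using same[OF assms] by simp
  then have "\<mu> (A p) = 1 / 2 ^ blen n" by (simp add: eq_divide_eq mult.commute)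
  then show ?thesis by (simp only: A_def)
qed

text \<open>A large value forces the step to leave the block of level \<open>n\<close>, which
  happens only at its last position.\<close>

lemma measure_coc_odomutant: "\<mu> {x \<in> \<Omega>. \<bar>coc_odomutant x\<bar> \<ge> 2 ^ blen n} \<le> 1 / 2 ^ blen n"
proof -
  have "\<mu> {x \<in> \<Omega>. \<bar>coc_odomutant x\<bar> \<ge> 2 ^ blen n}
      \<le> \<mu> {x \<in> nonconst. pos n x = 2 ^ blen n - 1}"
  proof (rule dyadic.finite_measure_mono_AE)
    show "AE x in dyadic_space. x \<in> {x \<in> \<Omega>. \<bar>coc_odomutant x\<bar> \<ge> 2 ^ blen n} \<longrightarrow> x \<in> {x \<in> nonconst. pos n x = 2 ^ blen n - 1}"
      using AE_nonconst
    proof (eventually_elim, intro impI)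
      fix x assume x: "x \<in> nonconst" "x \<in> {x \<in> \<Omega>. \<bar>coc_odomutant x\<bar> \<ge> 2 ^ blen n}"
      then have "\<not> pos n x + 1 < 2 ^ blen n" using coc_odomutant_less[OF x(1), of n] by auto
      then show "x \<in> {x \<in> nonconst. pos n x = 2 ^ blen n - 1}"
        using pos_less[OF nonconst_in[OF x(1)], of n] x(1) by auto
    qed
    have "{x \<in> nonconst. pos n x = 2 ^ blen n - 1} = {x \<in> \<Omega>. x \<in> nonconst \<and> pos n x = 2 ^ blen n - 1}"
      using nonconst_in by auto
    then show "{x \<in> nonconst. pos n x = 2 ^ blen n - 1} \<in> sets dyadic_space" by simp
  qed
  then show ?thesis using measure_pos[of "2 ^ blen n - 1" n] by simp
qed

lemma measure_coc_odometer: "\<mu> {x \<in> \<Omega>. \<bar>coc_odometer x\<bar> \<ge> 2 ^ blen n} \<le> 1 / 2 ^ blen n"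
proof -
  have "\<mu> {x \<in> \<Omega>. \<bar>coc_odometer x\<bar> \<ge> 2 ^ blen n}
      \<le> \<mu> {x \<in> \<Omega>. val (blen n) x = 2 ^ blen n - 1}"
  proof (rule dyadic.finite_measure_mono_AE)
    show "AE x in dyadic_space. x \<in> {x \<in> \<Omega>. \<bar>coc_odometer x\<bar> \<ge> 2 ^ blen n} \<longrightarrow> x \<in> {x \<in> \<Omega>. val (blen n) x = 2 ^ blen n - 1}"
      using AE_nonconst
    proof (eventually_elim, intro impI)
      fix x assume x: "x \<in> nonconst" "x \<in> {x \<in> \<Omega>. \<bar>coc_odometer x\<bar> \<ge> 2 ^ blen n}"
      then have "\<not> val (blen n) x + 1 < 2 ^ blen n" using coc_odometer_less[OF x(1), of n] by auto
      then show "x \<in> {x \<in> \<Omega>. val (blen n) x = 2 ^ blen n - 1}"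
        using bits_val_less[OF nonconst_in[OF x(1)], of 0 "blen n"] nonconst_in[OF x(1)] by auto
    qed
  qed measurable
  then show ?thesis using measure_bits_val[of "2 ^ blen n - 1" "blen n" 0] by simp
qed

section \<open>Ergodicity and integrability of the cocycles\<close>

text \<open>An invariant set \<open>A\<close> has the same measure in all cylinders of a level, so
  it is independent of every cylinder set \<open>B\<close>. With \<open>B\<close> close to
  \<open>A\<close>, this makes \<mu> A equal to its square up to 2 \<epsilon>.\<close>

lemma ergodic_odometer: "ergodic dyadic_space dyadic_odometer"
  unfolding ergodic_def
proof (intro ballI impI)
  fix A assume A: "A \<in> sets dyadic_space" and inv: "dyadic_odometer -` A \<inter> \<Omega> = A"
  have sub: "A \<subseteq> \<Omega>" by (rule sets.sets_into_space[OF A])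
  define C where "C = (\<lambda>n v. A \<inter> cyl n v)"
  have C: "C n v \<in> sets dyadic_space" for n v unfolding C_def using A by (intro sets.Int) simp_all
  have step: "\<mu> (C n v) = \<mu> (C n (v + 1))" if "v + 1 < 2 ^ n" for n v
  proof -
    have "(w + 1) mod 2 ^ n = v + 1 \<longleftrightarrow> w = v" if "w < 2 ^ n" for w
      using that \<open>v + 1 < 2 ^ n\<close> by (cases "w + 1 = 2 ^ n") auto
    then have 1: "x \<in> A \<Longrightarrow> (val n (dyadic_odometer x) = v + 1) = (val n x = v)" for x
      unfolding val_odometer using sub bits_val_less by blast
    have 2: "x \<in> A \<longleftrightarrow> x \<in> \<Omega> \<and> dyadic_odometer x \<in> A" for x using inv by auto
    have "dyadic_odometer -` C n (v + 1) \<inter> \<Omega> = C n v"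
    proof (intro set_eqI iffI)
      fix x assume "x \<in> dyadic_odometer -` C n (v + 1) \<inter> \<Omega>"
      then have x: "dyadic_odometer x \<in> A" "x \<in> \<Omega>" "val n (dyadic_odometer x) = v + 1"
        by (simp_all add: C_def)
      then have "x \<in> A" using 2[of x] by blast
      then show "x \<in> C n v" using 1[of x] x by (simp add: C_def)
    next
      fix x assume "x \<in> C n v"
      then have x: "x \<in> A" "x \<in> \<Omega>" "val n x = v" by (simp_all add: C_def)
      then have "dyadic_odometer x \<in> A" using 2[of x] by blast
      then show "x \<in> dyadic_odometer -` C n (v + 1) \<inter> \<Omega>"
        using 1[OF x(1)] x odometer_in by (simp add: C_def)
    qed
    then show ?thesis using measure_preimage[OF aut_odometer C, of n "v + 1"] by simp
  qed
  have same: "\<mu> (C n v) = \<mu> (C n 0)" if "v < 2 ^ n" for n v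
    using that by (induction v) (use step in auto)
  have un: "\<mu> (\<Union>v\<in>V. C n v) = card V * \<mu> (C n 0)" if "V \<subseteq> {..<2 ^ n}" for n V
  proof -
    have "finite V" using that finite_subset by blast
    then have "\<mu> (\<Union>v\<in>V. C n v) = (\<Sum>v\<in>V. \<mu> (C n v))"
      by (rule dyadic.finite_measure_finite_Union) (use C in \<open>auto simp: disjoint_family_on_def C_def\<close>)
    also have "\<dots> = (\<Sum>v\<in>V. \<mu> (C n 0))" using that by (intro sum.cong refl same) auto
    finally show ?thesis by simp
  qed
  have un_all: "\<mu> A = 2 ^ n * \<mu> (C n 0)" for n
  proof -
    have "(\<Union>v\<in>{..<2 ^ n}. C n v) = A" using sub bits_val_less by (auto simp: C_def)
    then show ?thesis using un[of "{..<2 ^ n}" n] by simp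
  qed
  have un_space: "\<mu> (\<Union>v\<in>V. cyl n v) = card V / 2 ^ n" if "V \<subseteq> {..<2 ^ n}" for n V
  proof -
    have "finite V" using that finite_subset by blast
    then have "\<mu> (\<Union>v\<in>V. cyl n v) = (\<Sum>v\<in>V. \<mu> (cyl n v))"
      by (rule dyadic.finite_measure_finite_Union) (auto simp: disjoint_family_on_def)
    also have "\<dots> = (\<Sum>v\<in>V. 1 / 2 ^ n)" using that by (intro sum.cong refl measure_bits_val) auto
    finally show ?thesis by simp
  qed
  let ?a = "\<mu> A"
  have small: "\<bar>?a - ?a * ?a\<bar> \<le> 2 * \<epsilon>" if eps: "\<epsilon> > 0" for \<epsilon>
  proof -
    obtain n V where nV: "\<mu> (sym_diff A {x \<in> \<Omega>. val n x \<in> V}) < \<epsilon>"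
      using cylinder_approx[OF A eps] by (elim exE)
    define B where "B = {x \<in> \<Omega>. val n x \<in> V}"
    define V' where "V' = V \<inter> {..<2 ^ n}"
    have B: "B \<in> sets dyadic_space" unfolding B_def by measurable
    have V': "V' \<subseteq> {..<2 ^ n}" by (simp add: V'_def)
    have "B = (\<Union>v\<in>V'. cyl n v)" using bits_val_less by (auto simp: B_def V'_def)
    then have b: "\<mu> B = card V' / 2 ^ n" using un_space[OF V'] by simp
    have "A \<inter> B = (\<Union>v\<in>V'. C n v)" using bits_val_less by (auto simp: B_def V'_def C_def)
    then have ab: "\<mu> (A \<inter> B) = ?a * \<mu> B"
      using un[OF V'] un_all[of n] b by simp
    have "\<mu> (A - B) \<le> \<mu> (sym_diff A B)"
      "\<mu> (B - A) \<le> \<mu> (sym_diff A B)"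
      using A B by (auto intro!: dyadic.finite_measure_mono)
    then have d: "\<mu> (A - B) < \<epsilon>" "\<mu> (B - A) < \<epsilon>" using nV by (auto simp: B_def)
    have 1: "?a = \<mu> (A \<inter> B) + \<mu> (A - B)"
      using dyadic.finite_measure_Diff'[OF A B] by simp
    have 2: "\<mu> B = \<mu> (A \<inter> B) + \<mu> (B - A)"
      using dyadic.finite_measure_Diff'[OF B A] by (simp add: Int_commute)
    have "\<bar>?a - \<mu> B\<bar> \<le> \<epsilon>" using 1 2 d measure_nonneg[of dyadic_space "A - B"] measure_nonneg[of dyadic_space "B - A"] by linarith
    then have "?a * \<bar>?a - \<mu> B\<bar> \<le> 1 * \<epsilon>"
      by (intro mult_mono) auto
    moreover have "?a * \<bar>?a - \<mu> B\<bar> = \<bar>?a * ?a - ?a * \<mu> B\<bar>"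
      by (simp add: abs_mult right_diff_distrib[symmetric])
    ultimately show ?thesis using 1 ab d measure_nonneg[of dyadic_space "A - B"] by linarith
  qed
  have "\<bar>?a - ?a * ?a\<bar> \<le> 0"
  proof (rule field_le_epsilon)
    fix e :: real assume "e > 0"
    then show "\<bar>?a - ?a * ?a\<bar> \<le> 0 + e" using small[of "e / 2"] by simp
  qed
  then have "?a * (1 - ?a) = 0" by (simp add: right_diff_distrib)
  then show "?a = 0 \<or> ?a = 1" by auto
qed

text \<open>The odometer moves points inside the orbits of the odomutant, so a set invariant under
  the latter is invariant under the former.\<close>

lemma ergodic_odomutant: "ergodic dyadic_space odomutant"
  unfolding ergodic_def
proof (intro ballI impI)
  fix A assume A: "A \<in> sets dyadic_space" and inv: "odomutant -` A \<inter> \<Omega> = A"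
  have T: "odomutant x \<in> A \<longleftrightarrow> x \<in> A" if "x \<in> \<Omega>" for x using inv that by auto
  have it: "int_iter dyadic_space odomutant k x \<in> A \<longleftrightarrow> x \<in> A" if x: "x \<in> \<Omega>" for k x
  proof (induction k rule: int_induct[where k = 0])
    case (step1 i)
    then show ?case using int_iter_Suc[OF aut_odomutant x, of i] T[OF int_iter_in[OF aut_odomutant x]] by simp
  next
    case (step2 i)
    then show ?case using int_iter_Suc[OF aut_odomutant x, of "i - 1"] T[OF int_iter_in[OF aut_odomutant x, of "i - 1"]] by simp
  qed simp
  have "dyadic_odometer x \<in> A \<longleftrightarrow> x \<in> A" if x: "x \<in> \<Omega>" for x
    using int_iter_odometer_ex[OF x] it[OF x] by auto
  then have "dyadic_odometer -` A \<inter> \<Omega> = A" using sets.sets_into_space[OF A] by auto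
  then show "\<mu> A = 0 \<or> \<mu> A = 1"
    using ergodic_odometer A unfolding ergodic_def by blast
qed

section \<open>The dyadic space is standard and atomless\<close>

lemma standard_borel_dyadic: "standard_borel dyadic_space"
  unfolding standard_borel_def
proof (intro exI conjI)
  let ?X = "product_topology (\<lambda>_::nat. discrete_topology {..<2::nat}) UNIV"
  show top: "topspace ?X = \<Omega>" by (auto simp: space_dyadic PiE_def Pi_def)
  show "completely_metrizable_space ?X"
    by (simp add: completely_metrizable_space_product_topology completely_metrizable_space_discrete_topology)
  have cyl: "openin ?X (cyl n v)" for n v
    unfolding openin_product_topology_alt
  proof
    fix x assume x: "x \<in> cyl n v"
    define U where "U = (\<lambda>i. if i < n then {x i} else {..<2::nat})"
    have "{i \<in> UNIV. U i \<noteq> topspace (discrete_topology {..<2})} \<subseteq> {..<n}" by (auto simp: U_def)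
    then have "finite {i \<in> UNIV. U i \<noteq> topspace (discrete_topology {..<2})}" by (rule finite_subset) simp
    moreover have "\<forall>i\<in>UNIV. openin (discrete_topology {..<2}) (U i)" using x by (auto simp: U_def in_dyadic)
    moreover have "x \<in> Pi\<^sub>E UNIV U" using x by (auto simp: U_def in_dyadic)
    moreover have "Pi\<^sub>E UNIV U \<subseteq> cyl n v"
    proof
      fix y assume y: "y \<in> Pi\<^sub>E UNIV U"
      have yi: "y i \<in> U i" for i using y by auto
      have "y i < 2" for i using yi[of i] x by (auto simp: U_def in_dyadic split: if_splits)
      moreover have "y t = x t" if "t < n" for t using yi[of t] that by (simp add: U_def)
      then have "val n y = val n x" by (intro bits_val_cong) simp
      ultimately show "y \<in> cyl n v" using x by (simp add: in_dyadic)
    qed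
    ultimately show "\<exists>U. finite {i \<in> UNIV. U i \<noteq> topspace (discrete_topology {..<2})} \<and>
        (\<forall>i\<in>UNIV. openin (discrete_topology {..<2}) (U i)) \<and> x \<in> Pi\<^sub>E UNIV U \<and> Pi\<^sub>E UNIV U \<subseteq> cyl n v"
      by blast
  qed
  \<comment> \<open>The cylinders are a countable base of the product topology, so every open set is
    a countable union of them.\<close>
  have base: "\<exists>n. {y \<in> \<Omega>. val n y = val n x} \<subseteq> U" if U: "openin ?X U" "x \<in> U" for U x
  proof -
    obtain W where W: "finite {i \<in> UNIV. W i \<noteq> topspace (discrete_topology {..<2})}" "x \<in> Pi\<^sub>E UNIV W" "Pi\<^sub>E UNIV W \<subseteq> U"
      using U unfolding openin_product_topology_alt by blast
    obtain n where n: "{i \<in> UNIV. W i \<noteq> topspace (discrete_topology {..<2})} \<subseteq> {..<n}"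
      using W(1) finite_nat_iff_bounded by blast
    have x: "x \<in> \<Omega>" using U openin_subset top by blast
    have "y \<in> Pi\<^sub>E UNIV W" if y: "y \<in> \<Omega>" "val n y = val n x" for y
    proof -
      have "y i \<in> W i" for i
      proof (cases "i < n")
        case True
        then have "y i = x i" using y bits_val_eq_iff[OF y(1) x, of 0 n] by simp
        then show ?thesis using W(2) by auto
      next
        case False
        then have "W i = {..<2}" using n by auto
        then show ?thesis using y by (simp add: in_dyadic)
      qed
      then show ?thesis by auto
    qed
    then have "{y \<in> \<Omega>. val n y = val n x} \<subseteq> Pi\<^sub>E UNIV W" by blast
    then show ?thesis using W(3) by (intro exI[of _ n]) (rule order_trans)
  qed
  let ?G = "cylinders"
  have G: "?G = (\<lambda>(n, v). cyl n v) ` UNIV" by auto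
  have cG: "countable ?G" unfolding G by simp
  show "second_countable ?X"
    unfolding second_countable_def
  proof (intro exI[of _ ?G] conjI ballI allI impI)
    fix U x assume U: "openin ?X U \<and> x \<in> U"
    then obtain n where n: "{y \<in> \<Omega>. val n y = val n x} \<subseteq> U" using base by blast
    have "x \<in> \<Omega>" using U openin_subset top by blast
    then show "\<exists>V\<in>?G. x \<in> V \<and> V \<subseteq> U"
      using n by (intro bexI[of _ "{y \<in> \<Omega>. val n y = val n x}"] conjI) auto
  next
    fix V assume "V \<in> ?G"
    then obtain n v where "V = cyl n v" by blast
    then show "openin ?X V" using cyl by simp
  qed (rule cG)
  show "sets dyadic_space = sigma_sets (topspace ?X) {U. openin ?X U}"
    unfolding top
  proof
    show "sets dyadic_space \<subseteq> sigma_sets \<Omega> {U. openin ?X U}"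
      unfolding sets_dyadic using cyl by (intro sigma_sets_mono') auto
    show "sigma_sets \<Omega> {U. openin ?X U} \<subseteq> sets dyadic_space"
    proof (rule sets.sigma_sets_subset, rule subsetI)
      fix U assume "U \<in> {U. openin ?X U}"
      then have U: "openin ?X U" by simp
      have "U = \<Union>{V \<in> ?G. V \<subseteq> U}"
      proof (intro equalityI subsetI)
        fix x assume x: "x \<in> U"
        then obtain n where n: "{y \<in> \<Omega>. val n y = val n x} \<subseteq> U" using base[OF U] by blast
        have "x \<in> \<Omega>" using x U openin_subset top by blast
        then show "x \<in> \<Union>{V \<in> ?G. V \<subseteq> U}"
          using n by (intro UnionI[of "{y \<in> \<Omega>. val n y = val n x}"]) auto
      qed blast
      moreover have "countable {V \<in> ?G. V \<subseteq> U}" by (rule countable_subset[OF _ cG]) blast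
      moreover have "V \<in> sets dyadic_space" if V: "V \<in> {V \<in> ?G. V \<subseteq> U}" for V
      proof -
        obtain n v where "V = cyl n v" using V by blast
        then show ?thesis by simp
      qed
      ultimately show "U \<in> sets dyadic_space" by (metis (no_types, lifting) sets.countable_Union subsetI)
    qed
  qed
qed

lemma standard_atomless_dyadic: "standard_atomless_prob_space dyadic_space"
  unfolding standard_atomless_prob_space_def
proof (intro conjI standard_borel_dyadic)
  show "prob_space dyadic_space" by (rule dyadic.prob_space_axioms)
  show "atomless dyadic_space"
    unfolding atomless_def
  proof (intro ballI impI)
    fix A assume A: "A \<in> sets dyadic_space" "emeasure dyadic_space A > 0"
    let ?a = "\<mu> A"
    have a: "?a > 0" using A(2) by (simp add: dyadic.emeasure_eq_measure)
    \<comment> \<open>Cylinders of this level have smaller measure than \<open>A\<close>, so one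
      that meets \<open>A\<close> in positive measure cuts out a proper part.\<close>
    obtain n where n: "(1 / 2) ^ n < ?a" using real_arch_pow_inv[OF a, of "1 / 2"] by auto
    define B where "B = (\<lambda>v. A \<inter> cyl n v)"
    have B: "B v \<in> sets dyadic_space" for v unfolding B_def using A by (intro sets.Int) simp_all
    have "\<exists>v<2 ^ n. \<mu> (B v) > 0"
    proof (rule ccontr)
      assume none: "\<not> ?thesis"
      have 0: "\<mu> (B v) = 0" if "v < 2 ^ n" for v
      proof -
        have "\<mu> (B v) \<le> 0" using none that not_less by blast
        then show ?thesis by (simp add: measure_le_0_iff)
      qed
      have "A = (\<Union>v<2 ^ n. B v)" using sets.sets_into_space[OF A(1)] bits_val_less by (auto simp: B_def)
      also have "\<mu> \<dots> \<le> (\<Sum>v<2 ^ n. \<mu> (B v))"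
        by (rule measure_UNION_le) (use B in auto)
      also have "\<dots> = 0" using 0 by (intro sum.neutral) auto
      finally show False using a by simp
    qed
    then obtain v where v: "v < 2 ^ n" "\<mu> (B v) > 0" by blast
    have "\<mu> (B v) \<le> \<mu> (cyl n v)"
      by (rule dyadic.finite_measure_mono) (auto simp: B_def)
    then have "\<mu> (B v) < ?a" using measure_bits_val[OF v(1), of 0] n by (simp add: power_one_over)
    then show "\<exists>B\<in>sets dyadic_space. B \<subseteq> A \<and> 0 < emeasure dyadic_space B \<and> emeasure dyadic_space B < emeasure dyadic_space A"
      using v(2) B[of v] by (intro bexI[of _ "B v"]) (auto simp: dyadic.emeasure_eq_measure B_def ennreal_less_iff)
  qed
qed

section \<open>Moments and entropy of the cocycles\<close>

lemma summable_blen: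
  fixes q :: real
  assumes q: "0 < q" "q < 1 / 2"
  shows "summable (\<lambda>n. (2 ^ blen (Suc n)) powr q * (1 / 2 ^ blen n))"
proof -
  \<comment> \<open>Gives \<open>n * (1 - 2 * q) \<ge> 2\<close> from \<open>N\<close> on. As
    \<open>14 * q - 5 < 2\<close>, the factor \<open>2 * q * (n + 7) - (n + 6)\<close> in the
    exponent is then at most -1.\<close>
  obtain N :: nat where N: "2 / (1 - 2 * q) \<le> N" using real_arch_simple by blast
  have "norm ((2 ^ blen (Suc n)) powr q * (1 / 2 ^ blen n)) \<le> (1 / 2) ^ n" if n: "n \<ge> N" for n
  proof -
    have "2 / (1 - 2 * q) \<le> n" using N n by linarith
    then have "2 \<le> n * (1 - 2 * q)" using q by (simp add: pos_divide_le_eq)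
    then have neg: "q * (2 * (real n + 7)) - (real n + 6) \<le> -1" using q by (simp add: algebra_simps)
    have "q * blen (Suc n) - blen n = 2 ^ (n + 9) * (q * (2 * (real n + 7)) - (real n + 6))"
      by (simp add: blen_def power_add algebra_simps)
    also have "\<dots> \<le> 2 ^ (n + 9) * -1" by (rule mult_left_mono[OF neg]) simp
    also have "\<dots> \<le> - real n"
    proof -
      have "real n < 2 ^ (n + 9)" by (rule of_nat_less_two_power[THEN order.strict_trans]) simp
      then show ?thesis by simp
    qed
    finally have e: "q * blen (Suc n) - blen n \<le> - real n" .
    have "(2 ^ blen (Suc n)) powr q * (1 / 2 ^ blen n) = 2 powr (q * blen (Suc n) - blen n)"
      by (simp add: powr_diff powr_realpow[symmetric] powr_powr mult.commute)
    also have "\<dots> \<le> 2 powr (- real n)" using e by (intro powr_mono) auto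
    also have "\<dots> = (1 / 2) ^ n" by (simp add: powr_minus powr_realpow power_one_over inverse_eq_divide)
    finally show ?thesis by simp
  qed
  then show ?thesis
    by (intro summable_comparison_test[OF _ summable_geometric[of "1 / 2 :: real"]]) auto
qed

text \<open>Between \<open>2 ^ blen n\<close> and \<open>2 ^ blen (Suc n)\<close> the integrand is
  at most \<open>w n\<close>, on a set of measure at most \<open>1 / 2 ^ blen n\<close>.\<close>

lemma integrable_powr_tail:
  fixes c :: "(nat \<Rightarrow> nat) \<Rightarrow> int"
  assumes [measurable]: "c \<in> dyadic_space \<rightarrow>\<^sub>M count_space UNIV"
    and tl: "\<And>n. \<mu> {x \<in> \<Omega>. \<bar>c x\<bar> \<ge> 2 ^ blen n} \<le> 1 / 2 ^ blen n"
    and q: "0 < q" "q < 1 / 2"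
  shows "integrable dyadic_space (\<lambda>x. \<bar>real_of_int (c x)\<bar> powr q)"
proof (rule integrableI_bounded)
  show "(\<lambda>x. \<bar>real_of_int (c x)\<bar> powr q) \<in> borel_measurable dyadic_space"
    by (rule measurable_compose[OF assms(1)]) simp
  define E where "E = (\<lambda>n. {x \<in> \<Omega>. \<bar>c x\<bar> \<ge> 2 ^ blen n})"
  define w where "w = (\<lambda>n. (2 ^ blen (Suc n)) powr q :: real)"
  have E [measurable]: "E n \<in> sets dyadic_space" for n
  proof -
    have "E n = c -` {k. 2 ^ blen n \<le> \<bar>k\<bar>} \<inter> \<Omega>" by (auto simp: E_def)
    also have "\<dots> \<in> sets dyadic_space" by (rule measurable_sets[OF assms(1)]) simp
    finally show ?thesis .
  qed
  have bd: "ennreal (\<bar>real_of_int (c x)\<bar> powr q) \<le> ennreal ((2 ^ blen 0) powr q) + (\<Sum>n. ennreal (w n) * indicator (E n) x)"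
    if x: "x \<in> \<Omega>" for x
  proof (cases "\<bar>c x\<bar> < 2 ^ blen 0")
    case True
    then have "real_of_int \<bar>c x\<bar> \<le> real_of_int (2 ^ blen 0)" by (subst of_int_le_iff) simp
    then have "\<bar>real_of_int (c x)\<bar> \<le> 2 ^ blen 0" by simp
    then have "\<bar>real_of_int (c x)\<bar> powr q \<le> (2 ^ blen 0) powr q" using q by (intro powr_mono2) auto
    then have "ennreal (\<bar>real_of_int (c x)\<bar> powr q) \<le> ennreal ((2 ^ blen 0) powr q)" by (rule ennreal_leI)
    then show ?thesis by (rule order_trans) simp
  next
    case False
    have ex: "\<exists>n. \<bar>c x\<bar> < 2 ^ blen n"
    proof -
      have "\<bar>c x\<bar> < 2 ^ nat \<bar>c x\<bar>" using of_nat_less_two_power[of "nat \<bar>c x\<bar>", where 'a = int] by simp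
      also have "(2::int) ^ nat \<bar>c x\<bar> \<le> 2 ^ blen (nat \<bar>c x\<bar>)" by (intro power_increasing blen_ge) simp
      finally show ?thesis by blast
    qed
    define m where "m = (LEAST n. \<bar>c x\<bar> < 2 ^ blen n)"
    have m: "\<bar>c x\<bar> < 2 ^ blen m" unfolding m_def by (rule LeastI_ex[OF ex])
    have "m \<noteq> 0" using m False by (intro notI) simp
    then obtain n where n: "m = Suc n" using not0_implies_Suc by blast
    have "\<not> \<bar>c x\<bar> < 2 ^ blen n" using not_less_Least[of n "\<lambda>n. \<bar>c x\<bar> < 2 ^ blen n"] n by (simp add: m_def)
    then have xE: "x \<in> E n" using x by (simp add: E_def)
    have "\<bar>real_of_int (c x)\<bar> \<le> 2 ^ blen (Suc n)"
    proof -
      have "real_of_int \<bar>c x\<bar> \<le> real_of_int (2 ^ blen (Suc n))" using m n by (simp only: of_int_le_iff)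
      then show ?thesis by simp
    qed
    then have "\<bar>real_of_int (c x)\<bar> powr q \<le> w n" unfolding w_def using q by (intro powr_mono2) auto
    then have "ennreal (\<bar>real_of_int (c x)\<bar> powr q) \<le> ennreal (w n) * indicator (E n) x"
      using xE by (simp add: ennreal_leI)
    also have "\<dots> \<le> (\<Sum>k. ennreal (w k) * indicator (E k) x)"
    proof -
      have "f n \<le> suminf f" for f :: "nat \<Rightarrow> ennreal" using sum_le_suminf[of f "{n}"] by simp
      then show ?thesis .
    qed
    finally show ?thesis by (rule order_trans) simp
  qed
  have "(\<integral>\<^sup>+ x. ennreal (norm (\<bar>real_of_int (c x)\<bar> powr q)) \<partial>dyadic_space)
    \<le> (\<integral>\<^sup>+ x. ennreal ((2 ^ blen 0) powr q) + (\<Sum>n. ennreal (w n) * indicator (E n) x) \<partial>dyadic_space)"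
    using bd by (intro nn_integral_mono) simp
  also have "\<dots> = ennreal ((2 ^ blen 0) powr q) + (\<integral>\<^sup>+ x. (\<Sum>n. ennreal (w n) * indicator (E n) x) \<partial>dyadic_space)"
    by (subst nn_integral_add) (simp_all add: dyadic.emeasure_space_1)
  also have "(\<integral>\<^sup>+ x. (\<Sum>n. ennreal (w n) * indicator (E n) x) \<partial>dyadic_space) = (\<Sum>n. ennreal (w n) * emeasure dyadic_space (E n))"
    by (subst nn_integral_suminf) (simp_all add: nn_integral_cmult_indicator)
  also have "\<dots> \<le> (\<Sum>n. ennreal (w n * (1 / 2 ^ blen n)))"
  proof (rule suminf_le)
    fix n
    have "ennreal (w n) * emeasure dyadic_space (E n) = ennreal (w n * \<mu> (E n))"
      by (simp add: dyadic.emeasure_eq_measure ennreal_mult w_def)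
    also have "\<dots> \<le> ennreal (w n * (1 / 2 ^ blen n))"
      using tl[of n] by (intro ennreal_leI mult_left_mono) (auto simp: E_def w_def)
    finally show "ennreal (w n) * emeasure dyadic_space (E n) \<le> ennreal (w n * (1 / 2 ^ blen n))" .
  qed auto
  also have "\<dots> = ennreal (\<Sum>n. w n * (1 / 2 ^ blen n))"
    by (rule suminf_ennreal2) (use summable_blen[OF q] in \<open>auto simp: w_def\<close>)
  finally have "(\<integral>\<^sup>+ x. ennreal (norm (\<bar>real_of_int (c x)\<bar> powr q)) \<partial>dyadic_space)
      \<le> ennreal ((2 ^ blen 0) powr q) + ennreal (\<Sum>n. w n * (1 / 2 ^ blen n))"
    by (auto simp: add_left_mono)
  also have "\<dots> < \<infinity>" by simp
  finally show "(\<integral>\<^sup>+ x. ennreal (norm (\<bar>real_of_int (c x)\<bar> powr q)) \<partial>dyadic_space) < \<infinity>"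
    .
qed

lemma sum_inverse_squares_int: "(\<Sum>n\<in>{- int N..int N}. 1 / (real_of_int n)\<^sup>2) \<le> 4 - 4 / (real N + 1)"
proof (induction N)
  case (Suc N)
  have "{- int (Suc N)..int (Suc N)} = insert (- int (Suc N)) (insert (int (Suc N)) {- int N..int N})" by auto
  then have "(\<Sum>n\<in>{- int (Suc N)..int (Suc N)}. 1 / (real_of_int n)\<^sup>2)
    = 2 / (real N + 1)\<^sup>2 + (\<Sum>n\<in>{- int N..int N}. 1 / (real_of_int n)\<^sup>2)"
    by (simp add: power2_eq_square algebra_simps)
  \<comment> \<open>The right-hand side is 4 / ((N + 1) * (N + 2)), so the bound telescopes. The
    base case is an equality because \<open>1 / 0 = 0\<close>.\<close>
  also have "2 / (real N + 1)\<^sup>2 \<le> 4 / (real N + 1) - 4 / (real N + 2)"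
    by (simp add: divide_simps power2_eq_square)
  finally have *: "(\<Sum>n\<in>{- int (Suc N)..int (Suc N)}. 1 / (real_of_int n)\<^sup>2)
    \<le> 4 / (real N + 1) - 4 / (real N + 2) + (\<Sum>n\<in>{- int N..int N}. 1 / (real_of_int n)\<^sup>2)" by simp
  have "4 / (real (Suc N) + 1) = 4 / (real N + 2)" by (simp add: add.commute)
  then show ?case using * Suc by linarith
qed simp

text \<open>Two regimes, with the absolute value of an integer for \<open>a\<close>. If
  \<open>p \<ge> 1 / a ^ 4\<close>, then \<open>- ln p\<close> is at most \<open>4 * ln a\<close>,
  which a power of \<open>a\<close> dominates. For smaller \<open>p\<close> the left-hand side is at
  most \<open>2 * sqrt p\<close>, hence at most 2 divided by the square of \<open>a\<close>.\<close>

lemma entropy_term_le: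
  fixes p a q :: real
  assumes p: "0 \<le> p" "p \<le> 1" and a: "a \<ge> 1" and q: "q > 0"
  shows "- (p * ln p) \<le> 4 / q * (p * a powr q) + 2 / a\<^sup>2"
proof (cases "p \<ge> 1 / a ^ 4")
  case True
  have "0 < 1 / a ^ 4" using a by simp
  then have ppos: "p > 0" using True by linarith
  have "- ln p = ln (1 / p)" using ppos by (simp add: ln_div)
  also have "\<dots> \<le> ln (a ^ 4)" using True ppos a by (subst ln_le_cancel_iff) (auto simp: field_simps)
  also have "\<dots> = 4 * ln a" using a by (simp add: ln_realpow)
  also have "\<dots> = 4 / q * ln (a powr q)" using a q by (simp add: ln_powr)
  also have "\<dots> \<le> 4 / q * a powr q"
  proof (intro mult_left_mono)
    have "a powr q > 0" using a by simp
    then show "ln (a powr q) \<le> a powr q" using ln_le_minus_one[of "a powr q"] by linarith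
  qed (use q in simp)
  finally have "p * - ln p \<le> p * (4 / q * a powr q)" using p by (intro mult_left_mono) auto
  moreover have "0 \<le> 2 / a\<^sup>2" by simp
  moreover have "p * - ln p = - (p * ln p)" "p * (4 / q * a powr q) = 4 / q * (p * a powr q)" by simp_all
  ultimately show ?thesis by linarith
next
  case False
  show ?thesis
  proof (cases "p = 0")
    case True
    then show ?thesis by simp
  next
    case pn: False
    then have ppos: "p > 0" using p by simp
    define r where "r = sqrt p"
    have r: "r > 0" "p = r * r" using ppos by (auto simp: r_def)
    have "ln (1 / r) \<le> 1 / r - 1" by (rule ln_le_minus_one) (use r in simp)
    then have "r * - ln r \<le> r * (1 / r)" using r by (intro mult_left_mono) (auto simp: ln_div)
    then have 1: "- (r * ln r) \<le> 1" using r by simp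
    have "- (p * ln p) = 2 * r * (- (r * ln r))" using r by (simp add: ln_mult algebra_simps)
    also have "\<dots> \<le> 2 * r * 1" using 1 r by (intro mult_left_mono) auto
    also have "r \<le> 1 / a\<^sup>2"
    proof -
      have "r * r \<le> (1 / a\<^sup>2) * (1 / a\<^sup>2)" using False r a by (simp add: power2_eq_square power4_eq_xxxx field_simps)
      then show ?thesis using r a by (metis abs_of_pos abs_le_square_iff power2_eq_square zero_le_divide_1_iff zero_le_power2 abs_of_nonneg)
    qed
    finally have "- (p * ln p) \<le> 2 / a\<^sup>2" by simp
    moreover have "0 \<le> 4 / q * (p * a powr q)" using p q by simp
    ultimately show ?thesis by linarith
  qed
qed

text \<open>\<open>entropy_term_le\<close> is summed over the nonzero values: the moment pays for
  the likely ones, the inverse squares for the unlikely ones. The value 0 contributes at most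
  1.\<close>

lemma Shannon_of_integrable:
  assumes P: "prob_space M" and c [measurable]: "c \<in> M \<rightarrow>\<^sub>M count_space UNIV"
    and q: "q > 0" and int: "integrable M (\<lambda>x. \<bar>real_of_int (c x)\<bar> powr q)"
  shows "Shannon M c"
  unfolding Shannon_def
proof (intro conjI c)
  interpret prob_space M by fact
  define p where "p = (\<lambda>n. measure M (c -` {n} \<inter> space M))"
  have p: "0 \<le> p n" "p n \<le> 1" for n by (simp_all add: p_def)
  define I where "I = (\<integral>x. \<bar>real_of_int (c x)\<bar> powr q \<partial>M)"
  have "(\<lambda>n. - (p n * ln (p n))) summable_on UNIV"
  proof (rule nonneg_bdd_above_summable_on)
    show "0 \<le> - (p n * ln (p n))" for n
      using p[of n] by (cases "p n = 0") (auto simp: mult_nonneg_nonpos)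
    show "bdd_above (sum (\<lambda>n. - (p n * ln (p n))) ` {F. F \<subseteq> UNIV \<and> finite F})"
    proof (rule bdd_aboveI2)
      fix F :: "int set" assume "F \<in> {F. F \<subseteq> UNIV \<and> finite F}"
      then have F: "finite F" by simp
      obtain N where N: "F \<subseteq> {- int N..int N}"
      proof
        show "F \<subseteq> {- int (nat (Max (abs ` F)))..int (nat (Max (abs ` F)))}"
        proof
          fix n assume n: "n \<in> F"
          have "\<bar>n\<bar> \<le> Max (abs ` F)" using F n by (intro Max_ge) auto
          then show "n \<in> {- int (nat (Max (abs ` F)))..int (nat (Max (abs ` F)))}" by auto
        qed
      qed
      have t: "- (p n * ln (p n)) \<le> 4 / q * (p n * \<bar>real_of_int n\<bar> powr q) + (2 * (1 / (real_of_int n)\<^sup>2) + (if n = 0 then 1 else 0))" for n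
      proof (cases "n = 0")
        case True
        have "- (p n * ln (p n)) \<le> 1"
        proof (cases "p n = 0")
          case False
          then have pp: "p n > 0" using p[of n] by simp
          then have "ln (1 / p n) \<le> 1 / p n - 1" by (intro ln_le_minus_one) simp
          then have "p n * - ln (p n) \<le> p n * (1 / p n)" using pp by (intro mult_left_mono) (auto simp: ln_div)
          then show ?thesis using pp by simp
        qed simp
        then show ?thesis using True by simp
      next
        case False
        then have "\<bar>real_of_int n\<bar> \<ge> 1" by linarith
        from entropy_term_le[OF p this q] show ?thesis using False by simp
      qed
      have "(\<Sum>n\<in>F. - (p n * ln (p n))) \<le> (\<Sum>n\<in>F. 4 / q * (p n * \<bar>real_of_int n\<bar> powr q) + (2 * (1 / (real_of_int n)\<^sup>2) + (if n = 0 then 1 else 0)))"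
        by (rule sum_mono) (rule t)
      also have "\<dots> = 4 / q * (\<Sum>n\<in>F. p n * \<bar>real_of_int n\<bar> powr q) + (2 * (\<Sum>n\<in>F. 1 / (real_of_int n)\<^sup>2) + (\<Sum>n\<in>F. if n = 0 then 1 else 0))"
        by (simp add: sum.distrib sum_distrib_left)
      finally have main: "(\<Sum>n\<in>F. - (p n * ln (p n))) \<le> 4 / q * (\<Sum>n\<in>F. p n * \<bar>real_of_int n\<bar> powr q) + (2 * (\<Sum>n\<in>F. 1 / (real_of_int n)\<^sup>2) + (\<Sum>n\<in>F. if n = 0 then 1 else 0))" .
      have z: "(\<Sum>n\<in>F. if n = 0 then 1 else 0) \<le> (1::real)"
        using F by simp
      have "(\<Sum>n\<in>F. 1 / (real_of_int n)\<^sup>2) \<le> (\<Sum>n\<in>{- int N..int N}. 1 / (real_of_int n)\<^sup>2)"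
        by (rule sum_mono2) (use N in auto)
      also have "\<dots> \<le> 4"
      proof -
        have "0 \<le> 4 / (real N + 1)" by simp
        then show ?thesis using sum_inverse_squares_int[of N] by linarith
      qed
      finally have sq: "(\<Sum>n\<in>F. 1 / (real_of_int n)\<^sup>2) \<le> 4" .
      have "(\<Sum>n\<in>F. p n * \<bar>real_of_int n\<bar> powr q) \<le> I"
      proof -
        have ind: "integrable M (indicator (c -` {n} \<inter> space M) :: _ \<Rightarrow> real)" for n
          by (rule integrable_real_indicator) (auto simp: emeasure_eq_measure)
        have "(\<Sum>n\<in>F. p n * \<bar>real_of_int n\<bar> powr q) = (\<Sum>n\<in>F. \<integral>x. indicator (c -` {n} \<inter> space M) x * \<bar>real_of_int n\<bar> powr q \<partial>M)"
          by (simp add: p_def)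
        also have "\<dots> = (\<integral>x. (\<Sum>n\<in>F. indicator (c -` {n} \<inter> space M) x * \<bar>real_of_int n\<bar> powr q) \<partial>M)"
          using ind by (intro Bochner_Integration.integral_sum[symmetric]) simp
        also have "\<dots> \<le> I"
          unfolding I_def
        proof (rule integral_mono)
          show "integrable M (\<lambda>x. \<Sum>n\<in>F. indicator (c -` {n} \<inter> space M) x * \<bar>real_of_int n\<bar> powr q)"
            using ind by simp
          fix x assume x: "x \<in> space M"
          have "(\<Sum>n\<in>F. indicator (c -` {n} \<inter> space M) x * \<bar>real_of_int n\<bar> powr q) = (\<Sum>n\<in>F. if n = c x then \<bar>real_of_int n\<bar> powr q else 0)"
            using x by (intro sum.cong) (auto simp: indicator_def)
          also have "\<dots> \<le> \<bar>real_of_int (c x)\<bar> powr q" using F by simp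
          finally show "(\<Sum>n\<in>F. indicator (c -` {n} \<inter> space M) x * \<bar>real_of_int n\<bar> powr q) \<le> \<bar>real_of_int (c x)\<bar> powr q" .
        qed (rule int)
        finally show ?thesis .
      qed
      then have "4 / q * (\<Sum>n\<in>F. p n * \<bar>real_of_int n\<bar> powr q) \<le> 4 / q * I"
        using q by (intro mult_left_mono) auto
      then show "(\<Sum>n\<in>F. - (p n * ln (p n))) \<le> 4 / q * I + (2 * 4 + 1)"
        using main z sq by linarith
    qed
  qed
  then show "(\<lambda>n. - (measure M (c -` {n} \<inter> space M) * ln (measure M (c -` {n} \<inter> space M)))) summable_on UNIV"
    by (simp add: p_def)
qed

lemma L_less_orbit_equivalent_odomutant:
  "L_less_orbit_equivalent (1 / 2) dyadic_space odomutant dyadic_space dyadic_odometer"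
  unfolding L_less_orbit_equivalent_def
proof (rule exI[of _ id], rule exI[of _ coc_odomutant], rule exI[of _ coc_odometer],
    intro conjI allI impI orbit_equivalence_odomutant oe_cocycles_odomutant)
  fix q :: real assume q: "0 < q \<and> q < 1 / 2"
  show "integrable dyadic_space (\<lambda>x. \<bar>real_of_int (coc_odomutant x)\<bar> powr q)"
    using q by (intro integrable_powr_tail measurable_coc_odomutant measure_coc_odomutant) auto
  show "integrable dyadic_space (\<lambda>x. \<bar>real_of_int (coc_odometer x)\<bar> powr q)"
    using q by (intro integrable_powr_tail measurable_coc_odometer measure_coc_odometer) auto
qed

lemma Shannon_orbit_equivalent_odomutant:
  "Shannon_orbit_equivalent dyadic_space odomutant dyadic_space dyadic_odometer"
  unfolding Shannon_orbit_equivalent_def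
proof (rule exI[of _ id], rule exI[of _ coc_odomutant], rule exI[of _ coc_odometer],
    intro conjI orbit_equivalence_odomutant oe_cocycles_odomutant)
  show "Shannon dyadic_space coc_odomutant"
    by (rule Shannon_of_integrable[OF dyadic.prob_space_axioms measurable_coc_odomutant, of "1 / 4"])
      (auto intro!: integrable_powr_tail measurable_coc_odomutant measure_coc_odomutant)
  show "Shannon dyadic_space coc_odometer"
    by (rule Shannon_of_integrable[OF dyadic.prob_space_axioms measurable_coc_odometer, of "1 / 4"])
      (auto intro!: integrable_powr_tail measurable_coc_odometer measure_coc_odometer)
qed

section \<open>Names along the odomutant\<close>

lemma subseq_ConsE:
  assumes "subseq s (c # v)"
  obtains t where "s = t \<or> s = c # t" "subseq t v"
  using assms by (cases s) (auto simp: split: if_splits)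

text \<open>The triangle inequality for the indel distance.\<close>

lemma subseq_common:
  assumes "subseq s v" "subseq s' v"
  shows "\<exists>r. subseq r s \<and> subseq r s' \<and> length s + length s' \<le> length r + length v"
  using assms
proof (induction v arbitrary: s s' rule: list.induct)
  case Nil
  then have "s = []" "s' = []" by (auto dest: list_emb_Nil2)
  then show ?case by (intro exI[of _ "[]"]) simp
next
  case (Cons c v)
  from Cons.prems(1) obtain t where t: "s = t \<or> s = c # t" "subseq t v" by (rule subseq_ConsE)
  from Cons.prems(2) obtain t' where t': "s' = t' \<or> s' = c # t'" "subseq t' v" by (rule subseq_ConsE)
  from Cons.IH[OF t(2) t'(2)] obtain r where r: "subseq r t" "subseq r t'" "length t + length t' \<le> length r + length v"
    by blast
  show ?case
  proof (cases "s = c # t \<and> s' = c # t'")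
    case True
    then show ?thesis using r by (intro exI[of _ "c # r"]) simp
  next
    case False
    have "subseq r s" "subseq r s'" using r t t' by (auto intro: list_emb_Cons)
    moreover have "length s + length s' \<le> length t + length t' + 1" using False t t' by auto
    ultimately show ?thesis using r(3) by (intro exI[of _ r]) auto
  qed
qed

text \<open>Equal pieces are matched, the others are dropped. A dropped piece costs its length but
  does not put the later ones out of step.\<close>

lemma subseq_concat_common:
  "\<exists>s. subseq s (concat (map g xs)) \<and> subseq s (concat (map g' xs)) \<and>
     length (concat (map g xs)) + length (concat (map g' xs))
       \<le> 2 * length s + (\<Sum>x\<leftarrow>xs. if g x = g' x then 0 else length (g x) + length (g' x))"
proof (induction xs)
  case Nil
  show ?case by (intro exI[of _ "[]"]) simp
next
  case (Cons x xs)
  then obtain s where s: "subseq s (concat (map g xs))" "subseq s (concat (map g' xs))"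
    "length (concat (map g xs)) + length (concat (map g' xs))
       \<le> 2 * length s + (\<Sum>x\<leftarrow>xs. if g x = g' x then 0 else length (g x) + length (g' x))"
    by blast
  show ?case
  proof (cases "g x = g' x")
    case True
    then show ?thesis using s by (intro exI[of _ "g x @ s"]) (simp add: list_emb_append_mono)
  next
    case False
    then show ?thesis using s by (intro exI[of _ s]) (simp add: list_emb_append2)
  qed
qed

lemma sum_shift_mod:
  fixes F :: "nat \<Rightarrow> 'b::comm_monoid_add"
  assumes "v < L"
  shows "(\<Sum>t<L. F ((v + t) mod L)) = (\<Sum>r<L. F r)"
proof (rule sum.reindex_bij_betw, rule bij_betw_byWitness[where f' = "\<lambda>r. (r + (L - v)) mod L"])
  show "\<forall>t\<in>{..<L}. ((v + t) mod L + (L - v)) mod L = t"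
  proof
    fix t assume "t \<in> {..<L}"
    have "((v + t) mod L + (L - v)) mod L = (v + t + (L - v)) mod L" by (simp add: mod_simps)
    also have "v + t + (L - v) = t + L" using assms by simp
    finally show "((v + t) mod L + (L - v)) mod L = t" using \<open>t \<in> {..<L}\<close> by simp
  qed
  show "\<forall>r\<in>{..<L}. (v + (r + (L - v)) mod L) mod L = r"
  proof
    fix r assume "r \<in> {..<L}"
    have "(v + (r + (L - v)) mod L) mod L = (v + (r + (L - v))) mod L" by (simp add: mod_simps)
    also have "v + (r + (L - v)) = r + L" using assms by simp
    finally show "(v + (r + (L - v)) mod L) mod L = r" using \<open>r \<in> {..<L}\<close> by simp
  qed
qed (use assms in auto)

text \<open>A whole period has the same length from whatever phase it starts.\<close>

lemma length_periodic:
  assumes "v < L"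
  shows "length (concat (map (\<lambda>t. G ((v + t) mod L)) [0..<K * L])) = K * length (concat (map G [0..<L]))"
proof -
  let ?F = "\<lambda>t. G ((v + t) mod L)"
  have step: "length (concat (map (\<lambda>t. ?F (k * L + t)) [0..<L])) = length (concat (map G [0..<L]))" for k
  proof -
    have "(v + (k * L + t)) mod L = (v + t) mod L" for t
      using mod_mult_self1[of "v + t" k L] by (simp add: ac_simps)
    then have "(\<Sum>t<L. length (?F (k * L + t))) = (\<Sum>r<L. length (G r))"
      using sum_shift_mod[OF assms, of "\<lambda>r. length (G r)"] by simp
    then show ?thesis by (simp add: length_concat o_def sum_list_distinct_conv_sum_set atLeast0LessThan)
  qed
  have "length (concat (map h [0..<K])) = K * c" if "\<And>k. length (h k) = c" for h :: "nat \<Rightarrow> 'a list" and c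
    using that by (induction K) auto
  note this[of "\<lambda>k. concat (map (\<lambda>t. ?F (k * L + t)) [0..<L])", OF step]
  then show ?thesis by (simp add: map_upt_mult[of ?F] concat_concat o_def)
qed

text \<open>Dropping the first \<open>L - v\<close> pieces brings the phase to 0, and
  \<open>K - 1\<close> whole periods remain. So the periodic words of all phases share one long
  subsequence.\<close>

lemma subseq_periodic:
  assumes "v < L" "K \<ge> 1"
  shows "subseq (concat (replicate (K - 1) (concat (map G [0..<L])))) (concat (map (\<lambda>t. G ((v + t) mod L)) [0..<K * L]))"
proof -
  let ?F = "\<lambda>t. G ((v + t) mod L)"
  have "concat (replicate (K - 1) (concat (map G [0..<L]))) = concat (map ?F [L - v..<L - v + (K - 1) * L])"
  proof -
    have "map ?F [L - v..<L - v + (K - 1) * L] = map (\<lambda>s. G (s mod L)) [0..<(K - 1) * L]"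
    proof (rule nth_equalityI)
      fix i assume "i < length (map ?F [L - v..<L - v + (K - 1) * L])"
      moreover have "v + (L - v + i) = i + L" using assms by simp
      ultimately show "map ?F [L - v..<L - v + (K - 1) * L] ! i = map (\<lambda>s. G (s mod L)) [0..<(K - 1) * L] ! i" by simp
    qed simp
    also have "\<dots> = concat (replicate (K - 1) (map G [0..<L]))"
    proof -
      have eq: "(\<lambda>t. map (\<lambda>r. G ((t * L + r) mod L)) [0..<L]) = (\<lambda>t. map G [0..<L])"
        by (intro ext map_cong) auto
      have "map (\<lambda>s. G (s mod L)) [0..<(K - 1) * L] = concat (map (\<lambda>t. map G [0..<L]) [0..<K - 1])"
        unfolding map_upt_mult[of "\<lambda>s. G (s mod L)"] eq by (rule refl)
      then show ?thesis by (simp add: map_replicate_const)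
    qed
    finally show ?thesis by (simp add: concat_concat map_replicate_const)
  qed
  moreover have "[0..<K * L] = [0..<L - v] @ [L - v..<L - v + (K - 1) * L] @ [L - v + (K - 1) * L..<K * L]"
  proof -
    have le: "L - v + (K - 1) * L \<le> K * L" using assms by (cases K) auto
    have "[0..<L - v + (K - 1) * L] = [0..<L - v] @ [L - v..<L - v + (K - 1) * L]" by (rule upt_add_eq_append) simp
    then show ?thesis using upt_add_eq_append[of 0 "L - v + (K - 1) * L" "K * L - (L - v + (K - 1) * L)"] le by simp
  qed
  ultimately show ?thesis by (simp add: subseq_drop_many list_emb_append2 list_emb_prefix)
qed

text \<open>Here rotations and words meet. The window of the rotated digit from
  \<open>(n + 8) * i\<close> on, with \<open>i\<close> the type of the larger block, holds the
  unrotated type of the subblock, and this is the index at which \<open>blk\<close>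
  descends.\<close>

lemma nth_blk_pos:
  assumes x: "x \<in> \<Omega>"
  shows "btype 0 x = blk n (btype n x) ! pos n x"
proof (induction n)
  case 0
  then show ?case using pos_less[OF x, of 0] by simp
next
  case (Suc n)
  let ?i = "btype (Suc n) x"
  have i: "?i < 2 ^ (n + 9)" by (rule btype_Suc_less[OF x])
  have "(n + 8) * ?i + (n + 8) = (n + 8) * Suc ?i" by simp
  also have "\<dots> \<le> dlen n" unfolding dlen_def using i by (intro mult_le_mono) auto
  finally have le: "(n + 8) * ?i + (n + 8) \<le> dlen n" .
  have z: "(\<lambda>t. x (blen n + rho (n + 8) ?i t)) \<in> \<Omega>" using x by (simp add: in_dyadic)
  have "(dig n x div 2 ^ ((n + 8) * ?i)) mod 2 ^ (n + 8) = bits_val (0 + (n + 8) * ?i) (n + 8) (\<lambda>t. x (blen n + rho (n + 8) ?i t))"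
    unfolding dig_def by (rule bits_val_div_mod[OF z le])
  also have "\<dots> = btype n x"
    unfolding btype_def[of n] bits_val_def by (intro sum.cong refl) (simp add: rho_def)
  finally have "blk (Suc n) ?i ! pos (Suc n) x = blk n (btype n x) ! pos n x"
    using nth_blk_Suc[OF dig_less[OF x] pos_less[OF x]] by simp
  then show ?case using Suc by simp
qed

lemma name_sublist:
  assumes x: "x \<in> nonconst" and l: "pos n x + l \<le> 2 ^ blen n"
  shows "sublist (map (\<lambda>j. btype 0 ((odomutant ^^ j) x)) [0..<l]) (blk n (btype n x))"
proof -
  have "map (\<lambda>j. btype 0 ((odomutant ^^ j) x)) [0..<l] = take l (drop (pos n x) (blk n (btype n x)))"
  proof (rule nth_equalityI)
    fix j assume "j < length (map (\<lambda>j. btype 0 ((odomutant ^^ j) x)) [0..<l])"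
    then have j: "j < l" by simp
    have b: "(odomutant ^^ j) x \<in> nonconst" "tail (blen n) ((odomutant ^^ j) x) = tail (blen n) x" "pos n ((odomutant ^^ j) x) = pos n x + j"
      using odomutant_funpow_block[OF x, of n j] l j by auto
    have "btype 0 ((odomutant ^^ j) x) = blk n (btype n x) ! (pos n x + j)"
      using nth_blk_pos[OF nonconst_in[OF b(1)], of n] b(3) btype_tail[OF b(2)] by simp
    then show "map (\<lambda>j. btype 0 ((odomutant ^^ j) x)) [0..<l] ! j = take l (drop (pos n x) (blk n (btype n x))) ! j"
      using j l length_blk[of n "btype n x"] by simp
  qed (use l length_blk[of n "btype n x"] in simp)
  then show ?thesis by (metis append_take_drop_id sublist_appendI)
qed

text \<open>The level sets of \<open>g\<close> are approximated by cylinder sets of one common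
  level. Where these overlap or leave a gap, the choice of a value is free, because their errors
  already cover such points.\<close>

lemma cylinder_fun_approx:
  fixes g :: "(nat \<Rightarrow> nat) \<Rightarrow> 'c"
  assumes F: "finite F" and g: "\<And>y. y \<in> \<Omega> \<Longrightarrow> g y \<in> F"
    and meas: "\<And>w. w \<in> F \<Longrightarrow> {y \<in> \<Omega>. g y = w} \<in> sets dyadic_space" and "\<epsilon> > 0"
  shows "\<exists>l G. (\<forall>v. G v \<in> F) \<and> \<mu> {y \<in> \<Omega>. g y \<noteq> G (val l y)} < \<epsilon>"
proof -
  define A where "A = (\<lambda>w. {y \<in> \<Omega>. g y = w})"
  obtain y0 where y0: "y0 \<in> \<Omega>" using odometer_in by blast
  define d where "d = \<epsilon> / (real (card F) + 1)"
  have d: "d > 0" using assms by (simp add: d_def add_nonneg_pos)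
  have "\<forall>w. \<exists>nV. w \<in> F \<longrightarrow> \<mu> (sym_diff (A w) {x \<in> \<Omega>. val (fst nV) x \<in> snd nV}) < d"
  proof
    fix w
    show "\<exists>nV. w \<in> F \<longrightarrow> \<mu> (sym_diff (A w) {x \<in> \<Omega>. val (fst nV) x \<in> snd nV}) < d"
    proof (cases "w \<in> F")
      case True
      obtain n V where "\<mu> (sym_diff (A w) {x \<in> \<Omega>. val n x \<in> V}) < d"
        using cylinder_approx[OF meas[OF True] d] unfolding A_def by (elim exE)
      then show ?thesis by (intro exI[of _ "(n, V)"]) simp
    qed simp
  qed
  from choice[OF this] obtain nV where nV: "w \<in> F \<Longrightarrow> \<mu> (sym_diff (A w) {x \<in> \<Omega>. val (fst (nV w)) x \<in> snd (nV w)}) < d" for w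
    by blast
  define l where "l = Max (fst ` nV ` F)"
  define W where "W = (\<lambda>w. {v. v mod 2 ^ fst (nV w) \<in> snd (nV w)})"
  define G where "G = (\<lambda>v. if \<exists>w\<in>F. v \<in> W w then SOME w. w \<in> F \<and> v \<in> W w else g y0)"
  have G: "G v \<in> F \<and> v \<in> W (G v)" if "\<exists>w\<in>F. v \<in> W w" for v
  proof -
    have "\<exists>w. w \<in> F \<and> v \<in> W w" using that by blast
    from someI_ex[OF this] show ?thesis using that by (simp add: G_def)
  qed
  have GF: "G v \<in> F" for v
    using G[of v] g[OF y0] by (cases "\<exists>w\<in>F. v \<in> W w") (auto simp: G_def)
  define C where "C = (\<lambda>w. {x \<in> \<Omega>. val l x \<in> W w})"
  have C: "\<mu> (sym_diff (A w) (C w)) < d" if "w \<in> F" for w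
  proof -
    have "fst (nV w) \<le> l" unfolding l_def using F that by (intro Max_ge) auto
    from val_mem_mono[OF this] show ?thesis using nV[OF that] by (simp add: C_def W_def)
  qed
  have Cs: "C w \<in> sets dyadic_space" for w unfolding C_def by measurable
  have sd: "sym_diff (A w) (C w) \<in> sets dyadic_space" if "w \<in> F" for w
    using meas[OF that] Cs[of w] by (auto simp: A_def)
  have "{y \<in> \<Omega>. g y \<noteq> G (val l y)} \<subseteq> (\<Union>w\<in>F. sym_diff (A w) (C w))"
  proof (rule subsetI)
    fix y assume "y \<in> {y \<in> \<Omega>. g y \<noteq> G (val l y)}"
    then have y: "y \<in> \<Omega>" "g y \<noteq> G (val l y)" by simp_all
    show "y \<in> (\<Union>w\<in>F. sym_diff (A w) (C w))"
    proof (cases "\<exists>w\<in>F. val l y \<in> W w")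
      case True
      have "y \<in> sym_diff (A (G (val l y))) (C (G (val l y)))" using G[OF True] y by (simp add: A_def C_def)
      then show ?thesis using G[OF True] by blast
    next
      case False
      then have "y \<in> sym_diff (A (g y)) (C (g y))" using y g[OF y(1)] by (simp add: A_def C_def)
      then show ?thesis using g[OF y(1)] by blast
    qed
  qed
  then have "\<mu> {y \<in> \<Omega>. g y \<noteq> G (val l y)} \<le> \<mu> (\<Union>w\<in>F. sym_diff (A w) (C w))"
    by (rule dyadic.finite_measure_mono) (intro sets.finite_UN F sd)
  also have "\<dots> \<le> (\<Sum>w\<in>F. \<mu> (sym_diff (A w) (C w)))"
    by (rule measure_UNION_le[OF F sd])
  also have "\<dots> \<le> (\<Sum>w\<in>F. d)" using C by (intro sum_mono less_imp_le)
  also have "\<dots> = card F * d" by simp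
  also have "\<dots> < \<epsilon>" using assms by (simp add: d_def field_simps)
  finally show ?thesis using GF by blast
qed

section \<open>Even Kakutani equivalence\<close>

lemma measure_preimage_funpow:
  assumes F: "aut dyadic_space F" and A: "A \<in> sets dyadic_space"
  shows "(F ^^ n) -` A \<inter> \<Omega> \<in> sets dyadic_space \<and>
    \<mu> ((F ^^ n) -` A \<inter> \<Omega>) = \<mu> A"
proof (induction n)
  case 0
  have "(F ^^ 0) -` A \<inter> \<Omega> = A" using sets.sets_into_space[OF A] by auto
  then show ?case using A by simp
next
  case (Suc n)
  have meas: "F \<in> dyadic_space \<rightarrow>\<^sub>M dyadic_space" using F by (simp add: aut_def mp_bij_def)
  let ?B = "(F ^^ n) -` A \<inter> \<Omega>"
  have "(F ^^ Suc n) -` A \<inter> \<Omega> = F -` ?B \<inter> \<Omega>"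
    using aut_in[OF F] by (auto simp: funpow_swap1)
  note eq = this
  have B: "?B \<in> sets dyadic_space" "\<mu> ?B = \<mu> A" using Suc by auto
  show ?case
    unfolding eq using measurable_sets[OF meas B(1)] measure_preimage[OF F B(1)] B(2) by (simp only:)
qed

text \<open>Summed over \<open>m\<close>, the measures of these sets give the integral of the return
  time over \<open>A\<close>. This form avoids the default value of \<open>return_time\<close> at
  points that never return.\<close>

definition nonreturn :: "((nat \<Rightarrow> nat) \<Rightarrow> nat \<Rightarrow> nat) \<Rightarrow> (nat \<Rightarrow> nat) set \<Rightarrow> nat \<Rightarrow> (nat \<Rightarrow> nat) set" where
  "nonreturn F A m = {x \<in> A. \<forall>j. 1 \<le> j \<and> j \<le> m \<longrightarrow> (F ^^ j) x \<notin> A}"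

lemma sets_nonreturn:
  assumes F: "aut dyadic_space F" and A: "A \<in> sets dyadic_space"
  shows "nonreturn F A m \<in> sets dyadic_space"
proof -
  have "nonreturn F A m = A - (\<Union>j\<in>{1..m}. (F ^^ j) -` A \<inter> \<Omega>)"
    using sets.sets_into_space[OF A] by (auto simp: nonreturn_def)
  also have "\<dots> \<in> sets dyadic_space"
    using measure_preimage_funpow[OF F A] A by (intro sets.Diff sets.finite_UN) auto
  finally show ?thesis .
qed

text \<open>Kac's inequality: the set \<open>B m\<close> in the proof consists of the points whose last visit to \<open>A\<close> before
  time \<open>N\<close> takes place at time \<open>N - 1 - m\<close>.\<close>

lemma Kac_le:
  assumes F: "aut dyadic_space F" and A: "A \<in> sets dyadic_space"
  shows "(\<Sum>m<N. \<mu> (nonreturn F A m)) \<le> 1"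
proof -
  define B where "B = (\<lambda>m. (F ^^ (N - 1 - m)) -` nonreturn F A m \<inter> \<Omega>)"
  have B: "B m \<in> sets dyadic_space" "\<mu> (B m) = \<mu> (nonreturn F A m)" for m
    unfolding B_def using measure_preimage_funpow[OF F sets_nonreturn[OF F A]] by auto
  have disj: "B m \<inter> B m' = {}" if "m < m'" "m' < N" for m m'
  proof (rule ccontr)
    assume "B m \<inter> B m' \<noteq> {}"
    then obtain x where x: "(F ^^ (N - 1 - m)) x \<in> A" "\<forall>j. 1 \<le> j \<and> j \<le> m' \<longrightarrow> (F ^^ j) ((F ^^ (N - 1 - m')) x) \<notin> A"
      by (auto simp: B_def nonreturn_def)
    have "(F ^^ (m' - m)) ((F ^^ (N - 1 - m')) x) = (F ^^ ((m' - m) + (N - 1 - m'))) x" by (simp only: funpow_add o_apply)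
    also have "(m' - m) + (N - 1 - m') = N - 1 - m" using that by simp
    finally have "(F ^^ (m' - m)) ((F ^^ (N - 1 - m')) x) \<in> A" using x(1) by simp
    moreover have "1 \<le> m' - m \<and> m' - m \<le> m'" using that by auto
    ultimately show False using x(2) by blast
  qed
  have "disjoint_family_on B {..<N}"
    unfolding disjoint_family_on_def
  proof (intro ballI impI)
    fix m n assume "m \<in> {..<N}" "n \<in> {..<N}" "m \<noteq> n"
    then show "B m \<inter> B n = {}" using disj[of m n] disj[of n m] by (cases "m < n") auto
  qed
  then have "(\<Sum>m<N. \<mu> (B m)) = \<mu> (\<Union>m<N. B m)"
    using B by (intro dyadic.finite_measure_finite_Union[symmetric]) auto
  then show ?thesis using B(2) by simp
qed

text \<open>Poincare recurrence from Kac's inequality: \<open>N\<close> times the measure is at most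
  1 for every \<open>N\<close>.\<close>

lemma nonreturn_null:
  assumes F: "aut dyadic_space F" and A: "A \<in> sets dyadic_space"
  shows "(\<Inter>m. nonreturn F A m) \<in> null_sets dyadic_space"
proof -
  let ?W = "\<Inter>m. nonreturn F A m"
  have W: "?W \<in> sets dyadic_space" using sets_nonreturn[OF F A] by (intro sets.countable_INT) auto
  have "real N * \<mu> ?W \<le> 1" for N
  proof -
    have "real N * \<mu> ?W = (\<Sum>m<N. \<mu> ?W)" by simp
    also have "\<dots> \<le> (\<Sum>m<N. \<mu> (nonreturn F A m))"
      using sets_nonreturn[OF F A] by (intro sum_mono dyadic.finite_measure_mono) auto
    also have "\<dots> \<le> 1" by (rule Kac_le[OF F A])
    finally show ?thesis .
  qed
  then have "\<mu> ?W = 0"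
    by (metis ex_less_of_nat_mult linorder_not_le measure_nonneg order_le_less)
  then show ?thesis using W by (intro null_setsI) (simp_all add: dyadic.emeasure_eq_measure)
qed

section \<open>From the normalized measures back to the dyadic one\<close>

lemma mp_bij_image:
  assumes "mp_bij M N \<Psi>" and C: "C \<in> sets M"
  shows "\<Psi> ` C \<in> sets N" "emeasure N (\<Psi> ` C) = emeasure M C"
proof -
  have bij: "bij_betw \<Psi> (space M) (space N)" and inv: "inv_into (space M) \<Psi> \<in> N \<rightarrow>\<^sub>M M"
    and meas: "\<Psi> \<in> M \<rightarrow>\<^sub>M N" and distr: "distr M N \<Psi> = N"
    using assms(1) by (auto simp: mp_bij_def)
  have sub: "C \<subseteq> space M" by (rule sets.sets_into_space[OF C])
  have "\<Psi> ` C = inv_into (space M) \<Psi> -` C \<inter> space N"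
  proof (intro set_eqI iffI)
    fix y assume "y \<in> \<Psi> ` C"
    then obtain x where x: "x \<in> C" "y = \<Psi> x" by blast
    then have "x \<in> space M" using sub by blast
    then show "y \<in> inv_into (space M) \<Psi> -` C \<inter> space N"
      using x bij_betw_inv_into_left[OF bij] bij_betwE[OF bij] by simp
  next
    fix y assume y: "y \<in> inv_into (space M) \<Psi> -` C \<inter> space N"
    then have "y = \<Psi> (inv_into (space M) \<Psi> y)" using bij_betw_inv_into_right[OF bij] by simp
    then show "y \<in> \<Psi> ` C" using y by blast
  qed
  then show 1: "\<Psi> ` C \<in> sets N" using measurable_sets[OF inv C] by simp
  have "\<Psi> -` (\<Psi> ` C) \<inter> space M = C"
    using sub bij_betw_imp_inj_on[OF bij] by (auto dest: inj_onD)
  then show "emeasure N (\<Psi> ` C) = emeasure M C"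
    using emeasure_distr[OF meas 1] distr by simp
qed

lemma induced_measure_facts:
  assumes A: "A \<in> sets dyadic_space" and pos: "0 < \<mu> A"
  shows "space (induced_measure dyadic_space A) = A"
    and "C \<in> sets (induced_measure dyadic_space A) \<longleftrightarrow> C \<subseteq> A \<and> C \<in> sets dyadic_space"
    and "C \<in> sets dyadic_space \<Longrightarrow> C \<subseteq> A \<Longrightarrow>
       emeasure (induced_measure dyadic_space A) C = ennreal (\<mu> C / \<mu> A)"
    and "(AE x in induced_measure dyadic_space A. P x) \<longleftrightarrow> (AE x in dyadic_space. x \<in> A \<longrightarrow> P x)"
proof -
  have sub: "A \<subseteq> \<Omega>" by (rule sets.sets_into_space[OF A])
  show "space (induced_measure dyadic_space A) = A" using sub by (auto simp: induced_measure_def space_restrict_space)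
  show "C \<in> sets (induced_measure dyadic_space A) \<longleftrightarrow> C \<subseteq> A \<and> C \<in> sets dyadic_space"
    unfolding induced_measure_def using A by (subst sets_restrict_space_iff) (auto simp: Int_absorb2[OF sub])
  show "emeasure (induced_measure dyadic_space A) C = ennreal (\<mu> C / \<mu> A)"
    if "C \<in> sets dyadic_space" "C \<subseteq> A"
  proof -
    have "emeasure (induced_measure dyadic_space A) C = emeasure (uniform_measure dyadic_space A) C"
      unfolding induced_measure_def using A that by (intro emeasure_restrict_space) (auto simp: Int_absorb2[OF sub])
    also have "\<dots> = emeasure dyadic_space C / emeasure dyadic_space A"
      using that A by (simp add: emeasure_uniform_measure Int_absorb1)
    also have "\<dots> = ennreal (\<mu> C / \<mu> A)"
      using pos by (simp add: dyadic.emeasure_eq_measure divide_ennreal)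
    finally show ?thesis .
  qed
  have "(AE x in induced_measure dyadic_space A. P x) \<longleftrightarrow> (AE x in uniform_measure dyadic_space A. x \<in> A \<longrightarrow> P x)"
    unfolding induced_measure_def using A by (intro AE_restrict_space_iff) (auto simp: Int_absorb2[OF sub])
  also have "\<dots> \<longleftrightarrow> (AE x in dyadic_space. x \<in> A \<longrightarrow> P x)"
    using pos A by (subst AE_uniform_measure) (auto simp: dyadic.emeasure_eq_measure)
  finally show "(AE x in induced_measure dyadic_space A. P x) \<longleftrightarrow> (AE x in dyadic_space. x \<in> A \<longrightarrow> P x)" .
qed

text \<open>An even equivalence, stated with \<mu> in place of the normalized measures: as
  \<open>\<mu> A = \<mu> B\<close>, the normalizing factors cancel and \<open>\<phi>\<close>
  preserves \<mu>. \<open>Z\<close> is a null set that contains the failures of the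
  conjugacy.\<close>

locale kakutani =
  fixes A B X0 Y0 Z :: "(nat \<Rightarrow> nat) set" and \<phi> :: "(nat \<Rightarrow> nat) \<Rightarrow> nat \<Rightarrow> nat"
  assumes A: "A \<in> sets dyadic_space" and A_pos: "0 < \<mu> A"
    and X0: "X0 \<in> sets dyadic_space" "X0 \<subseteq> A" "A - X0 \<in> null_sets dyadic_space"
    and Y0: "Y0 \<subseteq> B" "Y0 \<in> sets dyadic_space"
    and Z: "Z \<in> null_sets dyadic_space"
    and bij: "bij_betw \<phi> X0 Y0"
    and img: "\<And>C. C \<in> sets dyadic_space \<Longrightarrow> C \<subseteq> X0 \<Longrightarrow>
      \<phi> ` C \<in> sets dyadic_space \<and> \<mu> (\<phi> ` C) = \<mu> C"
    and preimg: "\<And>C. C \<in> sets dyadic_space \<Longrightarrow> C \<subseteq> Y0 \<Longrightarrow>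
      \<phi> -` C \<inter> X0 \<in> sets dyadic_space \<and> \<mu> (\<phi> -` C \<inter> X0) = \<mu> C"
    and conj: "\<And>x. x \<in> X0 \<Longrightarrow> x \<notin> Z \<Longrightarrow> \<phi> (induced_map odomutant A x) = induced_map dyadic_odometer B (\<phi> x)"

lemma evenly_Kakutani_equivalentD:
  assumes "evenly_Kakutani_equivalent dyadic_space odomutant dyadic_space dyadic_odometer"
  shows "\<exists>A B X0 Y0 Z \<phi>. kakutani A B X0 Y0 Z \<phi>"
proof -
  obtain A B where AB: "A \<in> sets dyadic_space" "B \<in> sets dyadic_space" "0 < \<mu> A" "0 < \<mu> B"
      "\<mu> A = \<mu> B"
    and c: "conjugate (induced_measure dyadic_space A) (induced_map odomutant A)
       (induced_measure dyadic_space B) (induced_map dyadic_odometer B)"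
    using assms unfolding evenly_Kakutani_equivalent_def by auto
  let ?MA = "induced_measure dyadic_space A" and ?MB = "induced_measure dyadic_space B"
  obtain X0 Y0 \<phi> where X0: "X0 \<in> sets ?MA" and Y0: "Y0 \<in> sets ?MB" and aeX: "AE x in ?MA. x \<in> X0"
    and mp: "mp_bij (restrict_space ?MA X0) (restrict_space ?MB Y0) \<phi>"
    and ae: "AE x in ?MA. \<phi> (induced_map odomutant A x) = induced_map dyadic_odometer B (\<phi> x)"
    using c unfolding conjugate_def by auto
  note fA = induced_measure_facts[OF AB(1,3)] and fB = induced_measure_facts[OF AB(2,4)]
  have X0': "X0 \<subseteq> A" "X0 \<in> sets dyadic_space" using X0 fA(2) by auto
  have Y0': "Y0 \<subseteq> B" "Y0 \<in> sets dyadic_space" using Y0 fB(2) by auto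
  have spX: "space (restrict_space ?MA X0) = X0" using X0' fA(1) by (auto simp: space_restrict_space)
  have spY: "space (restrict_space ?MB Y0) = Y0" using Y0' fB(1) by (auto simp: space_restrict_space)
  have setX: "C \<in> sets (restrict_space ?MA X0) \<longleftrightarrow> C \<subseteq> X0 \<and> C \<in> sets dyadic_space" for C
    using X0 X0' fA(1,2) by (subst sets_restrict_space_iff) (auto simp: Int_absorb2)
  have setY: "C \<in> sets (restrict_space ?MB Y0) \<longleftrightarrow> C \<subseteq> Y0 \<and> C \<in> sets dyadic_space" for C
    using Y0 Y0' fB(1,2) by (subst sets_restrict_space_iff) (auto simp: Int_absorb2)
  have emX: "emeasure (restrict_space ?MA X0) C = ennreal (\<mu> C / \<mu> A)"
    if "C \<in> sets dyadic_space" "C \<subseteq> X0" for C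
    using that X0 X0' fA(1,3) by (subst emeasure_restrict_space) (auto simp: Int_absorb2)
  have emY: "emeasure (restrict_space ?MB Y0) C = ennreal (\<mu> C / \<mu> A)"
    if "C \<in> sets dyadic_space" "C \<subseteq> Y0" for C
    using that Y0 Y0' fB(1,3) AB(5) by (subst emeasure_restrict_space) (auto simp: Int_absorb2)
  have eq: "r = s" if "ennreal (r / \<mu> A) = ennreal (s / \<mu> A)" "0 \<le> r" "0 \<le> s" for r s
    using that AB(3) by (subst (asm) ennreal_inj) (auto simp: divide_right_mono)
  have bij: "bij_betw \<phi> X0 Y0" using mp spX spY by (simp add: mp_bij_def)
  have img: "\<phi> ` C \<in> sets dyadic_space \<and> \<mu> (\<phi> ` C) = \<mu> C"
    if C: "C \<in> sets dyadic_space" "C \<subseteq> X0" for C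
  proof -
    have C': "C \<in> sets (restrict_space ?MA X0)" using C setX by simp
    have 1: "\<phi> ` C \<subseteq> Y0" "\<phi> ` C \<in> sets dyadic_space" using mp_bij_image(1)[OF mp C'] setY by auto
    have "emeasure (restrict_space ?MB Y0) (\<phi> ` C) = emeasure (restrict_space ?MA X0) C" by (rule mp_bij_image(2)[OF mp C'])
    then have "\<mu> (\<phi> ` C) = \<mu> C"
      unfolding emX[OF C] emY[OF 1(2,1)] by (rule eq) simp_all
    then show ?thesis using 1 by simp
  qed
  have pre: "\<phi> -` C \<inter> X0 \<in> sets dyadic_space \<and> \<mu> (\<phi> -` C \<inter> X0) = \<mu> C"
    if C: "C \<in> sets dyadic_space" "C \<subseteq> Y0" for C
  proof -
    have meas: "\<phi> \<in> restrict_space ?MA X0 \<rightarrow>\<^sub>M restrict_space ?MB Y0" using mp by (simp add: mp_bij_def)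
    have C': "C \<in> sets (restrict_space ?MB Y0)" using C setY by simp
    have "\<phi> -` C \<inter> X0 \<in> sets (restrict_space ?MA X0)" using measurable_sets[OF meas C'] spX by simp
    then have 1: "\<phi> -` C \<inter> X0 \<in> sets dyadic_space" using setX by simp
    have "\<phi> ` (\<phi> -` C \<inter> X0) = C \<inter> \<phi> ` X0" by auto
    also have "\<dots> = C" using C bij_betw_imp_surj_on[OF bij] by auto
    finally show ?thesis using img[OF 1] 1 by simp
  qed
  have aeX': "AE x in dyadic_space. x \<in> A \<longrightarrow> x \<in> X0" using aeX fA(4) by simp
  have null: "A - X0 \<in> null_sets dyadic_space"
  proof -
    have "{x \<in> \<Omega>. \<not> (x \<in> A \<longrightarrow> x \<in> X0)} = A - X0" using sets.sets_into_space[OF AB(1)] by auto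
    then show ?thesis using aeX' AB(1) X0' by (subst (asm) AE_iff_null) (auto intro: sets.Diff)
  qed
  have "AE x in dyadic_space. x \<in> A \<longrightarrow> \<phi> (induced_map odomutant A x) = induced_map dyadic_odometer B (\<phi> x)"
    using ae fA(4) by simp
  then obtain Z where Z: "{x \<in> \<Omega>. \<not> (x \<in> A \<longrightarrow> \<phi> (induced_map odomutant A x) = induced_map dyadic_odometer B (\<phi> x))} \<subseteq> Z"
    "Z \<in> null_sets dyadic_space" by (auto elim!: AE_E)
  have conj: "\<phi> (induced_map odomutant A x) = induced_map dyadic_odometer B (\<phi> x)" if "x \<in> X0" "x \<notin> Z" for x
    using Z(1) that X0'(1) sets.sets_into_space[OF AB(1)] by auto
  have "kakutani A B X0 Y0 Z \<phi>"
    by unfold_locales (use AB X0' null Y0' Z(2) bij img pre conj in auto)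
  then show ?thesis by blast
qed

section \<open>Good points and their excursions\<close>

context kakutani
begin

definition bad :: "(nat \<Rightarrow> nat) set" where
  "bad = (A - X0) \<union> Z \<union> (\<Inter>m. nonreturn odomutant A m) \<union> (A - nonconst)"

text \<open>Since the whole forward orbit avoids \<open>bad\<close>, the set is stable under the
  return map to \<open>A\<close>, and recurrence and conjugacy can be used at every return, not just
  almost everywhere.\<close>

definition good :: "(nat \<Rightarrow> nat) set" where
  "good = X0 - (\<Union>m. (odomutant ^^ m) -` bad \<inter> \<Omega>)"

lemma bad_null: "bad \<in> null_sets dyadic_space"
proof -
  have "A - nonconst \<in> null_sets dyadic_space"
  proof (rule null_sets_subset)
    show "{x \<in> \<Omega>. x \<notin> nonconst} \<in> null_sets dyadic_space"
      using AE_nonconst by (subst (asm) AE_iff_null) auto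
    show "A - nonconst \<subseteq> {x \<in> \<Omega>. x \<notin> nonconst}"
      using sets.sets_into_space[OF A] by auto
  qed (use A in simp)
  then show ?thesis
    unfolding bad_def using X0 Z nonreturn_null[OF aut_odomutant A] by (intro null_sets.Un)
qed

lemma good_null: "(\<Union>m. (odomutant ^^ m) -` bad \<inter> \<Omega>) \<in> null_sets dyadic_space"
proof (rule null_sets_UN')
  fix m
  have "bad \<in> sets dyadic_space" "\<mu> bad = 0" using bad_null by (auto simp: measure_def)
  then show "(odomutant ^^ m) -` bad \<inter> \<Omega> \<in> null_sets dyadic_space"
    using measure_preimage_funpow[OF aut_odomutant, of bad m] by (intro null_setsI) (auto simp: dyadic.emeasure_eq_measure)
qed simp

lemma sets_good [measurable]: "good \<in> sets dyadic_space"
  unfolding good_def using X0 good_null by auto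

lemma good_sub: "good \<subseteq> X0" "good \<subseteq> A" "good \<subseteq> \<Omega>"
  using X0 sets.sets_into_space[OF A] by (auto simp: good_def)

lemma measure_good: "\<mu> good = \<mu> A"
proof -
  have "\<mu> good = \<mu> X0"
    unfolding good_def using X0(1) good_null by (rule measure_Diff_null_set[OF _ _])
  also have "\<dots> = \<mu> (A - (A - X0))"
    using X0(2) by (simp add: double_diff)
  also have "\<dots> = \<mu> A" using A X0(3) by (intro measure_Diff_null_set)
  finally show ?thesis .
qed

lemma good_iter:
  assumes "x \<in> good"
  shows "(odomutant ^^ m) x \<notin> bad"
  using assms good_sub by (auto simp: good_def)

lemma good_nonconst: "x \<in> good \<Longrightarrow> x \<in> nonconst"
  using good_iter[of x 0] good_sub by (auto simp: bad_def)

abbreviation ret :: "(nat \<Rightarrow> nat) \<Rightarrow> nat" where "ret \<equiv> return_time odomutant A"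

lemma ret:
  assumes x: "x \<in> good"
  shows "1 \<le> ret x" "(odomutant ^^ ret x) x \<in> A" "\<And>j. 1 \<le> j \<Longrightarrow> j < ret x \<Longrightarrow> (odomutant ^^ j) x \<notin> A"
proof -
  have "x \<notin> (\<Inter>m. nonreturn odomutant A m)" using good_iter[OF x, of 0] by (simp add: bad_def)
  then have ne: "{k. 1 \<le> k \<and> (odomutant ^^ k) x \<in> A} \<noteq> {}" using x good_sub by (auto simp: nonreturn_def)
  have "ret x \<in> {k. 1 \<le> k \<and> (odomutant ^^ k) x \<in> A}" unfolding return_time_def by (rule Inf_nat_def1[OF ne])
  then show "1 \<le> ret x" "(odomutant ^^ ret x) x \<in> A" by auto
  show "(odomutant ^^ j) x \<notin> A" if "1 \<le> j" "j < ret x" for j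
  proof
    assume "(odomutant ^^ j) x \<in> A"
    then have "ret x \<le> j" unfolding return_time_def using that(1) by (intro cInf_lower) auto
    then show False using that(2) by simp
  qed
qed

lemma ret_eqI:
  assumes x: "x \<in> good" and "1 \<le> k" "(odomutant ^^ k) x \<in> A" "\<And>j. 1 \<le> j \<Longrightarrow> j < k \<Longrightarrow> (odomutant ^^ j) x \<notin> A"
  shows "ret x = k"
  using ret[OF x] assms by (metis linorder_neqE_nat)

lemma good_step:
  assumes x: "x \<in> good"
  shows "(odomutant ^^ ret x) x \<in> good" "\<phi> ((odomutant ^^ ret x) x) = induced_map dyadic_odometer B (\<phi> x)"
proof -
  have "(odomutant ^^ ret x) x \<in> X0" using ret(2)[OF x] good_iter[OF x, of "ret x"] by (auto simp: bad_def)
  moreover have "(odomutant ^^ m) ((odomutant ^^ ret x) x) \<notin> bad" for m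
    using good_iter[OF x, of "m + ret x"] by (simp add: funpow_add)
  ultimately show "(odomutant ^^ ret x) x \<in> good" by (simp add: good_def)
  have "x \<in> X0" "x \<notin> Z" using x good_sub good_iter[OF x, of 0] by (auto simp: bad_def)
  then show "\<phi> ((odomutant ^^ ret x) x) = induced_map dyadic_odometer B (\<phi> x)"
    using conj[of x] by (simp add: induced_map_def)
qed

abbreviation name :: "(nat \<Rightarrow> nat) \<Rightarrow> nat \<Rightarrow> nat list" where
  "name x l \<equiv> map (\<lambda>j. btype 0 ((odomutant ^^ j) x)) [0..<l]"

text \<open>The stretch of the name of a good point up to its return to \<open>A\<close>,
  transported by \<open>\<phi>\<close>. Off \<open>B\<close> the word is empty, so the time that the
  odometer spends there adds nothing.\<close>

definition exc :: "(nat \<Rightarrow> nat) \<Rightarrow> nat list" where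
  "exc y = (if y \<in> \<phi> ` good then name (inv_into X0 \<phi> y) (ret (inv_into X0 \<phi> y)) else [])"

lemma exc_phi: "x \<in> good \<Longrightarrow> exc (\<phi> x) = name x (ret x)"
  using bij_betw_inv_into_left[OF bij, of x] good_sub by (auto simp: exc_def)

lemma exc_off: "y \<notin> B \<Longrightarrow> exc y = []"
proof -
  have "\<phi> ` good \<subseteq> B" using bij_betw_imp_surj_on[OF bij] good_sub Y0 by blast
  then show "y \<notin> B \<Longrightarrow> exc y = []" by (auto simp: exc_def)
qed

lemma name_append: "name x (l + l') = name x l @ name ((odomutant ^^ l) x) l'"
proof -
  have "[0..<l + l'] = [0..<l] @ [l..<l + l']" by (rule upt_add_eq_append) simp
  moreover have "map (\<lambda>j. btype 0 ((odomutant ^^ j) x)) [l..<l + l'] = name ((odomutant ^^ l) x) l'"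
    by (rule nth_equalityI) (auto simp: funpow_add add.commute[of l])
  ultimately show ?thesis by simp
qed

text \<open>Along the odometer orbit of \<open>\<phi> x\<close> one reads the excursions of \<open>x\<close> one after the other.\<close>

lemma concat_exc:
  assumes "x \<in> good"
  shows "\<exists>l. concat (map (\<lambda>t. exc ((dyadic_odometer ^^ t) (\<phi> x))) [0..<M]) = name x l"
  using assms
proof (induction M arbitrary: x rule: less_induct)
  case (less M)
  let ?y = "\<phi> x"
  show ?case
  proof (cases "M = 0")
    case True
    then show ?thesis by (intro exI[of _ 0]) simp
  next
    case M: False
    have skip: "concat (map (\<lambda>t. exc ((dyadic_odometer ^^ t) ?y)) [1..<m]) = []"
      if "\<And>t. 1 \<le> t \<Longrightarrow> t < m \<Longrightarrow> (dyadic_odometer ^^ t) ?y \<notin> B" for m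
      using that exc_off by auto
    have hd: "[0..<m] = 0 # [1..<m]" if "m \<ge> 1" for m using that by (simp add: upt_conv_Cons)
    show ?thesis
    proof (cases "\<exists>t. 1 \<le> t \<and> t < M \<and> (dyadic_odometer ^^ t) ?y \<in> B")
      case False
      then have "concat (map (\<lambda>t. exc ((dyadic_odometer ^^ t) ?y)) [1..<M]) = []" by (intro skip) auto
      then have "concat (map (\<lambda>t. exc ((dyadic_odometer ^^ t) ?y)) [0..<M]) = name x (ret x)"
        using hd[of M] M exc_phi[OF less.prems] by simp
      then show ?thesis by blast
    next
      case True
      let ?r = "return_time dyadic_odometer B ?y"
      from True obtain t where t: "1 \<le> t" "t < M" "(dyadic_odometer ^^ t) ?y \<in> B" by blast
      then have ne: "{k. 1 \<le> k \<and> (dyadic_odometer ^^ k) ?y \<in> B} \<noteq> {}" by blast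
      have "?r \<in> {k. 1 \<le> k \<and> (dyadic_odometer ^^ k) ?y \<in> B}" unfolding return_time_def by (rule Inf_nat_def1[OF ne])
      then have r1: "1 \<le> ?r" by simp
      have rle: "?r \<le> k" if "1 \<le> k" "(dyadic_odometer ^^ k) ?y \<in> B" for k
        unfolding return_time_def using that by (intro cInf_lower) auto
      have rM: "?r < M" using rle[OF t(1,3)] t(2) by simp
      \<comment> \<open>By the conjugacy, the return of \<open>x\<close> to \<open>A\<close> is
        mapped to the return of \<open>\<phi> x\<close> to \<open>B\<close>; the induction restarts
        there.\<close>
      define x' where "x' = (odomutant ^^ ret x) x"
      have x': "x' \<in> good" "\<phi> x' = (dyadic_odometer ^^ ?r) ?y"
        using good_step[OF less.prems] by (simp_all add: x'_def induced_map_def)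
      have "M - ?r < M" using r1 rM by simp
      from less.IH[OF this x'(1)] obtain l where
        l: "concat (map (\<lambda>t. exc ((dyadic_odometer ^^ t) (\<phi> x'))) [0..<M - ?r]) = name x' l" by blast
      have "map (\<lambda>t. exc ((dyadic_odometer ^^ t) ?y)) [?r..<M] = map (\<lambda>t. exc ((dyadic_odometer ^^ t) (\<phi> x'))) [0..<M - ?r]"
        by (rule nth_equalityI) (auto simp: x'(2) funpow_add add.commute[of ?r])
      moreover have "concat (map (\<lambda>t. exc ((dyadic_odometer ^^ t) ?y)) [1..<?r]) = []"
        using rle by (intro skip) (meson not_le)
      moreover have "[0..<M] = 0 # [1..<?r] @ [?r..<M]"
        using hd[of M] M upt_add_eq_append[of 1 ?r "M - ?r"] r1 rM by simp
      ultimately have "concat (map (\<lambda>t. exc ((dyadic_odometer ^^ t) ?y)) [0..<M]) = name x (ret x) @ name x' l"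
        using exc_phi[OF less.prems] l by simp
      also have "\<dots> = name x (ret x + l)" unfolding name_append x'_def ..
      finally show ?thesis by blast
    qed
  qed
qed

end

section \<open>Integrals along orbits and the top of a tower\<close>

lemma distr_funpow:
  assumes F: "aut dyadic_space F"
  shows "distr dyadic_space dyadic_space (F ^^ n) = dyadic_space"
proof (rule measure_eqI)
  have meas: "F ^^ n \<in> dyadic_space \<rightarrow>\<^sub>M dyadic_space"
    using F by (intro measurable_funpow) (simp add: aut_def mp_bij_def)
  fix C assume "C \<in> sets (distr dyadic_space dyadic_space (F ^^ n))"
  then have C: "C \<in> sets dyadic_space" by simp
  then show "emeasure (distr dyadic_space dyadic_space (F ^^ n)) C = emeasure dyadic_space C"
    using measure_preimage_funpow[OF F C, of n] by (simp add: emeasure_distr[OF meas] dyadic.emeasure_eq_measure)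
qed simp

lemma integral_funpow:
  fixes u :: "(nat \<Rightarrow> nat) \<Rightarrow> real"
  assumes F: "aut dyadic_space F" and u: "integrable dyadic_space u"
  shows "integrable dyadic_space (\<lambda>x. u ((F ^^ n) x))"
    "(\<integral>x. u ((F ^^ n) x) \<partial>dyadic_space) = (\<integral>x. u x \<partial>dyadic_space)"
proof -
  have meas: "F ^^ n \<in> dyadic_space \<rightarrow>\<^sub>M dyadic_space"
    using F by (intro measurable_funpow) (simp add: aut_def mp_bij_def)
  have um: "u \<in> borel_measurable dyadic_space" using u by simp
  show "integrable dyadic_space (\<lambda>x. u ((F ^^ n) x))"
    using integrable_distr[OF meas, of u] u distr_funpow[OF F, of n] by simp
  show "(\<integral>x. u ((F ^^ n) x) \<partial>dyadic_space) = (\<integral>x. u x \<partial>dyadic_space)"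
    using integral_distr[OF meas um] distr_funpow[OF F, of n] by simp
qed

text \<open>Counts the levels of the tower, each of measure \<open>1 / 2 ^ blen n\<close>. Names
  read from the remaining points have room in their block.\<close>

lemma measure_pos_gt:
  assumes \<theta>: "0 \<le> \<theta>" "\<theta> \<le> 1"
  shows "\<mu> {x \<in> nonconst. real (pos n x) > (1 - \<theta>) * 2 ^ blen n} \<le> \<theta>"
proof -
  let ?H = "2 ^ blen n :: nat"
  define P where "P = {p. p < ?H \<and> real p > (1 - \<theta>) * 2 ^ blen n}"
  have P: "finite P" by (rule finite_subset[of _ "{..<?H}"]) (auto simp: P_def)
  define f where "f = nat \<lfloor>(1 - \<theta>) * 2 ^ blen n\<rfloor>"
  have f: "(1 - \<theta>) * 2 ^ blen n < real f + 1" "real f \<le> (1 - \<theta>) * 2 ^ blen n"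
    using \<theta> by (auto simp: f_def)
  have fH: "f \<le> ?H"
  proof -
    have "(1 - \<theta>) * 2 ^ blen n \<le> 1 * 2 ^ blen n" using \<theta> by (intro mult_right_mono) auto
    then have "real f \<le> 2 ^ blen n" using f(2) by linarith
    then show ?thesis by simp
  qed
  have "P \<subseteq> {f<..<?H}"
  proof
    fix p assume "p \<in> P"
    then have "p < ?H" "real f < real p" using f(2) by (auto simp: P_def)
    then show "p \<in> {f<..<?H}" by simp
  qed
  then have "card P \<le> card {f<..<?H}" by (intro card_mono) auto
  then have "card P \<le> ?H - Suc f" by simp
  then have "real (card P) \<le> real (?H - Suc f)" by (rule of_nat_mono)
  also have "\<dots> \<le> \<theta> * 2 ^ blen n"
  proof (cases "Suc f \<le> ?H")
    case True
    then have "real (?H - Suc f) = 2 ^ blen n - (real f + 1)" by (simp add: of_nat_diff)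
    then show ?thesis using f(1) by (simp add: left_diff_distrib)
  qed (use \<theta> in simp)
  finally have card: "real (card P) \<le> \<theta> * 2 ^ blen n" .
  have A: "{x \<in> nonconst. pos n x = p} \<in> sets dyadic_space" for p
  proof -
    have "{x \<in> nonconst. pos n x = p} = {x \<in> \<Omega>. x \<in> nonconst \<and> pos n x = p}" by (auto simp: nonconst_in)
    then show ?thesis by simp
  qed
  have "{x \<in> nonconst. real (pos n x) > (1 - \<theta>) * 2 ^ blen n} = (\<Union>p\<in>P. {x \<in> nonconst. pos n x = p})"
    using pos_less[OF nonconst_in] by (auto simp: P_def)
  then have "\<mu> {x \<in> nonconst. real (pos n x) > (1 - \<theta>) * 2 ^ blen n} \<le> (\<Sum>p\<in>P. \<mu> {x \<in> nonconst. pos n x = p})"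
    using measure_UNION_le[OF P A] by simp
  also have "\<dots> = (\<Sum>p\<in>P. 1 / 2 ^ blen n)" by (intro sum.cong refl measure_pos) (simp add: P_def)
  also have "\<dots> = card P / 2 ^ blen n" by simp
  also have "\<dots> \<le> \<theta>" using card by (simp add: divide_le_eq)
  finally show ?thesis .
qed

section \<open>The excursion as an integrable function\<close>

context kakutani
begin

lemma sets_ret: "{x \<in> good. ret x = k} \<in> sets dyadic_space"
proof (cases "k = 0")
  case True
  then have "{x \<in> good. ret x = k} = {}" using ret(1) by fastforce
  then show ?thesis by (simp only: sets.empty_sets)
next
  case False
  have "{x \<in> good. ret x = k} = good \<inter> (nonreturn odomutant A (k - 1) \<inter> ((odomutant ^^ k) -` A \<inter> \<Omega>))"
  proof (intro set_eqI iffI)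
    fix x assume x: "x \<in> {x \<in> good. ret x = k}"
    then have xg: "x \<in> good" and k: "ret x = k" by auto
    have "x \<in> nonreturn odomutant A (k - 1)"
      unfolding nonreturn_def using ret(3)[OF xg] k xg good_sub by auto
    then show "x \<in> good \<inter> (nonreturn odomutant A (k - 1) \<inter> ((odomutant ^^ k) -` A \<inter> \<Omega>))"
      using ret(2)[OF xg] k xg good_sub by auto
  next
    fix x assume x: "x \<in> good \<inter> (nonreturn odomutant A (k - 1) \<inter> ((odomutant ^^ k) -` A \<inter> \<Omega>))"
    then have "ret x = k" using False by (intro ret_eqI) (auto simp: nonreturn_def)
    then show "x \<in> {x \<in> good. ret x = k}" using x by simp
  qed
  also have "\<dots> \<in> sets dyadic_space"
    using sets_good sets_nonreturn[OF aut_odomutant A] measure_preimage_funpow[OF aut_odomutant A] by blast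
  finally show ?thesis .
qed

lemma measurable_btype: "btype n \<in> dyadic_space \<rightarrow>\<^sub>M count_space UNIV"
  unfolding btype_def[abs_def] by simp

lemma sets_exc: "{y \<in> \<Omega>. exc y = w} \<in> sets dyadic_space"
proof -
  define C where "C = {x \<in> good. name x (ret x) = w}"
  have C: "C \<in> sets dyadic_space"
  proof -
    have "C = {x \<in> good. ret x = length w} \<inter> {x \<in> \<Omega>. \<forall>j<length w. btype 0 ((odomutant ^^ j) x) = w ! j}"
      using good_sub by (auto simp: C_def list_eq_iff_nth_eq)
    also have "\<dots> \<in> sets dyadic_space"
    proof (intro sets.Int sets_ret)
      have [measurable]: "odomutant ^^ j \<in> dyadic_space \<rightarrow>\<^sub>M dyadic_space" for j by (rule measurable_funpow) simp
      note [measurable] = measurable_btype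
      show "{x \<in> \<Omega>. \<forall>j<length w. btype 0 ((odomutant ^^ j) x) = w ! j} \<in> sets dyadic_space" by measurable
    qed
    finally show ?thesis .
  qed
  have sub: "C \<subseteq> X0" using good_sub by (auto simp: C_def)
  have im: "\<phi> ` C \<in> sets dyadic_space" "\<phi> ` good \<in> sets dyadic_space"
    using img[OF C sub] img[OF sets_good good_sub(1)] by auto
  have "{y \<in> \<Omega>. exc y = w} = \<phi> ` C \<union> (if w = [] then \<Omega> - \<phi> ` good else {})"
  proof (intro set_eqI iffI)
    fix y assume y: "y \<in> {y \<in> \<Omega>. exc y = w}"
    show "y \<in> \<phi> ` C \<union> (if w = [] then \<Omega> - \<phi> ` good else {})"
    proof (cases "y \<in> \<phi> ` good")
      case True
      then obtain x where x: "x \<in> good" "y = \<phi> x" by blast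
      then have "x \<in> C" using y exc_phi[OF x(1)] by (simp add: C_def)
      then show ?thesis using x by blast
    next
      case False
      then show ?thesis using y by (auto simp: exc_def)
    qed
  next
    fix y assume y: "y \<in> \<phi> ` C \<union> (if w = [] then \<Omega> - \<phi> ` good else {})"
    show "y \<in> {y \<in> \<Omega>. exc y = w}"
    proof (cases "y \<in> \<phi> ` C")
      case True
      then obtain x where x: "x \<in> good" "y = \<phi> x" "name x (ret x) = w" by (auto simp: C_def)
      moreover have "y \<in> \<Omega>" using True sets.sets_into_space[OF im(1)] by blast
      ultimately show ?thesis using exc_phi[OF x(1)] by simp
    next
      case False
      then show ?thesis using y by (auto simp: exc_def split: if_splits)
    qed
  qed
  then show ?thesis using im by auto
qed

lemma measurable_exc: "exc \<in> dyadic_space \<rightarrow>\<^sub>M count_space UNIV"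
proof -
  have "exc -` {w} \<inter> \<Omega> = {y \<in> \<Omega>. exc y = w}" for w by auto
  then show ?thesis using sets_exc by (subst measurable_count_space_eq2_countable) auto
qed

lemma measure_exc_gt: "\<mu> {y \<in> \<Omega>. m < length (exc y)} \<le> \<mu> (nonreturn odomutant A m)"
proof -
  let ?C = "good \<inter> nonreturn odomutant A m"
  have C: "?C \<in> sets dyadic_space" "?C \<subseteq> X0" using sets_nonreturn[OF aut_odomutant A] good_sub by auto
  have "{y \<in> \<Omega>. m < length (exc y)} \<subseteq> \<phi> ` ?C"
  proof
    fix y assume "y \<in> {y \<in> \<Omega>. m < length (exc y)}"
    then have y: "m < length (exc y)" by simp
    then have "y \<in> \<phi> ` good" by (auto simp: exc_def split: if_splits)
    then obtain x where x: "x \<in> good" "y = \<phi> x" by blast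
    then have "m < ret x" using y exc_phi[OF x(1)] by simp
    then have "x \<in> nonreturn odomutant A m"
      unfolding nonreturn_def using ret(3)[OF x(1)] x good_sub by auto
    then show "y \<in> \<phi> ` ?C" using x by blast
  qed
  then have "\<mu> {y \<in> \<Omega>. m < length (exc y)} \<le> \<mu> (\<phi> ` ?C)"
    using img[OF C] by (intro dyadic.finite_measure_mono) auto
  also have "\<dots> = \<mu> ?C" using img[OF C] by simp
  also have "\<dots> \<le> \<mu> (nonreturn odomutant A m)"
    using sets_nonreturn[OF aut_odomutant A] by (intro dyadic.finite_measure_mono) auto
  finally show ?thesis .
qed

text \<open>The integral is the sum over \<open>m\<close> of the measures of the sets where the
  length exceeds \<open>m\<close>, and Kac's inequality bounds this sum by 1.\<close>

lemma integrable_exc: "integrable dyadic_space (\<lambda>y. real (length (exc y)))"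
proof (rule integrableI_bounded)
  have meas: "(\<lambda>y. length (exc y)) \<in> dyadic_space \<rightarrow>\<^sub>M count_space UNIV"
    by (rule measurable_compose[OF measurable_exc]) simp
  show "(\<lambda>y. real (length (exc y))) \<in> borel_measurable dyadic_space"
    by (rule measurable_compose[OF measurable_exc]) simp
  have "(\<integral>\<^sup>+ y. ennreal (norm (real (length (exc y)))) \<partial>dyadic_space) = (\<integral>\<^sup>+ y. of_nat (length (exc y)) \<partial>dyadic_space)"
    by (simp add: ennreal_of_nat_eq_real_of_nat)
  also have "\<dots> = (\<Sum>m. emeasure dyadic_space {y \<in> \<Omega>. m < length (exc y)})"
    by (rule nn_integral_nat_function[OF meas])
  also have "\<dots> \<le> 1"
  proof (rule suminf_le_const)
    fix N
    have "(\<Sum>m<N. emeasure dyadic_space {y \<in> \<Omega>. m < length (exc y)})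
      = ennreal (\<Sum>m<N. \<mu> {y \<in> \<Omega>. m < length (exc y)})"
      by (simp add: dyadic.emeasure_eq_measure sum_ennreal)
    also have "\<dots> \<le> ennreal 1"
    proof (rule ennreal_leI)
      have "(\<Sum>m<N. \<mu> {y \<in> \<Omega>. m < length (exc y)}) \<le> (\<Sum>m<N. \<mu> (nonreturn odomutant A m))"
        by (intro sum_mono measure_exc_gt)
      also have "\<dots> \<le> 1" by (rule Kac_le[OF aut_odomutant A])
      finally show "(\<Sum>m<N. \<mu> {y \<in> \<Omega>. m < length (exc y)}) \<le> 1" .
    qed
    finally show "(\<Sum>m<N. emeasure dyadic_space {y \<in> \<Omega>. m < length (exc y)}) \<le> 1" by simp
  qed auto
  also have "1 < (\<infinity> :: ennreal)" by simp
  finally show "(\<integral>\<^sup>+ y. ennreal (norm (real (length (exc y)))) \<partial>dyadic_space) < \<infinity>" .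
qed

text \<open>An excursion from a good point has length at least 1, and \<open>\<phi>\<close> carries
  the good points to a set of measure \<mu> A.\<close>

lemma integral_exc_ge: "\<mu> A \<le> (\<integral>y. real (length (exc y)) \<partial>dyadic_space)"
proof -
  have im: "\<phi> ` good \<in> sets dyadic_space" "\<mu> (\<phi> ` good) = \<mu> A"
    using img[OF sets_good good_sub(1)] measure_good by auto
  have int: "integrable dyadic_space (indicator (\<phi> ` good) :: _ \<Rightarrow> real)"
    using im by (intro integrable_real_indicator) (auto simp: dyadic.emeasure_eq_measure)
  have "\<mu> A = (\<integral>y. indicator (\<phi> ` good) y \<partial>dyadic_space)"
    using im sets.sets_into_space[OF im(1)] by (simp add: Int_absorb2)
  also have "\<dots> \<le> (\<integral>y. real (length (exc y)) \<partial>dyadic_space)"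
  proof (rule integral_mono[OF int integrable_exc])
    fix y
    show "indicator (\<phi> ` good) y \<le> real (length (exc y))"
    proof (cases "y \<in> \<phi> ` good")
      case True
      then obtain x where x: "x \<in> good" "y = \<phi> x" by blast
      then show ?thesis using exc_phi[OF x(1)] ret(1)[OF x(1)] True by simp
    qed simp
  qed
  finally show ?thesis .
qed

lemma exc_letters: "set (exc y) \<subseteq> {..<2 ^ 8}"
proof -
  have "btype 0 ((odomutant ^^ j) x) < 2 ^ 8" if "x \<in> good" for x j
    using btype_less[OF aut_funpow_in[OF aut_odomutant], of x 0 j] that good_sub by auto
  moreover have "inv_into X0 \<phi> y \<in> good" if "y \<in> \<phi> ` good"
    using that bij_betw_inv_into_left[OF bij] good_sub by auto
  ultimately show ?thesis by (auto simp: exc_def)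
qed

text \<open>Long excursions are cut off at a small cost by dominated convergence; finitely many
  words remain, and these are approximated by a function of \<open>l\<close> bits. \<open>D\<close>
  is the price of a mismatch in \<open>subseq_concat_common\<close>.\<close>

lemma exc_approx:
  assumes "\<eta> > 0"
  shows "\<exists>l G. let D = (\<lambda>y. if exc y = G (val l y) then 0 else length (exc y) + length (G (val l y))) in
    integrable dyadic_space (\<lambda>y. real (D y)) \<and> (\<integral>y. real (D y) \<partial>dyadic_space) < \<eta>"
proof -
  let ?e = "\<lambda>y. real (length (exc y))"
  define cut where "cut = (\<lambda>R y. if R < length (exc y) then ?e y else 0)"
  have cut_meas: "cut R \<in> borel_measurable dyadic_space" for R
    unfolding cut_def by (rule measurable_compose[OF measurable_exc, of "\<lambda>w. if R < length w then real (length w) else 0"]) simp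
  have cut_int: "integrable dyadic_space (cut R)" for R
    by (rule Bochner_Integration.integrable_bound[OF integrable_exc cut_meas]) (auto simp: cut_def)
  have "(\<lambda>R. \<integral>y. cut R y \<partial>dyadic_space) \<longlonglongrightarrow> (\<integral>y. 0 \<partial>dyadic_space)"
  proof (rule integral_dominated_convergence[where w = ?e])
    show "AE y in dyadic_space. (\<lambda>R. cut R y) \<longlonglongrightarrow> 0"
    proof (rule AE_I2)
      fix y
      have "eventually (\<lambda>R. cut R y = 0) sequentially"
        using eventually_ge_at_top[of "length (exc y)"] by eventually_elim (simp add: cut_def)
      then show "(\<lambda>R. cut R y) \<longlonglongrightarrow> 0" by (rule tendsto_eventually)
    qed
    show "AE y in dyadic_space. norm (cut R y) \<le> ?e y" for R by (auto simp: cut_def)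
  qed (use cut_meas integrable_exc in auto)
  then have "eventually (\<lambda>R. (\<integral>y. cut R y \<partial>dyadic_space) < \<eta> / 4) sequentially"
    using assms by (intro order_tendstoD(2)) auto
  then obtain R where R: "(\<integral>y. cut R y \<partial>dyadic_space) < \<eta> / 4"
    by (auto simp: eventually_sequentially)
  define F where "F = {w :: nat list. set w \<subseteq> {..<2 ^ 8} \<and> length w \<le> R}"
  have F: "finite F" unfolding F_def by (rule finite_lists_length_le) simp
  define g where "g = (\<lambda>y. if length (exc y) \<le> R then exc y else [])"
  have g_sets: "{y \<in> \<Omega>. g y = w} \<in> sets dyadic_space" for w
  proof -
    have "g \<in> dyadic_space \<rightarrow>\<^sub>M count_space UNIV"
      unfolding g_def by (rule measurable_compose[OF measurable_exc, of "\<lambda>w. if length w \<le> R then w else []"]) simp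
    from measurable_sets[OF this, of "{w}"] have "g -` {w} \<inter> \<Omega> \<in> sets dyadic_space" by simp
    moreover have "g -` {w} \<inter> \<Omega> = {y \<in> \<Omega>. g y = w}" by auto
    ultimately show ?thesis by simp
  qed
  have gF: "g y \<in> F" for y using exc_letters[of y] by (auto simp: g_def F_def)
  \<comment> \<open>Makes \<open>2 * R * \<delta>\<close> at most \<eta> / 2; the other half pays
    for twice the cut-off part.\<close>
  define \<delta> where "\<delta> = \<eta> / (4 * (real R + 1))"
  have \<delta>: "\<delta> > 0" using assms by (simp add: \<delta>_def add_nonneg_pos)
  obtain l G where G: "\<forall>v. G v \<in> F" and lG: "\<mu> {y \<in> \<Omega>. g y \<noteq> G (val l y)} < \<delta>"
    using cylinder_fun_approx[OF F gF g_sets \<delta>] by (elim exE conjE)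
  define D where "D = (\<lambda>y. if exc y = G (val l y) then 0 else length (exc y) + length (G (val l y)))"
  let ?E = "{y \<in> \<Omega>. g y \<noteq> G (val l y)}"
  have gG_meas: "?E \<in> sets dyadic_space"
  proof -
    have "?E = \<Omega> - (\<Union>w\<in>F. {y \<in> \<Omega>. g y = w} \<inter> {y \<in> \<Omega>. G (val l y) = w})"
      using G by auto
    also have "\<dots> \<in> sets dyadic_space"
    proof (intro sets.Diff sets.top sets.finite_UN F sets.Int g_sets)
      fix w
      have "{y \<in> \<Omega>. G (val l y) = w} = {y \<in> \<Omega>. val l y \<in> {v. G v = w}}" by simp
      then show "{y \<in> \<Omega>. G (val l y) = w} \<in> sets dyadic_space" by simp
    qed
    finally show ?thesis .
  qed
  have D_meas: "(\<lambda>y. real (D y)) \<in> borel_measurable dyadic_space"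
  proof -
    have "(\<lambda>y. (\<lambda>w. real (if w = G (val l y) then 0 else length w + length (G (val l y)))) (exc y)) \<in> borel_measurable dyadic_space"
    proof (rule measurable_compose_countable[OF _ measurable_exc])
      fix w :: "nat list"
      show "(\<lambda>y. real (if w = G (val l y) then 0 else length w + length (G (val l y)))) \<in> borel_measurable dyadic_space"
        by (rule measurable_compose[OF measurable_bits_val, of "\<lambda>v. real (if w = G v then 0 else length w + length (G v))"]) simp
    qed
    then show ?thesis by (simp only: D_def)
  qed
  \<comment> \<open>For a short excursion a mismatch costs at most \<open>2 * R\<close>. A long one
    is longer than the word \<open>G\<close>, so it costs at most twice its own length.\<close>
  have bd: "real (D y) \<le> 2 * cut R y + 2 * real R * indicator ?E y" if y: "y \<in> \<Omega>" for y
  proof -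
    have lG': "length (G (val l y)) \<le> R" using G by (auto simp: F_def)
    show ?thesis
    proof (cases "length (exc y) \<le> R")
      case True
      then have "g y = exc y" by (simp add: g_def)
      then have "real (D y) \<le> 2 * real R * indicator ?E y" using True lG' y by (auto simp: D_def indicator_def)
      then show ?thesis using True by (simp add: cut_def)
    next
      case False
      then have "real (D y) \<le> 2 * cut R y" using lG' by (auto simp: D_def cut_def)
      moreover have "0 \<le> 2 * real R * (indicator ?E y :: real)" by simp
      ultimately show ?thesis by linarith
    qed
  qed
  have E_int: "integrable dyadic_space (indicator ?E :: _ \<Rightarrow> real)"
    using gG_meas by (intro integrable_real_indicator) (auto simp: dyadic.emeasure_eq_measure)
  have bd_int: "integrable dyadic_space (\<lambda>y. 2 * cut R y + 2 * real R * indicator ?E y)"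
    using cut_int[of R] E_int by (intro Bochner_Integration.integrable_add integrable_mult_right) auto
  have D_int: "integrable dyadic_space (\<lambda>y. real (D y))"
    by (rule Bochner_Integration.integrable_bound[OF bd_int D_meas])
      (use bd in \<open>auto intro!: AE_I2 order_trans[OF _ abs_ge_self]\<close>)
  have "(\<integral>y. real (D y) \<partial>dyadic_space) \<le> (\<integral>y. 2 * cut R y + 2 * real R * indicator ?E y \<partial>dyadic_space)"
    by (rule integral_mono[OF D_int bd_int bd])
  also have "\<dots> = 2 * (\<integral>y. cut R y \<partial>dyadic_space) + 2 * real R * \<mu> ?E"
  proof -
    have "(\<integral>y. 2 * cut R y + 2 * real R * indicator ?E y \<partial>dyadic_space)
        = (\<integral>y. 2 * cut R y \<partial>dyadic_space) + (\<integral>y. 2 * real R * indicator ?E y \<partial>dyadic_space)"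
      using cut_int[of R] E_int by (intro Bochner_Integration.integral_add integrable_mult_right) auto
    moreover have "?E \<inter> \<Omega> = ?E" by auto
    then have "(\<integral>y. indicator ?E y \<partial>dyadic_space) = \<mu> ?E"
      using Bochner_Integration.integral_indicator[of dyadic_space ?E] by (simp only:)
    ultimately show ?thesis by (simp only: integral_mult_right_zero)
  qed
  also have "\<dots> < \<eta>"
  proof -
    have "2 * real R * \<mu> ?E \<le> 2 * real R * \<delta>" using lG by (intro mult_left_mono) auto
    also have "\<dots> \<le> \<eta> / 2" using assms by (simp add: \<delta>_def field_simps)
    finally show ?thesis using R by linarith
  qed
  finally have "(\<integral>y. real (D y) \<partial>dyadic_space) < \<eta>" .
  then show ?thesis using D_int unfolding D_def Let_def by blast
qed

end

section \<open>Two long names in blocks of different types\<close>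

context kakutani
begin

text \<open>Along the odometer the words \<open>G\<close> form a periodic sequence, and the
  concatenations from all phases share \<open>per\<close>. So the names of any two points of
  \<open>Q\<close> are close to each other. But \<open>Q\<close> is too large for a single type, and
  names read in blocks of different types are far apart by \<open>blk_far\<close>.\<close>

lemma contradiction: False
proof -
  define \<alpha> where "\<alpha> = \<mu> A"
  define \<kappa> where "\<kappa> = (\<integral>y. real (length (exc y)) \<partial>dyadic_space)"
  \<comment> \<open>Two exceptional sets of measure at most \<theta> each will be removed from
    \<open>good\<close>, which leaves \<alpha> / 2.\<close>
  define \<theta> where "\<theta> = \<alpha> / 4"
  define a where "a = \<kappa> / 32"
  \<comment> \<open>With a mean cost below \<open>a * \<theta>\<close>, Markov's inequality bounds
    by \<theta> the measure of the points where the average cost reaches \<open>a\<close>.\<close>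
  define \<eta> where "\<eta> = a * \<theta>"
  have \<alpha>: "0 < \<alpha>" "\<alpha> \<le> 1" using A_pos by (simp_all add: \<alpha>_def)
  have \<kappa>: "0 < \<kappa>" using integral_exc_ge \<alpha> by (simp add: \<kappa>_def \<alpha>_def)
  have \<theta>: "0 < \<theta>" "\<theta> \<le> 1 / 4" using \<alpha> by (simp_all add: \<theta>_def)
  have a: "0 < a" using \<kappa> by (simp add: a_def)
  have \<eta>: "0 < \<eta>" using a \<theta> by (simp add: \<eta>_def)
  obtain l G where lG: "let D = (\<lambda>y. if exc y = G (val l y) then 0 else length (exc y) + length (G (val l y))) in
    integrable dyadic_space (\<lambda>y. real (D y)) \<and> (\<integral>y. real (D y) \<partial>dyadic_space) < \<eta>"
    using exc_approx[OF \<eta>] by (elim exE)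
  define D where "D = (\<lambda>y. if exc y = G (val l y) then 0 else length (exc y) + length (G (val l y)))"
  have D: "integrable dyadic_space (\<lambda>y. real (D y))" "(\<integral>y. real (D y) \<partial>dyadic_space) < \<eta>"
    using lG unfolding Let_def D_def[symmetric] by auto
  define L where "L = (2::nat) ^ l"
  define w where "w = length (concat (map G [0..<L]))"
  have w_sum: "real w = (\<Sum>v<L. real (length (G v)))"
    by (simp add: w_def length_concat o_def sum_list_distinct_conv_sum_set atLeast0LessThan)
  have L: "L \<ge> 1" by (simp add: L_def)
  have intG: "integrable dyadic_space (\<lambda>y. real (length (G (val l y))))"
    "(\<integral>y. real (length (G (val l y))) \<partial>dyadic_space) = real w / L"
  proof -
    let ?C = "\<lambda>v. cyl l v"
    have C_int: "integrable dyadic_space (indicator (?C v) :: _ \<Rightarrow> real)" for v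
      by (intro integrable_real_indicator) (auto simp: dyadic.emeasure_eq_measure)
    have eq: "real (length (G (val l y))) = (\<Sum>v<L. real (length (G v)) * indicator (?C v) y)" if y: "y \<in> \<Omega>" for y
    proof -
      have "(\<Sum>v<L. real (length (G v)) * indicator (?C v) y) = (\<Sum>v<L. if v = val l y then real (length (G v)) else 0)"
        using y by (intro sum.cong) (auto simp: indicator_def)
      then show ?thesis using bits_val_less[OF y, of 0 l] by (simp add: L_def)
    qed
    have int: "integrable dyadic_space (\<lambda>y. \<Sum>v<L. real (length (G v)) * indicator (?C v) y)"
      using C_int by (intro Bochner_Integration.integrable_sum integrable_mult_right) auto
    show "integrable dyadic_space (\<lambda>y. real (length (G (val l y))))"
      using int by (subst Bochner_Integration.integrable_cong[OF refl eq]) auto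
    have "(\<integral>y. real (length (G (val l y))) \<partial>dyadic_space) = (\<integral>y. (\<Sum>v<L. real (length (G v)) * indicator (?C v) y) \<partial>dyadic_space)"
      by (rule Bochner_Integration.integral_cong[OF refl eq])
    also have "\<dots> = (\<Sum>v<L. \<integral>y. real (length (G v)) * indicator (?C v) y \<partial>dyadic_space)"
      using C_int by (intro Bochner_Integration.integral_sum integrable_mult_right) auto
    also have "\<dots> = (\<Sum>v<L. real (length (G v)) * (1 / L))"
    proof (intro sum.cong refl)
      fix v assume "v \<in> {..<L}"
      then have v: "v < 2 ^ l" by (simp add: L_def)
      have "?C v \<inter> \<Omega> = ?C v" by auto
      then have "(\<integral>y. indicator (?C v) y \<partial>dyadic_space) = \<mu> (?C v)"
        using Bochner_Integration.integral_indicator[of dyadic_space "?C v"] by (simp only:)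
      also have "\<dots> = 1 / L" using measure_bits_val[OF v, of 0] by (simp add: L_def)
      finally show "(\<integral>y. real (length (G v)) * indicator (?C v) y \<partial>dyadic_space) = real (length (G v)) * (1 / L)"
        by (simp only: integral_mult_right_zero)
    qed
    also have "\<dots> = real w / L" by (simp add: w_sum sum_divide_distrib)
    finally show "(\<integral>y. real (length (G (val l y))) \<partial>dyadic_space) = real w / L" .
  qed
  have D_ge: "length (exc y) \<le> length (G (val l y)) + D y" "length (G (val l y)) \<le> length (exc y) + D y" for y
    by (auto simp: D_def)
  have "\<kappa> \<le> (\<integral>y. real (length (G (val l y))) + real (D y) \<partial>dyadic_space)"
    unfolding \<kappa>_def
  proof (rule integral_mono[OF integrable_exc])
    show "integrable dyadic_space (\<lambda>y. real (length (G (val l y))) + real (D y))"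
      using intG(1) D(1) by (rule Bochner_Integration.integrable_add)
    fix y show "real (length (exc y)) \<le> real (length (G (val l y))) + real (D y)" using D_ge(1)[of y] by linarith
  qed
  also have "\<dots> = real w / L + (\<integral>y. real (D y) \<partial>dyadic_space)"
    using Bochner_Integration.integral_add[OF intG(1) D(1)] intG(2) by simp
  finally have "\<kappa> < real w / L + \<eta>" using D(2) by linarith
  moreover have "\<eta> \<le> \<kappa> / 2"
  proof -
    have "a * \<theta> \<le> a * 1" using a \<theta> by (intro mult_left_mono) auto
    then show ?thesis using \<kappa> by (simp add: \<eta>_def a_def)
  qed
  ultimately have "\<kappa> / 2 \<le> real w / L" by linarith
  then have wL: "L * \<kappa> \<le> 2 * w" using L by (simp add: field_simps)
  have "0 < real L * \<kappa>" using L \<kappa> by simp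
  \<comment> \<open>The period is not empty, since its words have mean length at least \<kappa> /
    2.\<close>
  then have w: "0 < w" using wL by linarith
  \<comment> \<open>Large for three purposes: the period is short against the block
    (\<open>c1\<close>), the additive error of \<open>blk_far\<close> is small (\<open>c2\<close>),
    and a single type has measure less than \<alpha> / 2 (\<open>c3\<close>).\<close>
  obtain n where n: "64 * w / \<theta> + 2560 / \<theta> + 2 / \<alpha> < 2 ^ n"
    using real_arch_pow[of 2 "64 * w / \<theta> + 2560 / \<theta> + 2 / \<alpha>"] by auto
  have nn: "0 \<le> 64 * w / \<theta>" "0 \<le> 2560 / \<theta>" "0 \<le> 2 / \<alpha>" using \<theta> \<alpha> by simp_all
  have n1: "64 * w / \<theta> < 2 ^ n" and n2: "2560 / \<theta> < 2 ^ n" and n3: "2 / \<alpha> < 2 ^ n" using n nn by linarith+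
  define H :: real where "H = 2 ^ blen n"
  have H: "2 ^ n \<le> H" unfolding H_def using blen_ge[of n] by (intro power_increasing) auto
  have H0: "0 < H" by (simp add: H_def)
  have c1: "64 * w \<le> \<theta> * H"
  proof -
    have "64 * w / \<theta> \<le> H" using n1 H by linarith
    then show ?thesis using \<theta> by (simp add: pos_divide_le_eq mult.commute)
  qed
  have c2: "160 / 4 ^ (n + 8) * H \<le> \<theta> * H / 16"
  proof -
    have "(2::real) ^ n \<le> 4 ^ n" by (rule power_mono) auto
    also have "(4::real) ^ n \<le> 4 ^ (n + 8)" by (rule power_increasing) auto
    finally have "2560 / \<theta> \<le> 4 ^ (n + 8)" using n2 by linarith
    then have "160 / 4 ^ (n + 8) \<le> \<theta> / 16" using \<theta> by (simp add: field_simps)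
    then have "160 / 4 ^ (n + 8) * H \<le> \<theta> / 16 * H" using H0 by (intro mult_right_mono) auto
    then show ?thesis by simp
  qed
  have c3: "1 / 2 ^ (n + 8) < \<alpha> / 2"
  proof -
    have "(2::real) ^ n \<le> 2 ^ (n + 8)" by (rule power_increasing) auto
    then have "2 / \<alpha> < 2 ^ (n + 8)" using n3 by linarith
    then show ?thesis using \<alpha> by (simp add: field_simps)
  qed
  \<comment> \<open>As many periods as fit into half of \<open>\<theta> * H\<close>. Even with its
    errors, the name is then no longer than \<open>\<theta> * H\<close> and fits behind a position
    of at most \<open>(1 - \<theta>) * H\<close>.\<close>
  define K where "K = nat \<lfloor>\<theta> * H / (2 * w)\<rfloor>"
  have "1 \<le> \<theta> * H / (2 * w)" using c1 w by (simp add: field_simps)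
  then have K1: "K \<ge> 1" and K2: "real K \<le> \<theta> * H / (2 * w)" and K3: "\<theta> * H / (2 * w) < real K + 1"
    by (simp_all add: K_def le_nat_iff)
  have Kw: "real K * w \<le> \<theta> * H / 2" "\<theta> * H / 2 - w < real K * w"
  proof -
    have "real K * w \<le> \<theta> * H / (2 * w) * w" using K2 by (intro mult_right_mono) auto
    then show "real K * w \<le> \<theta> * H / 2" using w by simp
    have "\<theta> * H / (2 * w) * w < (real K + 1) * w" using K3 w by (intro mult_strict_right_mono) auto
    then show "\<theta> * H / 2 - w < real K * w" using w by (simp add: algebra_simps)
  qed
  define M where "M = K * L"
  have M0: "0 < real M" using K1 L by (simp add: M_def)
  \<comment> \<open>The cost allowed on the whole stretch, compared with the block through
    \<open>L * \<kappa> \<le> 2 * w\<close>.\<close>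
  have aM: "a * M \<le> \<theta> * H / 32"
  proof -
    have "a * M = real K * (real L * \<kappa>) / 32" by (simp add: a_def M_def)
    also have "\<dots> \<le> real K * (2 * w) / 32" using wL by (intro divide_right_mono mult_left_mono) auto
    also have "\<dots> \<le> \<theta> * H / 32" using Kw(1) by simp
    finally show ?thesis .
  qed
  define DM where "DM = (\<lambda>y. \<Sum>t<M. real (D ((dyadic_odometer ^^ t) y)))"
  have DM_int: "integrable dyadic_space DM" "(\<integral>y. DM y \<partial>dyadic_space) = M * (\<integral>y. real (D y) \<partial>dyadic_space)"
  proof -
    note f = integral_funpow[OF aut_odometer D(1)]
    show "integrable dyadic_space DM" unfolding DM_def by (intro Bochner_Integration.integrable_sum f)
    have "(\<integral>y. DM y \<partial>dyadic_space) = (\<Sum>t<M. \<integral>y. real (D ((dyadic_odometer ^^ t) y)) \<partial>dyadic_space)"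
      unfolding DM_def by (intro Bochner_Integration.integral_sum f)
    then show "(\<integral>y. DM y \<partial>dyadic_space) = M * (\<integral>y. real (D y) \<partial>dyadic_space)" using f(2) by simp
  qed
  define bad1 where "bad1 = {y \<in> \<Omega>. DM y \<ge> a * M}"
  have bad1: "bad1 \<in> sets dyadic_space"
  proof -
    have [measurable]: "DM \<in> borel_measurable dyadic_space" using DM_int(1) by simp
    show ?thesis unfolding bad1_def by measurable
  qed
  have "\<mu> bad1 \<le> (\<integral>y. DM y \<partial>dyadic_space) / (a * M)"
    unfolding bad1_def using a M0
    by (intro integral_Markov_inequality_measure[OF DM_int(1), of "{}"]) (auto simp: DM_def intro!: AE_I2 sum_nonneg)
  also have "\<dots> = (\<integral>y. real (D y) \<partial>dyadic_space) / a" using M0 DM_int(2) by simp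
  also have "\<dots> \<le> \<theta>" using D(2) a by (simp add: \<eta>_def pos_divide_le_eq mult.commute)
  finally have bad1_le: "\<mu> bad1 \<le> \<theta>" .
  \<comment> \<open>The points with expensive names, and next those too close to the end of their
    block.\<close>
  define P1 where "P1 = \<phi> -` (bad1 \<inter> Y0) \<inter> X0"
  define P2 where "P2 = {x \<in> nonconst. real (pos n x) > (1 - \<theta>) * 2 ^ blen n}"
  have "bad1 \<inter> Y0 \<in> sets dyadic_space" using bad1 Y0 by blast
  from preimg[OF this] have P1: "P1 \<in> sets dyadic_space" "\<mu> P1 = \<mu> (bad1 \<inter> Y0)"
    by (auto simp: P1_def)
  have P1_le: "\<mu> P1 \<le> \<theta>"
  proof -
    have "\<mu> (bad1 \<inter> Y0) \<le> \<mu> bad1" using bad1 by (intro dyadic.finite_measure_mono) auto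
    then show ?thesis using P1(2) bad1_le by linarith
  qed
  have P2: "P2 \<in> sets dyadic_space"
  proof -
    have "P2 = nonconst \<inter> {x \<in> \<Omega>. pos n x \<in> {p. real p > (1 - \<theta>) * 2 ^ blen n}}"
      by (auto simp: P2_def nonconst_in)
    also have "\<dots> \<in> sets dyadic_space" by (intro sets.Int sets_nonconst) measurable
    finally show ?thesis .
  qed
  have P2_le: "\<mu> P2 \<le> \<theta>" unfolding P2_def using \<theta> by (intro measure_pos_gt) auto
  define Q where "Q = good - (P1 \<union> P2)"
  have Q: "Q \<in> sets dyadic_space" unfolding Q_def using P1 P2 by (intro sets.Diff sets_good sets.Un)
  have "\<alpha> \<le> \<mu> (Q \<union> (P1 \<union> P2))"
    unfolding \<alpha>_def measure_good[symmetric] using Q P1 P2 by (intro dyadic.finite_measure_mono) (auto simp: Q_def)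
  also have "\<dots> \<le> \<mu> Q + \<mu> (P1 \<union> P2)" using Q P1 P2 by (intro measure_Un_le) auto
  also have "\<mu> (P1 \<union> P2) \<le> \<mu> P1 + \<mu> P2" using P1 P2 by (intro measure_Un_le)
  finally have Q_ge: "\<alpha> / 2 \<le> \<mu> Q" using P1_le P2_le by (simp add: \<theta>_def)
  have types: "\<exists>x\<in>Q. \<exists>x'\<in>Q. btype n x \<noteq> btype n x'"
  proof (rule ccontr)
    assume "\<not> ?thesis"
    then have same: "btype n x = btype n x'" if "x \<in> Q" "x' \<in> Q" for x x' using that by blast
    have "Q \<noteq> {}" using Q_ge \<alpha> by auto
    then obtain x0 where x0: "x0 \<in> Q" by blast
    then have x0': "x0 \<in> \<Omega>" using good_sub by (auto simp: Q_def)
    have "\<mu> Q \<le> \<mu> {x \<in> \<Omega>. bits_val (blen n) (n + 8) x = btype n x0}"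
    proof (rule dyadic.finite_measure_mono)
      show "Q \<subseteq> {x \<in> \<Omega>. bits_val (blen n) (n + 8) x = btype n x0}"
        using same[OF _ x0] good_sub by (auto simp: Q_def btype_def)
    qed simp
    also have "\<dots> = 1 / 2 ^ (n + 8)" by (rule measure_bits_val[OF btype_less[OF x0']])
    finally show False using Q_ge c3 by linarith
  qed
  define V where "V = (\<lambda>y. concat (map (\<lambda>t. exc ((dyadic_odometer ^^ t) y)) [0..<M]))"
  define W where "W = (\<lambda>y. concat (map (\<lambda>t. G (val l ((dyadic_odometer ^^ t) y))) [0..<M]))"
  have W_eq: "W y = concat (map (\<lambda>t. G ((val l y + t) mod L)) [0..<K * L])" if y: "y \<in> \<Omega>" for y
  proof -
    have "val l ((dyadic_odometer ^^ t) y) = (val l y + t) mod L" for t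
      using val_odometer_funpow[of l t y] bits_val_less[OF aut_funpow_in[OF aut_odometer y], of 0 l t] by (simp add: L_def)
    then show ?thesis by (simp add: W_def M_def)
  qed
  define per where "per = concat (replicate (K - 1) (concat (map G [0..<L])))"
  have len_per: "length per = (K - 1) * w" by (simp add: per_def w_def length_concat sum_list_replicate)
  have W_len: "length (W y) = K * w" and W_per: "subseq per (W y)" if y: "y \<in> \<Omega>" for y
  proof -
    have v: "val l y < L" using bits_val_less[OF y, of 0 l] by (simp add: L_def)
    show "length (W y) = K * w" unfolding W_eq[OF y] w_def by (rule length_periodic[OF v])
    show "subseq per (W y)" unfolding W_eq[OF y] per_def by (rule subseq_periodic[OF v K1])
  qed
  have V: "sublist (V (\<phi> x)) (blk n (btype n x)) \<and> real (K * w) - \<theta> * H / 32 \<le> length (V (\<phi> x)) \<and>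
      (\<exists>s. subseq s (V (\<phi> x)) \<and> subseq s (W (\<phi> x)) \<and> real (length (V (\<phi> x))) + real (K * w) \<le> 2 * real (length s) + \<theta> * H / 32)"
    if x: "x \<in> Q" for x
  proof -
    have xg: "x \<in> good" using x by (simp add: Q_def)
    then have xn: "x \<in> nonconst" and xX: "x \<in> X0" using good_nonconst good_sub by auto
    let ?y = "\<phi> x"
    have yY: "?y \<in> Y0" using xX bij_betwE[OF bij] by blast
    then have y: "?y \<in> \<Omega>" using sets.sets_into_space[OF Y0(2)] by blast
    have "?y \<notin> bad1" using x xX yY by (auto simp: Q_def P1_def)
    then have "DM ?y < a * M" using y by (simp add: bad1_def)
    then have dm: "DM ?y \<le> \<theta> * H / 32" using aM by linarith
    obtain s where s: "subseq s (V ?y)" "subseq s (W ?y)"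
      "length (V ?y) + length (W ?y) \<le> 2 * length s + (\<Sum>t\<leftarrow>[0..<M]. D ((dyadic_odometer ^^ t) ?y))"
      using subseq_concat_common[of "\<lambda>t. exc ((dyadic_odometer ^^ t) ?y)" "[0..<M]" "\<lambda>t. G (val l ((dyadic_odometer ^^ t) ?y))"]
      unfolding V_def W_def D_def by (elim exE conjE)
    have DM_eq: "DM ?y = real (\<Sum>t\<leftarrow>[0..<M]. D ((dyadic_odometer ^^ t) ?y))"
      by (simp add: DM_def sum_list_distinct_conv_sum_set atLeast0LessThan)
    have "real (length (V ?y) + length (W ?y)) \<le> real (2 * length s + (\<Sum>t\<leftarrow>[0..<M]. D ((dyadic_odometer ^^ t) ?y)))"
      using s(3) by (rule of_nat_mono)
    then have s3: "real (length (V ?y)) + real (K * w) \<le> 2 * real (length s) + DM ?y"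
      unfolding DM_eq W_len[OF y] by simp
    have ls: "length s \<le> length (V ?y)" "length s \<le> K * w"
      using s(1,2) W_len[OF y] by (auto dest: list_emb_length)
    have ls': "real (length s) \<le> real (length (V ?y))" "real (length s) \<le> real (K * w)"
      using ls by (simp_all only: of_nat_le_iff)
    have lo: "real (K * w) - \<theta> * H / 32 \<le> length (V ?y)" using s3 ls' dm by linarith
    have hi: "real (length (V ?y)) \<le> \<theta> * H"
    proof -
      have "real (length (V ?y)) \<le> real (K * w) + \<theta> * H / 32" using s3 ls' dm by linarith
      moreover have "real (K * w) \<le> \<theta> * H / 2" using Kw(1) by simp
      moreover have "0 \<le> \<theta> * H" using \<theta> H0 by simp
      ultimately show ?thesis by linarith
    qed
    obtain m where m: "V ?y = name x m" using concat_exc[OF xg, of M] unfolding V_def by (elim exE)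
    then have lm: "length (V ?y) = m" by simp
    have "real (pos n x) \<le> (1 - \<theta>) * H" using x xn by (auto simp: Q_def P2_def H_def)
    then have "real (pos n x) + real m \<le> H" using hi lm by (simp add: left_diff_distrib)
    then have "real (pos n x + m) \<le> real (2 ^ blen n)" by (simp add: H_def)
    then have "pos n x + m \<le> 2 ^ blen n" by (simp only: of_nat_le_iff)
    then have "sublist (V ?y) (blk n (btype n x))" unfolding m by (rule name_sublist[OF xn])
    moreover have "real (length (V ?y)) + real (K * w) \<le> 2 * real (length s) + \<theta> * H / 32" using s3 dm by linarith
    ultimately show ?thesis using lo s(1,2) by blast
  qed
  obtain x x' where xx: "x \<in> Q" "x' \<in> Q" "btype n x \<noteq> btype n x'" using types by blast
  let ?V = "V (\<phi> x)" and ?V' = "V (\<phi> x')" and ?W = "W (\<phi> x)" and ?W' = "W (\<phi> x')"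
  have sp: "x \<in> \<Omega>" "x' \<in> \<Omega>" and spy: "\<phi> x \<in> \<Omega>" "\<phi> x' \<in> \<Omega>"
  proof -
    have g: "x \<in> good" "x' \<in> good" using xx by (auto simp: Q_def)
    then show "x \<in> \<Omega>" "x' \<in> \<Omega>" using good_sub by auto
    have "\<phi> x \<in> Y0" "\<phi> x' \<in> Y0" using g good_sub bij_betwE[OF bij] by auto
    then show "\<phi> x \<in> \<Omega>" "\<phi> x' \<in> \<Omega>" using sets.sets_into_space[OF Y0(2)] by auto
  qed
  from V[OF xx(1)] obtain s where s: "subseq s ?V" "subseq s ?W" "real (length ?V) + real (K * w) \<le> 2 * real (length s) + \<theta> * H / 32"
    and sub: "sublist ?V (blk n (btype n x))" and lo: "real (K * w) - \<theta> * H / 32 \<le> length ?V" by blast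
  from V[OF xx(2)] obtain s' where s': "subseq s' ?V'" "subseq s' ?W'" "real (length ?V') + real (K * w) \<le> 2 * real (length s') + \<theta> * H / 32"
    and sub': "sublist ?V' (blk n (btype n x'))" and lo': "real (K * w) - \<theta> * H / 32 \<le> length ?V'" by blast
  \<comment> \<open>Passing to \<open>per\<close> loses at most \<open>w\<close> letters of
    \<open>s\<close>. As \<open>per\<close> is also a subsequence of \<open>?W'\<close>, what
    remains is intersected there with \<open>s'\<close>.\<close>
  obtain r where r: "subseq r s" "subseq r per" "length s + length per \<le> length r + length ?W"
    using subseq_common[OF s(2) W_per[OF spy(1)]] by (elim exE conjE)
  have rW: "subseq r ?W'" by (rule subseq_order.order_trans[OF r(2) W_per[OF spy(2)]])
  obtain q where q: "subseq q r" "subseq q s'" "length r + length s' \<le> length q + length ?W'"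
    using subseq_common[OF rW s'(2)] by (elim exE conjE)
  have "length per + w = K * w"
  proof -
    have "(K - 1) * w + w = (K - 1 + 1) * w" by (simp add: algebra_simps)
    then show ?thesis using K1 by (simp add: len_per)
  qed
  then have "length s + length s' \<le> length q + w + K * w"
    using r(3) q(3) W_len[OF spy(1)] W_len[OF spy(2)] by linarith
  then have "real (length s + length s') \<le> real (length q + w + K * w)" by (rule of_nat_mono)
  then have q3: "real (length s) + real (length s') \<le> real (length q) + real w + real (K * w)" by simp
  have qV: "subseq q ?V" "subseq q ?V'"
    using q(1,2) r(1) s(1) s'(1) by (meson subseq_order.order_trans)+
  have "far_sub (1 / 4 - 56 / 2 ^ (n + 8)) (160 / 4 ^ (n + 8) * 2 ^ blen n) (blk n (btype n x)) (blk n (btype n x'))"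
    by (rule blk_far[OF btype_less[OF sp(1)] btype_less[OF sp(2)] xx(3)])
  then have far: "far_sub (1 / 4) (\<theta> * H / 16) (blk n (btype n x)) (blk n (btype n x'))"
  proof (rule far_sub_mono)
    show "160 / 4 ^ (n + 8) * 2 ^ blen n \<le> \<theta> * H / 16" using c2 by (simp only: H_def)
  qed simp
  \<comment> \<open>Here \<open>h\<close> is \<open>\<theta> * H\<close> and \<open>m\<close> is
    \<open>w\<close>. Closeness and \<open>blk_far\<close> bound 3 / 4 of the total length by h / 8
    + 2 m, while the total length exceeds 15 h / 16 - 2 m. As m \<le> h / 64, in units of h / 64
    this reads 45 < 8 + 7 / 2.\<close>
  have arith: False
    if "2 * c \<le> 1 / 4 * (u + u') + h / 16" "64 * m \<le> h" "0 < h" "p + p' \<le> c + m + k"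
      "u + k \<le> 2 * p + h / 32" "u' + k \<le> 2 * p' + h / 32" "k - h / 32 \<le> u" "k - h / 32 \<le> u'" "h / 2 - m < k"
    for c u u' h m p p' k :: real
  proof -
    have "u + u' - h / 16 - 2 * m \<le> 2 * c" using that(4-6) by (simp add: field_simps)
    then have "3 / 4 * (u + u') \<le> h / 8 + 2 * m" using that(1) by (simp add: field_simps)
    moreover have "h - 2 * m - h / 16 \<le> u + u'" using that(7-9) by (simp add: field_simps)
    ultimately show False using that(2,3) by (simp add: field_simps)
  qed
  show False
  proof (rule arith[OF _ _ _ q3 s(3) s'(3) lo lo'])
    show "2 * real (length q) \<le> 1 / 4 * (real (length ?V) + real (length ?V')) + \<theta> * H / 16"
      by (rule farD[OF far_subD[OF far sub sub'] qV])
    show "64 * real w \<le> \<theta> * H" using c1 by simp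
    show "0 < \<theta> * H" using \<theta> H0 by simp
    show "\<theta> * H / 2 - real w < real (K * w)" using Kw(2) by simp
  qed
qed

end

theorem theorem1:
  shows "\<exists>(M :: (nat \<Rightarrow> nat) measure) T.
     standard_atomless_prob_space M \<and> aut M T \<and> ergodic M T \<and>
     L_less_orbit_equivalent (1/2) M T dyadic_space dyadic_odometer \<and>
     Shannon_orbit_equivalent M T dyadic_space dyadic_odometer \<and>
     \<not> evenly_Kakutani_equivalent M T dyadic_space dyadic_odometer"
proof (intro exI conjI)
  show "standard_atomless_prob_space dyadic_space" by (rule standard_atomless_dyadic)
  show "aut dyadic_space odomutant" by (rule aut_odomutant)
  show "ergodic dyadic_space odomutant" by (rule ergodic_odomutant)
  show "L_less_orbit_equivalent (1/2) dyadic_space odomutant dyadic_space dyadic_odometer"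
    by (rule L_less_orbit_equivalent_odomutant)
  show "Shannon_orbit_equivalent dyadic_space odomutant dyadic_space dyadic_odometer"
    by (rule Shannon_orbit_equivalent_odomutant)
  show "\<not> evenly_Kakutani_equivalent dyadic_space odomutant dyadic_space dyadic_odometer"
    using evenly_Kakutani_equivalentD kakutani.contradiction by blast
qed

end
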